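(* Let $d \ge 3$, $S \in \mathcal{S}^d(1)$ and $l \in \{1, \ldots, d\}$. Then \[ \max_{F \in \mathcal{F}_l(S)} \operatorname{vol}_{\mathbb{Z}}(F) \le \frac{2(s_d - 1)^2}{l!\,(s_{d-l+1} - 1)}. \] Moreover: (a) if $S$ is unimodularly equivalent to $S^d_1$, equality holds (for every $l$); (b) if $d \ge 4$ and $l \in \{1, d\}$, equality holds if and only if $S$ is unimodularly equivalent to $S^d_1$. In particular, for $l=d$, every $S\in\mathcal{S}^d(1)$ satisfies $\operatorname{vol}(S) \le \frac{2}{d!}(s_d-1)^2$.
   Context: The Sylvester sequence: $s_1 = 2$, $s_i = \prod_{j=1}^{i-1} s_j + 1$ for $i\ge 2$. $\mathcal{S}^d(1)$ is the set of $d$-dimensional simplices in $\mathbb{R}^d$ with vertices in $\mathbb{Z}^d$ and exactly one integral point in their interior. $\mathcal{F}_l(S)$ is the set of $l$-dimensional faces of $S$. For a rational polytope $F$ of dimension $i$, $\operatorname{vol}_{\mathbb{Z}}(F) := \operatorname{vol}_i(F)/\det(\Lambda)$, where $\Lambda = \mathbb{Z}^d \cap \operatorname{lin}\{x-y : x,y\in F\}$ and $\operatorname{vol}_i$ is $i$-dimensional Euclidean volume. $S^d_1 := \operatorname{conv}(\{0, s_1 e_1, \ldots, s_{d-1}e_{d-1}, 2(s_d-1)e_d\})$. Unimodular equivalence: existence of an affine bijection of $\mathbb{R}^d$ preserving $\mathbb{Z}^d$ mapping one polytope onto the other. *)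

theory Defs
  imports "HOL-Analysis.Analysis"
begin

text \<open>s 1 = 2, s i = (prod of s j for j = 1..i-1) + 1. The value at index 0 is junk (2).\<close>
function sylv :: "nat \<Rightarrow> nat" where
  "sylv i = (if i \<le> 1 then 2 else (\<Prod>j\<in>{1..<i}. sylv j) + 1)"
  by auto
termination
  by (relation "Wellfounded.measure id") auto

definition Zd :: "(real^'n) set" where
  "Zd = {x. \<forall>i. x $ i \<in> \<int>}"

definition diff_space :: "'a::euclidean_space set \<Rightarrow> 'a set" where
  "diff_space F = span {x - y | x y. x \<in> F \<and> y \<in> F}"

definition is_onb :: "'a::euclidean_space set \<Rightarrow> nat \<Rightarrow> (nat \<Rightarrow> 'a) \<Rightarrow> bool" where
  "is_onb V i u \<longleftrightarrow> (\<forall>k<i. u k \<in> V) \<and>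
     (\<forall>j<i. \<forall>k<i. u j \<bullet> u k = (if j = k then 1 else 0)) \<and> span (u ` {..<i}) = V"

definition euclid_vol :: "'a::euclidean_space set \<Rightarrow> real" where
  "euclid_vol F =
    (let V = diff_space F; i = dim V; u = (SOME u. is_onb V i u); a = (SOME a. a \<in> F);
         M = PiM {..<i} (\<lambda>_. lborel)
     in measure M {t \<in> space M. a + (\<Sum>k<i. t k *\<^sub>R u k) \<in> F})"

definition lattice_of :: "(real^'n) set \<Rightarrow> (real^'n) set" where
  "lattice_of F = Zd \<inter> diff_space F"

definition is_lattice_basis :: "'a::euclidean_space set \<Rightarrow> nat \<Rightarrow> (nat \<Rightarrow> 'a) \<Rightarrow> bool" where
  "is_lattice_basis L i b \<longleftrightarrow> inj_on b {..<i} \<and> independent (b ` {..<i}) \<and>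
     L = {\<Sum>k<i. of_int (z k) *\<^sub>R b k | z. True}"

definition lattice_det :: "'a::euclidean_space set \<Rightarrow> real" where
  "lattice_det L =
    (let i = dim (span L); b = (SOME b. is_lattice_basis L i b)
     in euclid_vol {\<Sum>k<i. t k *\<^sub>R b k | t. \<forall>k<i. 0 \<le> t k \<and> t k \<le> 1})"

definition volZ :: "(real^'n) set \<Rightarrow> real" where
  "volZ F = euclid_vol F / lattice_det (lattice_of F)"

definition faces_of_dim :: "nat \<Rightarrow> 'a::euclidean_space set \<Rightarrow> 'a set set" where
  "faces_of_dim l S = {F. F face_of S \<and> aff_dim F = int l}"

definition lattice_simplices_one :: "(real^'n) set set" where
  "lattice_simplices_one =
    {S. \<exists>C. \<not> affine_dependent C \<and> card C = CARD('n) + 1 \<and> C \<subseteq> Zd \<and> S = convex hull C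
         \<and> card (interior S \<inter> Zd) = 1}"

definition unimod_equiv :: "(real^'n) set \<Rightarrow> (real^'n) set \<Rightarrow> bool" where
  "unimod_equiv P Q \<longleftrightarrow> (\<exists>g b. linear g \<and> bij (\<lambda>x. g x + b) \<and>
      (\<lambda>x. g x + b) ` Zd = Zd \<and> (\<lambda>x. g x + b) ` P = Q)"

text \<open>S^d_1 = conv{0, s_1 e_1, ..., s_(d-1) e_(d-1), 2(s_d - 1) e_d}, where the coordinates
  of real^'n are numbered 1..d by a fixed (arbitrary) bijection; the choice is irrelevant up
  to unimodular equivalence.\<close>
definition coord_enum :: "nat \<Rightarrow> 'n::finite" where
  "coord_enum = (SOME e. bij_betw e {1..CARD('n)} (UNIV :: 'n set))"

definition S_d_1 :: "(real^'n) set" where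
  "S_d_1 = (let d = CARD('n); e = (coord_enum :: nat \<Rightarrow> 'n) in
     convex hull ({0} \<union> {axis (e i) (real (sylv i)) | i. 1 \<le> i \<and> i \<le> d - 1}
                   \<union> {axis (e d) (2 * (real (sylv d) - 1))}))"

end

theory Submission
  imports Defs
begin

text \<open>
  Let \<open>\<beta>\<close> be the barycentric coordinates of the interior lattice point. A small nonzero lattice
  perturbation of \<open>\<beta>\<close> would produce a second interior lattice point, so Minkowski's theorem on linear
  forms gives two families of inequalities: the product of \<open>\<beta>\<close> over a proper subset of the vertices is
  at most its sum over the remaining vertices, and \<open>l! * vol(F)\<close> times the product of \<open>\<beta>\<close> over all but
  one vertex of an \<open>l\<close>-face \<open>F\<close> is at most 1.

  Sort the coordinates as \<open>x 1 \<ge> \<dots> \<ge> x (d + 1)\<close>. Abel summation together with \<open>ln z \<le> z - 1\<close> turns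
  the product-sum inequalities into lower bounds \<open>1 / (s (t + 1) - 1)\<close> for the tails of \<open>x\<close>, and a
  descent that either compares with the Sylvester sequence by the same inequality or averages one more
  entry into the tail bounds \<open>x k * \<dots> * x d\<close> from below.

  In the equality cases \<open>x\<close> is the Sylvester sequence ending in two equal terms, and the edge between
  the two vertices of least weight is divisible by \<open>2 * (s d - 1)\<close>. Since the Sylvester numbers are
  pairwise coprime, the interior lattice point then shows that each of the other edges is divisible by its
  Sylvester number, and the volume bound forces the quotients to form a lattice basis.
\<close>

section \<open>Sylvester sequence and product-sum inequalities\<close>

text \<open>Halving the last term of \<open>1 = 1/s_1 + ... + 1/s_(d-1) + 1/(s_d - 1)\<close> gives
  \<open>d + 1\<close> weights whose product over the positions \<open>d - l + 1\<close> to
  \<open>d\<close> is the reciprocal of \<open>l!\<close> times the claimed bound; hence the factor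
  2 and the denominator \<open>s_(d-l+1) - 1\<close>. The rivals are sequences that follow the
  Sylvester sequence up to some position and are constant afterwards. In dimension 2 the rival
  \<open>(1/3, 1/3, 1/3)\<close> wins, as \<open>1/9 < 1/8\<close>. In dimension 3 the rival
  \<open>(1/2, 1/6, 1/6, 1/6)\<close> ties, as \<open>1/2 * 1/6 * 1/6 = 1/2 * 1/3 * 1/12\<close>.
  From dimension 4 on they all lose strictly. This explains both dimension hypotheses.

  In the equality cases the weights must be turned back into lattice points. For
  \<open>l = 1\<close> the extremal edge itself has the required lattice length. For
  \<open>l = d\<close> equality says only that a box has exactly the volume of a lattice cell, where
  Minkowski's theorem is silent; there Blichfeldt's theorem is applied to this box together with a
  small cube, whose position decides which lattice vector is found.\<close>

declare sylv.simps [simp del]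

lemma sylv_1: "sylv (Suc 0) = 2"
  by (simp add: sylv.simps)

lemma prod_sylv:
  assumes "1 \<le> i" shows "(\<Prod>j\<in>{1..<i}. sylv j) + 1 = sylv i"
  using assms by (subst (2) sylv.simps) auto

lemma sylv_Suc:
  assumes "1 \<le> i" shows "real (sylv (Suc i)) - 1 = real (sylv i) * (real (sylv i) - 1)"
proof -
  have "sylv (Suc i) = (\<Prod>j\<in>{1..<Suc i}. sylv j) + 1"
    using assms prod_sylv[of "Suc i"] by simp
  also have "{1..<Suc i} = insert i {1..<i}" using assms by auto
  finally have "sylv (Suc i) = sylv i * (\<Prod>j\<in>{1..<i}. sylv j) + 1" by simp
  moreover have "real (sylv i) - 1 = real (\<Prod>j\<in>{1..<i}. sylv j)"
    using prod_sylv[OF assms] by (metis add_diff_cancel_right' of_nat_1 of_nat_add)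
  ultimately show ?thesis by simp
qed

lemma sylv_ge_2: "2 \<le> sylv i"
proof (cases "i \<le> 1")
  case True then show ?thesis by (simp add: sylv.simps)
next
  case False
  have "sylv j > 0" for j by (simp add: sylv.simps)
  then have "(\<Prod>j\<in>{1..<i}. sylv j) \<ge> 1" by (metis One_nat_def Suc_leI prod_pos)
  with False show ?thesis by (subst sylv.simps) (simp del: One_nat_def)
qed

lemma sylv_2: "sylv 2 = 3"
  using sylv_Suc[of 1] by (simp add: sylv_1 numeral_2_eq_2)

lemma sylv_3: "sylv 3 = 7"
proof -
  have "Suc 2 = 3" by simp
  then show ?thesis using sylv_Suc[of 2] by (simp only: sylv_2) simp
qed

lemma sylv_mono:
  assumes "1 \<le> i" "i \<le> j" shows "sylv i \<le> sylv j"
  using assms(2)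
proof (induction rule: dec_induct)
  case (step n)
  have "2 \<le> real (sylv n)" using sylv_ge_2[of n] by simp
  then have "1 * (real (sylv n) - 1) \<le> real (sylv n) * (real (sylv n) - 1)" by (intro mult_right_mono) auto
  moreover have "real (sylv (Suc n)) - 1 = real (sylv n) * (real (sylv n) - 1)"
    using step assms by (intro sylv_Suc) auto
  ultimately have "1 * (real (sylv n) - 1) \<le> real (sylv (Suc n)) - 1" by metis
  with step show ?case by simp
qed simp

text \<open>Telescoping \<open>sylv_Suc\<close> yields the quotient
  \<open>(s_m - 1) / (s_k - 1)\<close>, the form in which Sylvester numbers enter the volume
  bound.\<close>

lemma prod_sylv_real:
  assumes "1 \<le> k" "k \<le> m"
  shows "(\<Prod>i\<in>{k..<m}. real (sylv i)) * (real (sylv k) - 1) = real (sylv m) - 1"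
  using assms(2)
proof (induction rule: dec_induct)
  case (step n)
  then show ?case using sylv_Suc[of n] assms by (simp add: mult_ac)
qed simp

lemma coprime_sylv:
  assumes "1 \<le> i" "1 \<le> j" "i \<noteq> j" shows "coprime (sylv i) (sylv j)"
proof -
  have *: "coprime (sylv i) (sylv j)" if "1 \<le> i" "i < j" for i j
  proof -
    have "sylv i dvd (\<Prod>j\<in>{1..<j}. sylv j)"
      using that by (intro dvd_prodI) auto
    then show ?thesis
      using prod_sylv[of j] that by (metis coprime_add_one_right coprime_commute
       coprime_divisors dvd_refl less_imp_le order_trans)
  qed
  show ?thesis using *[of i j] *[of j i] assms by (meson coprime_commute linorder_neqE_nat)
qed

section \<open>Elementary inequalities for comparing products\<close>

lemma power_bound_step:
  fixes s :: real and m :: nat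
  assumes m: "2 \<le> m" and s: "2 \<le> s" and le: "(s - 1) * (real m + 1) ^ m \<le> s ^ m * real m ^ (m - 1)"
  shows "(s - 1) * (real (Suc m) + 1) ^ (Suc m) < s ^ Suc m * real (Suc m) ^ (Suc m - 1)"
proof -
  obtain p where p: "m = Suc p" using m by (cases m) auto
  define a where "a = real m"
  have a2: "a \<ge> 2" using m by (simp add: a_def)
  \<comment> \<open>From \<open>m\<close> to \<open>m + 1\<close> the quotient of the right side by
    the left side is multiplied by
    \<open>s * (m + 1)^(2 * m) / ((m + 2)^(m + 1) * m^(m - 1))\<close>. This exceeds 1:
    \<open>m * (m + 2) \<le> (m + 1)^2\<close> is used \<open>m - 1\<close> times, and
    \<open>(m + 2)^2 < 2 * (m + 1)^2\<close> covers the remaining square.\<close>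
  have "(a + 2) ^ Suc m * a ^ (m-1) = (a * (a + 2)) ^ p * (a+2)^2"
    by (simp add: p power_mult_distrib power2_eq_square mult_ac)
  also have "\<dots> \<le> ((a+1)^2) ^ p * (a+2)^2"
    using a2 by (intro mult_right_mono power_mono) (auto simp: power2_eq_square algebra_simps)
  also have "\<dots> < ((a+1)^2) ^ p * (s * (a+1)^2)"
  proof -
    have "a * a \<ge> 2 * 2" using a2 by (intro mult_mono) auto
    then have "(a+2)^2 < 2 * (a+1)^2" by (simp add: power2_eq_square algebra_simps)
    also have "\<dots> \<le> s * (a+1)^2" using s by (intro mult_right_mono) auto
    finally show ?thesis using a2 by (intro mult_strict_left_mono) auto
  qed
  also have "\<dots> = s * (a+1)^m * (a+1)^m"
    by (simp add: p power_mult_distrib power2_eq_square mult_ac)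
  finally have A: "(a + 2) ^ Suc m * a ^ (m-1) < s * (a+1)^m * (a+1)^m" .
  have "(s - 1) * (a + 2) ^ Suc m * a ^ (m-1) * (a+1)^m
      = (s - 1) * (a+1)^m * ((a + 2) ^ Suc m * a ^ (m-1))" by (simp add: mult_ac)
  also have "\<dots> < (s - 1) * (a+1)^m * (s * (a+1)^m * (a+1)^m)"
    using A s a2 by (intro mult_strict_left_mono) auto
  also have "\<dots> \<le> (s ^ m * a ^ (m - 1)) * (s * (a+1)^m * (a+1)^m)"
    using le s a2 by (intro mult_right_mono) (auto simp: a_def)
  finally have "(s - 1) * (a + 2) ^ Suc m * (a ^ (m-1) * (a+1)^m) < s ^ Suc m * (a+1)^m * (a ^ (m - 1) * (a+1)^m)"
    by (simp add: mult_ac)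
  then have "(s - 1) * (a + 2) ^ Suc m < s ^ Suc m * (a+1)^m"
    using a2 by (subst (asm) mult_less_cancel_right_pos) auto
  then show ?thesis by (simp add: a_def add_ac)
qed

text \<open>Up to a common factor the two sides are the reciprocals of consecutive comparison values
  \<open>g k t\<close> and \<open>g k (Suc t)\<close>, with \<open>s\<close> the Sylvester number of
  index \<open>t + 1\<close> and \<open>m = d - t\<close>. For \<open>m = 2\<close> the difference
  is \<open>2 * (s - 3) * (s - 3/2)\<close>, which makes \<open>s = 3\<close> the only tie. For
  \<open>s = 2\<close> the inequality is false at \<open>m = 2\<close> and starts with
  \<open>64 \<le> 72\<close> at \<open>m = 3\<close>.\<close>

lemma power_bound:
  fixes s :: real and m :: nat
  assumes "(s \<ge> 3 \<and> m \<ge> 2) \<or> (s = 2 \<and> m \<ge> 3)"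
  shows "(s - 1) * (real m + 1) ^ m \<le> s ^ m * real m ^ (m - 1) \<and>
     (s \<noteq> 3 \<or> m \<noteq> 2 \<longrightarrow> (s - 1) * (real m + 1) ^ m < s ^ m * real m ^ (m - 1))"
proof (cases "s \<ge> 3")
  case True
  then have "m \<ge> 2" using assms by auto
  then show ?thesis
  proof (induction rule: dec_induct)
    case base
    have "0 \<le> (s - 3) * (s - 3/2)" using True by (intro mult_nonneg_nonneg) auto
    moreover have "0 < (s - 3) * (s - 3/2)" if "s \<noteq> 3" using True that by (intro mult_pos_pos) auto
    ultimately show ?case by (auto simp: power2_eq_square field_simps)
  next
    case (step n)
    then show ?case using power_bound_step[of n s] True by linarith
  qed
next
  case False
  then have "m \<ge> 3" and s: "s = 2" using assms by auto
  then show ?thesis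
  proof (induction rule: dec_induct)
    case base
    show ?case by (simp add: s)
  next
    case (step n)
    then show ?case using power_bound_step[of n s] s by linarith
  qed
qed

text \<open>After summation by parts each \<open>D t\<close> with \<open>t < m\<close> carries a
  nonpositive factor, because the reciprocals \<open>1 / x i\<close> increase; only the boundary
  term at \<open>m\<close> survives. The sign of \<open>D m\<close> is left open, since
  \<open>D_nonneg\<close> applies this to a supposedly negative \<open>D m\<close>.\<close>

lemma abel_weight_bound:
  fixes D x :: "nat \<Rightarrow> real"
  assumes "1 \<le> k" "k \<le> m" and pos: "\<And>i. k \<le> i \<Longrightarrow> i \<le> m \<Longrightarrow> 0 < x i"
    and mono: "\<And>i. k \<le> i \<Longrightarrow> Suc i \<le> m \<Longrightarrow> x (Suc i) \<le> x i"
    and D: "\<And>t. k - 1 \<le> t \<Longrightarrow> t < m \<Longrightarrow> 0 \<le> D t"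
  shows "(\<Sum>i=k..m. (D i - D (i - 1)) / x i) \<le> D m / x m"
  using assms(2) pos mono D
proof (induction rule: dec_induct)
  case base
  then show ?case using assms(1) by (auto simp: divide_right_mono)
next
  case (step n)
  have "D n / x n \<le> D n / x (Suc n)"
    using step.prems step.hyps by (intro divide_left_mono) auto
  with step show ?case by (force simp: diff_divide_distrib)
qed

text \<open>The sum of \<open>ln z \<le> z - 1\<close> over all quotients
  \<open>z = y i / x i\<close>, with \<open>r / R\<close> counted \<open>c\<close> times for a tail
  of \<open>c\<close> equal entries. The gap \<open>e z = z - 1 - ln z\<close> is kept explicit: it
  is nonnegative and vanishes only at \<open>z = 1\<close>, which settles the equality case.\<close>

lemma prod_le_of_tangent:
  fixes x y :: "nat \<Rightarrow> real" and c :: nat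
  assumes x: "\<And>i. i \<in> I \<Longrightarrow> 0 < x i" and y: "\<And>i. i \<in> I \<Longrightarrow> 0 < y i" and R: "0 < R" and r: "0 < r"
    and le: "(\<Sum>i\<in>I. (y i - x i) / x i) + real c * ((r - R) / R) \<le> 0" and I: "finite I"
  shows "(\<Prod>i\<in>I. y i) * r ^ c \<le> (\<Prod>i\<in>I. x i) * R ^ c"
    and "(\<Prod>i\<in>I. y i) * r ^ c = (\<Prod>i\<in>I. x i) * R ^ c \<Longrightarrow> i \<in> I \<Longrightarrow> x i = y i"
proof -
  define e where "e z = z - 1 - ln z" for z :: real
  have e0: "0 \<le> e z" if "0 < z" for z using ln_le_minus_one[OF that] by (simp add: e_def)
  have xn: "x i \<noteq> 0" if "i \<in> I" for i using x[OF that] by simp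
  have yn: "y i \<noteq> 0" if "i \<in> I" for i using y[OF that] by simp
  have L: "ln ((\<Prod>i\<in>I. y i) * r ^ c) - ln ((\<Prod>i\<in>I. x i) * R ^ c) =
     (\<Sum>i\<in>I. ln (y i / x i)) + real c * ln (r / R)"
    using x y R r xn yn
    by (simp add: ln_mult prod_pos ln_prod I ln_realpow ln_div sum_subtractf algebra_simps prod_zero_iff)
  have E: "(\<Sum>i\<in>I. ln (y i / x i)) + real c * ln (r / R) + ((\<Sum>i\<in>I. e (y i / x i)) + real c * e (r / R))
     = (\<Sum>i\<in>I. (y i - x i) / x i) + real c * ((r - R) / R)"
  proof -
    have "ln (y i / x i) + e (y i / x i) = (y i - x i) / x i" if "i \<in> I" for i
      using xn[OF that] by (simp add: e_def diff_divide_distrib)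
    moreover have "ln (r / R) + e (r / R) = (r - R) / R" using R by (simp add: e_def diff_divide_distrib)
    ultimately have "(\<Sum>i\<in>I. (y i - x i) / x i) + real c * ((r - R) / R)
       = (\<Sum>i\<in>I. ln (y i / x i) + e (y i / x i)) + real c * (ln (r / R) + e (r / R))"
      by simp
    then show ?thesis by (simp add: sum.distrib distrib_left)
  qed
  have s0: "0 \<le> (\<Sum>i\<in>I. e (y i / x i))" by (intro sum_nonneg e0) (simp add: x y)
  have c0: "0 \<le> real c * e (r / R)" using R r by (simp add: e0)
  have pos: "0 < (\<Prod>i\<in>I. y i) * r ^ c" "0 < (\<Prod>i\<in>I. x i) * R ^ c"
    using x y R r by (auto intro!: mult_pos_pos prod_pos)
  have "ln ((\<Prod>i\<in>I. y i) * r ^ c) \<le> ln ((\<Prod>i\<in>I. x i) * R ^ c)" using L E s0 c0 le by linarith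
  then show "(\<Prod>i\<in>I. y i) * r ^ c \<le> (\<Prod>i\<in>I. x i) * R ^ c" using pos by simp
  assume eq: "(\<Prod>i\<in>I. y i) * r ^ c = (\<Prod>i\<in>I. x i) * R ^ c" and i: "i \<in> I"
  from L[unfolded eq] have "(\<Sum>i\<in>I. ln (y i / x i)) + real c * ln (r / R) = 0" by simp
  then have "(\<Sum>i\<in>I. e (y i / x i)) = 0" using E s0 c0 le by linarith
  then have "e (y i / x i) = 0"
    using i I by (subst (asm) sum_nonneg_eq_0_iff) (auto intro!: e0 simp: x y)
  then have "y i / x i = 1" using ln_eq_minus_one[of "y i / x i"] x[OF i] y[OF i] by (simp add: e_def)
  then show "x i = y i" using xn[OF i] by simp
qed

text \<open>Of \<open>c + 1\<close> entries with sum \<open>S\<close>, one is left out of the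
  product, so raising \<open>z\<close> above the mean \<open>a\<close> at the expense of the others
  need not lower it. With \<open>z = a * (1 + e)\<close> the claim becomes
  \<open>1 \<le> (1 + e) * (1 - e / c)^(c - 1)\<close>, which follows from Bernoulli's inequality as
  long as \<open>e * c \<le> 1\<close>; that is the upper bound on \<open>z\<close>.\<close>

lemma power_shift_bound:
  fixes z S :: real and c :: nat
  assumes "1 \<le> c" "0 < S" "S / (real c + 1) \<le> z" "z * real c \<le> S"
  shows "(S / (real c + 1)) ^ c \<le> z * ((S - z) / real c) ^ (c - 1)"
proof -
  define a where "a = S / (real c + 1)"
  have a: "a > 0" and S: "S = a * (real c + 1)" using assms by (auto simp: a_def)
  define e where "e = z / a - 1"
  have z: "z = a * (1 + e)" using a by (simp add: e_def)
  have e0: "e \<ge> 0" using assms a by (simp add: e_def a_def[symmetric])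
  have "a * ((1 + e) * real c) \<le> a * (real c + 1)" using assms(4) by (simp add: z S mult_ac)
  then have "(1 + e) * real c \<le> real c + 1" using a by (simp only: mult_le_cancel_left_pos)
  then have ec: "e * real c \<le> 1" by (simp add: algebra_simps)
  have eq: "(S - z) / real c = a * (1 + (- (e / real c)))" using assms(1) by (simp add: z S field_simps)
  have e1: "e \<le> 1" using ec e0 assms(1)
    by (smt (verit) mult_le_cancel_left1 of_nat_1 of_nat_mono)
  have le1: "e / real c \<le> 1" using e1 e0 assms(1) by (simp add: divide_le_eq)
  have eq2: "(1 + e) * (1 + real (c - 1) * (- (e / real c))) = 1 + (e / real c) * (1 - e * (real c - 1))"
    using assms(1) by (simp add: of_nat_diff field_simps)
  have "e * (real c - 1) \<le> 1" using ec e0 by (simp add: algebra_simps)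
  then have "1 \<le> (1 + e) * (1 + real (c - 1) * (- (e / real c)))"
    unfolding eq2 using e0 by simp
  also have "\<dots> \<le> (1 + e) * (1 + (- (e / real c))) ^ (c - 1)"
    using e0 le1 by (intro mult_left_mono Bernoulli_inequality) auto
  finally have "a ^ c * 1 \<le> a ^ c * ((1 + e) * (1 + (- (e / real c))) ^ (c - 1))"
    using a by (intro mult_left_mono) auto
  also have "\<dots> = z * ((S - z) / real c) ^ (c - 1)"
    unfolding eq power_mult_distrib using assms(1) by (cases c) (simp_all add: z mult_ac)
  finally show ?thesis by (simp add: a_def)
qed

section \<open>Sorted sequences with product-sum inequalities\<close>

locale product_sum_sequence =
  fixes x :: "nat \<Rightarrow> real" and d :: nat
  assumes d1: "1 \<le> d"
    and pos: "\<And>i. 1 \<le> i \<Longrightarrow> i \<le> Suc d \<Longrightarrow> 0 < x i"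
    and mono: "\<And>i j. 1 \<le> i \<Longrightarrow> i \<le> j \<Longrightarrow> j \<le> Suc d \<Longrightarrow> x j \<le> x i"
    and sum1: "(\<Sum>i=1..Suc d. x i) = 1"
    and ps: "\<And>j. 1 \<le> j \<Longrightarrow> j \<le> d \<Longrightarrow> (\<Prod>i=1..j. x i) \<le> (\<Sum>i=Suc j..Suc d. x i)"
begin

definition R :: "nat \<Rightarrow> real" where "R t = (\<Sum>i=Suc t..Suc d. x i)"
definition y :: "nat \<Rightarrow> real" where "y i = 1 / real (sylv i)"
text \<open>Both the remainder \<open>1 - (y 1 + ... + y t)\<close> (see \<open>r_rec\<close>) and
  the product \<open>y 1 * ... * y t\<close> (see \<open>prod_y\<close>): the Sylvester sequence
  turns the product-sum inequalities into equalities.\<close>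

definition r :: "nat \<Rightarrow> real" where "r t = 1 / (real (sylv (Suc t)) - 1)"
definition D :: "nat \<Rightarrow> real" where "D t = R t - r t"

lemma R_rec: assumes "1 \<le> t" "t \<le> d" shows "R (t - 1) = x t + R t"
  unfolding R_def using assms by (subst sum.atLeast_Suc_atMost) auto

lemma R_pos: "t \<le> d \<Longrightarrow> 0 < R t"
  unfolding R_def by (intro sum_pos pos) auto

lemma R_le: assumes "1 \<le> t" "t \<le> d" shows "R t \<le> real (Suc d - t) * x t"
proof -
  have "R t \<le> (\<Sum>i=Suc t..Suc d. x t)" unfolding R_def using assms by (intro sum_mono mono) auto
  then show ?thesis by simp
qed

lemma y_pos: "0 < y i" using sylv_ge_2[of i] by (simp add: y_def)

lemma r_pos: "0 < r i" using sylv_ge_2[of "Suc i"] by (simp add: r_def)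

lemma r_rec: assumes "1 \<le> t" shows "r (t - 1) = y t + r t"
proof -
  have "1 / (s - 1) = 1 / s + 1 / (s * (s - 1))" if "2 \<le> s" for s :: real
    using that by (simp add: field_simps)
  then show ?thesis using assms sylv_Suc[of t] sylv_ge_2[of t] by (simp add: r_def y_def)
qed

lemma D_rec: assumes "1 \<le> t" "t \<le> d" shows "D t - D (t - 1) = y t - x t"
  using r_rec[of t] R_rec[of t] assms by (simp add: D_def)

lemma D_0: "D 0 = 0"
  using sum1 by (simp add: D_def R_def r_def sylv_1)

lemma prod_y: "(\<Prod>i=1..j. y i) = r j"
proof (induction j)
  case 0 then show ?case by (simp add: r_def sylv_1)
next
  case (Suc j)
  then show ?case using sylv_Suc[of "Suc j"] by (simp add: r_def y_def mult_ac)
qed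

lemma tangent_sum:
  assumes "1 \<le> k" "k \<le> m" "m \<le> d" "\<And>t. t < m \<Longrightarrow> 0 \<le> D t"
  shows "(\<Sum>i=k..m. (y i - x i) / x i) \<le> D m / x m"
proof -
  have "(\<Sum>i=k..m. (y i - x i) / x i) = (\<Sum>i=k..m. (D i - D (i - 1)) / x i)"
    using assms by (intro sum.cong refl) (subst D_rec, auto)
  also have "\<dots> \<le> D m / x m"
    using assms by (intro abel_weight_bound) (auto intro!: pos mono)
  finally show ?thesis .
qed

text \<open>At a first \<open>t\<close> with \<open>D t < 0\<close> the boundary term of the Abel
  summation is nonpositive, so the product of the \<open>x i\<close> is at least that of the
  \<open>y i\<close>, which is \<open>r t\<close>. By the product-sum inequality \<open>R t\<close>
  is then at least \<open>r t\<close>, a contradiction.\<close>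

lemma D_nonneg: "t \<le> d \<Longrightarrow> 0 \<le> D t"
proof (induction t rule: less_induct)
  case (less t)
  show ?case
  proof (cases "t = 0")
    case True then show ?thesis by (simp add: D_0)
  next
    case False
    show ?thesis
    proof (rule ccontr)
      assume neg: "\<not> 0 \<le> D t"
      have "(\<Sum>i=1..t. (y i - x i) / x i) \<le> D t / x t"
        using less False by (intro tangent_sum) auto
      also have "\<dots> \<le> 0" using neg pos[of t] less.prems False by (simp add: divide_le_0_iff)
      \<comment> \<open>The exponent 0 switches off the tail factor of
        \<open>prod_le_of_tangent\<close>.\<close>
      finally have "(\<Prod>i=1..t. y i) * 1 ^ 0 \<le> (\<Prod>i=1..t. x i) * 1 ^ 0"
        using less.prems by (intro prod_le_of_tangent) (auto intro!: pos y_pos)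
      then have "r t \<le> (\<Prod>i=1..t. x i)" using prod_y[of t] by simp
      then have "r t \<le> R t" using ps[of t] less.prems False by (simp add: R_def)
      with neg show False by (simp add: D_def)
    qed
  qed
qed

lemma R_ge: "t \<le> d \<Longrightarrow> r t \<le> R t" using D_nonneg[of t] by (simp add: D_def)

text \<open>If \<open>R t = r t\<close>, then
  \<open>r t \<le> (\<Prod>i=1..t. x i) \<le> R t = r t\<close>, so the tangent inequality is an
  equality in every factor.\<close>

lemma R_eq_imp:
  assumes "t \<le> d" "R t = r t" "1 \<le> i" "i \<le> t"
  shows "x i = y i"
proof -
  have "(\<Sum>i=1..t. (y i - x i) / x i) \<le> D t / x t"
    using assms by (intro tangent_sum D_nonneg) auto
  then have le: "(\<Sum>i=1..t. (y i - x i) / x i) + real 0 * ((1 - 1) / 1) \<le> 0" using assms by (simp add: D_def)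
  have "(\<Prod>i=1..t. y i) * 1 ^ 0 \<le> (\<Prod>i=1..t. x i) * 1 ^ 0"
    using assms by (intro prod_le_of_tangent(1)[OF _ _ _ _ le]) (auto intro!: pos y_pos)
  moreover have "(\<Prod>i=1..t. x i) \<le> R t" using ps[of t] assms by (simp add: R_def)
  ultimately have "(\<Prod>i=1..t. y i) * 1 ^ 0 = (\<Prod>i=1..t. x i) * 1 ^ 0" using assms prod_y[of t] by simp
  then show ?thesis using assms
    by (intro prod_le_of_tangent(2)[OF _ _ _ _ le]) (auto intro!: pos y_pos)
qed

text \<open>\<open>Q k m\<close> is the product \<open>x k * \<dots> * x d\<close> with the entries after \<open>m\<close> replaced by their average
  (the last one is not part of the product), and \<open>g k m\<close> is its value at the Sylvester sequence.\<close>

definition Q :: "nat \<Rightarrow> nat \<Rightarrow> real" where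
  "Q k m = (\<Prod>i=k..m. x i) * (R m / real (Suc d - m)) ^ (d - m)"
definition g :: "nat \<Rightarrow> nat \<Rightarrow> real" where
  "g k m = (\<Prod>i=k..m. y i) * (r m / real (Suc d - m)) ^ (d - m)"

text \<open>The two cases of the descent: if \<open>x m\<close> is large, concavity of the logarithm compares with the
  Sylvester sequence directly; if it is small, averaging it into the tail does not increase \<open>Q\<close>.\<close>

lemma g_le_Q:
  assumes "1 \<le> k" "k \<le> m" "m < d" and big: "R m \<le> real (d - m) * x m"
  shows "g k m \<le> Q k m" and "g k m = Q k m \<Longrightarrow> k \<le> i \<Longrightarrow> i \<le> m \<Longrightarrow> x i = y i"
proof -
  let ?n = "real (Suc d - m)"
  have n: "?n > 0" using assms by simp
  have xm: "0 < x m" using assms by (intro pos) auto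
  \<comment> \<open>This is where a large \<open>x m\<close> enters: the boundary term of the Abel
    summation is outweighed by the loss \<open>D m / R m\<close> in each of the \<open>d - m\<close>
    averaged factors.\<close>
  have "D m / x m \<le> real (d - m) * (D m / R m)"
  proof -
    have "D m * R m \<le> D m * (real (d - m) * x m)"
      using big D_nonneg[of m] assms by (intro mult_left_mono) auto
    then show ?thesis using xm R_pos[of m] assms by (simp add: field_simps)
  qed
  moreover have "(r m / ?n - R m / ?n) / (R m / ?n) = - (D m / R m)"
  proof -
    have "(a / n - b / n) / (b / n) = - ((b - a) / b)" if "n > 0" "b > 0" for a b n :: real
      using that by (simp add: field_simps)
    then show ?thesis using n R_pos[of m] assms by (simp add: D_def del: of_nat_diff)
  qed
  moreover have "(\<Sum>i=k..m. (y i - x i) / x i) \<le> D m / x m"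
    using assms by (intro tangent_sum D_nonneg) auto
  ultimately have le: "(\<Sum>i=k..m. (y i - x i) / x i) + real (d - m) * ((r m / ?n - R m / ?n) / (R m / ?n)) \<le> 0"
    by simp
  have pos': "0 < R m / ?n" "0 < r m / ?n" using n R_pos[of m] r_pos[of m] assms by auto
  have p: "0 < x i" if "i \<in> {k..m}" for i using that assms by (intro pos) auto
  show "g k m \<le> Q k m" unfolding g_def Q_def
    by (intro prod_le_of_tangent(1)[OF _ _ _ _ le] p y_pos pos') auto
  show "x i = y i" if "g k m = Q k m" "k \<le> i" "i \<le> m"
    using that unfolding g_def Q_def
    by (intro prod_le_of_tangent(2)[OF _ _ _ _ le] p y_pos pos') auto
qed

lemma Q_pred_le:
  assumes "1 \<le> k" "k \<le> m" "m < d" and small: "real (d - m) * x m \<le> R m"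
  shows "Q k (m - 1) \<le> Q k m"
proof -
  let ?c = "Suc d - m"
  have c: "1 \<le> ?c" "Suc d - (m - 1) = Suc ?c" "d - (m - 1) = ?c" "d - m = ?c - 1" using assms by auto
  have e: "{k..m} = insert m {k..m-1}" using assms by auto
  \<comment> \<open>The \<open>?c + 1\<close> entries from \<open>m\<close> on have the sum
    \<open>R (m - 1)\<close>. As the sequence is sorted, \<open>x m\<close> is at least their mean;
    \<open>small\<close> becomes the required upper bound after adding \<open>x m\<close> to both
    sides.\<close>
  have "(R (m - 1) / (real ?c + 1)) ^ ?c \<le> x m * ((R (m - 1) - x m) / real ?c) ^ (?c - 1)"
  proof (rule power_shift_bound)
    have Rm: "R (m - 1) = x m + R m" using assms by (intro R_rec) auto
    show "0 < R (m - 1)" using assms by (intro R_pos) auto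
    show "R (m - 1) / (real ?c + 1) \<le> x m"
    proof -
      have "(a + b) / (c + 1) \<le> a" if "b \<le> c * a" "0 \<le> c" for a b c :: real
        using that by (simp add: pos_divide_le_eq algebra_simps)
      then show ?thesis using R_le[of m] assms unfolding Rm by (simp del: of_nat_diff)
    qed
    have "real ?c = real (d - m) + 1" using assms by auto
    then show "x m * real ?c \<le> R (m - 1)" using small unfolding Rm by (simp add: algebra_simps)
  qed (use c in auto)
  then have "(R (m - 1) / (real ?c + 1)) ^ ?c \<le> x m * (R m / real ?c) ^ (?c - 1)"
    using R_rec[of m] assms by simp
  then have "(\<Prod>i=k..m-1. x i) * (R (m - 1) / (real ?c + 1)) ^ ?c
     \<le> (\<Prod>i=k..m-1. x i) * (x m * (R m / real ?c) ^ (?c - 1))"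
    using assms by (intro mult_left_mono) (auto intro!: prod_nonneg less_imp_le[OF pos])
  moreover have "m \<notin> {k..m-1}" using assms by auto
  ultimately show ?thesis unfolding Q_def c e by (simp add: mult_ac add.commute[of 1])
qed

text \<open>The descent ends at the latest at \<open>m = k - 1\<close>, where \<open>Q\<close>
  consists of the averaged tail alone and \<open>R_ge\<close> bounds it by
  \<open>g k (k - 1)\<close>.\<close>

lemma Q_ge:
  assumes "1 \<le> k" "k - 1 \<le> m" "m < d" "\<And>t. k - 1 \<le> t \<Longrightarrow> t \<le> m \<Longrightarrow> c \<le> g k t"
  shows "c \<le> Q k m"
  using assms(2-4)
proof (induction m rule: dec_induct)
  case base
  have "r (k-1) \<le> R (k-1)" using base by (intro R_ge) auto
  then have "g k (k-1) \<le> Q k (k-1)" using base r_pos[of "k-1"]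
    unfolding g_def Q_def using assms(1) by (auto intro!: power_mono divide_right_mono)
  with base show ?case by force
next
  case (step n)
  show ?case
  proof (cases "R (Suc n) \<le> real (d - Suc n) * x (Suc n)")
    case True
    then have "g k (Suc n) \<le> Q k (Suc n)" using step assms(1) by (intro g_le_Q) auto
    with step.prems(2)[of "Suc n"] step.hyps show ?thesis by auto
  next
    case False
    then have "Q k (Suc n - 1) \<le> Q k (Suc n)" using step assms(1) by (intro Q_pred_le) auto
    with step.IH step.prems show ?thesis by (auto intro: order_trans)
  qed
qed

text \<open>Both values contain the factor
  \<open>(\<Prod>i=k..t. y i) / (s - 1)^(d - t - 1)\<close>; what remains are the reciprocals of the
  two sides of \<open>power_bound\<close>. The dimension enters at \<open>t = 0\<close>, where
  \<open>s = 2\<close> requires \<open>m = d \<ge> 3\<close>.\<close>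

lemma g_Suc_le:
  assumes "3 \<le> d" "1 \<le> k" "k - 1 \<le> t" "t + 2 \<le> d"
  shows "g k (Suc t) \<le> g k t" "4 \<le> d \<Longrightarrow> g k (Suc t) < g k t"
proof -
  let ?s = "real (sylv (Suc t))" and ?m = "d - t"
  obtain p where p: "d - t = Suc p" "p \<ge> 1" using assms(4) by (intro that[of "d - t - 1"]) auto
  have c: "Suc d - t = Suc (Suc p)" "Suc d - Suc t = Suc p" "d - Suc t = p" using p by auto
  have s2: "?s \<ge> 2" using sylv_ge_2[of "Suc t"] by simp
  have s: "(?s \<ge> 3 \<and> ?m \<ge> 2) \<or> (?s = 2 \<and> ?m \<ge> 3)"
  proof (cases "t = 0")
    case True then show ?thesis using assms by (simp add: sylv_1)
  next
    case False
    then have "sylv 2 \<le> sylv (Suc t)" by (intro sylv_mono) auto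
    then show ?thesis using assms by (simp add: sylv_2)
  qed
  \<comment> \<open>The tie \<open>s = 3\<close>, \<open>m = 2\<close> means \<open>t = 1\<close>
    and \<open>d = 3\<close>. For \<open>d \<ge> 4\<close>, \<open>m = 2\<close> forces
    \<open>t \<ge> 2\<close> and thus \<open>s \<ge> 7\<close>.\<close>
  have strict: "?s \<noteq> 3 \<or> ?m \<noteq> 2" if "4 \<le> d"
  proof (rule ccontr)
    assume "\<not> ?thesis"
    then have "t \<ge> 2" "?s = 3" using that by auto
    moreover from this have "sylv 3 \<le> sylv (Suc t)" by (intro sylv_mono) auto
    ultimately show False by (simp add: sylv_3)
  qed
  have A: "(\<Prod>i=k..t. y i) > 0" by (intro prod_pos) (auto simp: y_pos)
  have e: "{k..Suc t} = insert (Suc t) {k..t}" using assms by auto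
  have R1: "r (Suc t) = 1 / (?s * (?s - 1))" using sylv_Suc[of "Suc t"] by (simp add: r_def)
  let ?L = "(?s - 1) * (real ?m + 1) ^ ?m" and ?U = "?s ^ ?m * real ?m ^ (?m - 1)"
  have Lp: "?L > 0" using s2 by (intro mult_pos_pos) auto
  have Up: "?U > 0" using s2 p by (intro mult_pos_pos) auto
  have gt: "g k t = (\<Prod>i=k..t. y i) / (?s - 1) ^ p * (1 / ?L)"
    unfolding g_def c p r_def by (simp add: power_divide power_mult_distrib mult_ac add_ac)
  have gS: "g k (Suc t) = (\<Prod>i=k..t. y i) / (?s - 1) ^ p * (1 / ?U)"
    unfolding g_def c p R1 e by (simp add: y_def power_divide power_mult_distrib mult_ac)
  have q: "0 < (\<Prod>i=k..t. y i) / (?s - 1) ^ p" using A s2 by simp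
  have "?L \<le> ?U" using power_bound[OF s] by blast
  then have "1 / ?U \<le> 1 / ?L" using Lp Up by (intro divide_left_mono) auto
  then show "g k (Suc t) \<le> g k t" unfolding gt gS using q by (intro mult_left_mono) auto
  assume "4 \<le> d"
  then have "?L < ?U" using power_bound[OF s] strict by blast
  then have "1 / ?U < 1 / ?L" using Lp Up by (intro divide_strict_left_mono) auto
  then show "g k (Suc t) < g k t" unfolding gt gS using q by (intro mult_strict_left_mono) auto
qed

lemma g_last_le:
  assumes "3 \<le> d" "1 \<le> k" "k - 1 \<le> t" "t \<le> m" "m < d"
  shows "g k m \<le> g k t"
  using assms(4,5)
proof (induction m rule: dec_induct)
  case (step n)
  then show ?case using g_Suc_le(1)[of k n] assms by auto
qed simp

lemma g_last:
  assumes "1 \<le> k" "k \<le> d"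
  shows "g k (d - 1) = (real (sylv k) - 1) / (2 * (real (sylv d) - 1)^2)"
proof -
  have c: "Suc d - (d - 1) = 2" "d - (d - 1) = 1" "Suc (d - 1) = d" "{k..d-1} = {k..<d}" using assms by auto
  have "(\<Prod>i\<in>{k..<d}. real (sylv i)) = (real (sylv d) - 1) / (real (sylv k) - 1)"
    using prod_sylv_real[of k d] assms sylv_ge_2[of k] by (simp add: field_simps)
  then show ?thesis using sylv_ge_2[of k] sylv_ge_2[of d]
    unfolding g_def c r_def y_def by (simp add: prod_dividef power2_eq_square)
qed

lemma x_d_ge: "R (d - 1) / 2 \<le> x d" and x_d_eq: "x d = R (d - 1) / 2 \<Longrightarrow> x (Suc d) = x d"
proof -
  have "R (d - 1) = x d + x (Suc d)" using d1 by (simp add: R_def)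
  moreover have "x (Suc d) \<le> x d" using d1 by (intro mono) auto
  ultimately show "R (d - 1) / 2 \<le> x d" "x d = R (d - 1) / 2 \<Longrightarrow> x (Suc d) = x d" by auto
qed

lemma Q_last_le:
  assumes "1 \<le> k" "k \<le> d"
  shows "Q k (d - 1) \<le> (\<Prod>i=k..d. x i)"
    and "Q k (d - 1) = (\<Prod>i=k..d. x i) \<Longrightarrow> x d = R (d - 1) / 2"
proof -
  have c: "Suc d - (d - 1) = 2" "d - (d - 1) = 1" using assms by auto
  have e: "{k..d} = insert d {k..d-1}" "d \<notin> {k..d-1}" using assms by auto
  have p: "0 < (\<Prod>i=k..d-1. x i)" using assms by (intro prod_pos) (auto intro!: pos)
  have Q: "Q k (d - 1) = (\<Prod>i=k..d-1. x i) * (R (d - 1) / 2)" unfolding Q_def c by simp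
  have X: "(\<Prod>i=k..d. x i) = (\<Prod>i=k..d-1. x i) * x d" by (subst e) (use e(2) in \<open>simp add: mult_ac\<close>)
  show "Q k (d - 1) \<le> (\<Prod>i=k..d. x i)" unfolding Q X using p x_d_ge by (intro mult_left_mono) auto
  show "Q k (d - 1) = (\<Prod>i=k..d. x i) \<Longrightarrow> x d = R (d - 1) / 2" unfolding Q X using p by (metis less_irrefl mult_left_cancel)
qed

text \<open>As \<open>g k t\<close> is least at \<open>t = d - 1\<close>, this value can serve as
  the constant of the descent. It remains to replace the mean of the last two entries by the larger
  of them, \<open>x d\<close>.\<close>

theorem prod_ge:
  assumes "3 \<le> d" "1 \<le> k" "k \<le> d"
  shows "(real (sylv k) - 1) / (2 * (real (sylv d) - 1)^2) \<le> (\<Prod>i=k..d. x i)"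
proof -
  have "g k (d - 1) \<le> Q k (d - 1)"
    using assms by (intro Q_ge g_last_le) auto
  then show ?thesis using Q_last_le(1)[of k] g_last[of k] assms by simp
qed

lemma extremal:
  assumes "R (d - 1) = r (d - 1)" "x d = R (d - 1) / 2"
  shows "1 \<le> i \<Longrightarrow> i < d \<Longrightarrow> x i = 1 / real (sylv i)"
    "x d = 1 / (2 * (real (sylv d) - 1))" "x (Suc d) = 1 / (2 * (real (sylv d) - 1))"
proof -
  show "x i = 1 / real (sylv i)" if "1 \<le> i" "i < d"
    using R_eq_imp[OF _ assms(1), of i] that by (simp add: y_def)
  show d: "x d = 1 / (2 * (real (sylv d) - 1))"
    unfolding assms(2) unfolding assms(1) r_def using d1 by simp
  show "x (Suc d) = 1 / (2 * (real (sylv d) - 1))"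
    unfolding x_d_eq[OF assms(2)] by (fact d)
qed

text \<open>For \<open>k = d\<close> both \<open>R (d - 1) / 2 \<le> x d\<close> and
  \<open>r (d - 1) \<le> R (d - 1)\<close> must be equalities. For \<open>k = 1\<close> the strict
  decrease of \<open>g\<close> forbids a descent below \<open>d - 1\<close>; so the direct
  comparison applies there, and its equality case fixes all entries before \<open>d\<close> and with
  them the tail sum.\<close>

theorem prod_eq_imp:
  assumes "k = d \<or> k = 1 \<and> 4 \<le> d"
    and eq: "(\<Prod>i=k..d. x i) = (real (sylv k) - 1) / (2 * (real (sylv d) - 1)^2)"
  shows "R (d - 1) = r (d - 1)" "x d = R (d - 1) / 2"
proof -
  have "R (d - 1) = r (d - 1) \<and> x d = R (d - 1) / 2"
  proof (cases "k = d")
    case True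
    then have "x d = r (d - 1) / 2" using eq d1 sylv_ge_2[of d] by (simp add: r_def power2_eq_square)
    then show ?thesis using x_d_ge R_ge[of "d - 1"] by auto
  next
    case False
    then have k: "k = 1" and d: "4 \<le> d" using assms by auto
    have gx: "g k (d - 1) = (\<Prod>i=k..d. x i)" using g_last[of k] k d eq by simp
    have "g k (d - 1) \<le> Q k (d - 1)" using d k by (intro Q_ge g_last_le) auto
    then have Qx: "Q k (d - 1) = (\<Prod>i=k..d. x i)" using Q_last_le(1)[of k] k d gx by auto
    have big: "R (d - 1) \<le> real (d - (d - 1)) * x (d - 1)"
    proof (rule ccontr)
      assume "\<not> ?thesis"
      then have "Q k (d - 1 - 1) \<le> Q k (d - 1)" using k d by (intro Q_pred_le) auto
      moreover have "g k (d - 1 - 1) \<le> Q k (d - 1 - 1)" using d k by (intro Q_ge g_last_le) auto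
      moreover have "g k (Suc (d - 2)) < g k (d - 2)" using d k by (intro g_Suc_le) auto
      moreover have "Suc (d - 2) = d - 1" "d - 1 - 1 = d - 2" using d by auto
      ultimately show False using Qx gx by simp
    qed
    have xy: "x i = y i" if "1 \<le> i" "i \<le> d - 1" for i
      using that k d Qx gx by (intro g_le_Q(2)[OF _ _ _ big]) auto
    have "(\<Sum>i=1..t. x i) = R 0 - R t" if "t \<le> d" for t using that
    proof (induction t)
      case (Suc t) then show ?case using R_rec[of "Suc t"] by simp
    qed simp
    moreover have "(\<Sum>i=1..t. y i) = r 0 - r t" for t
    proof (induction t)
      case (Suc t) then show ?case using r_rec[of "Suc t"] by simp
    qed simp
    moreover have "(\<Sum>i=1..d-1. x i) = (\<Sum>i=1..d-1. y i)" using xy by (intro sum.cong) auto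
    ultimately have "R (d - 1) = r (d - 1)" using D_0 by (simp add: D_def)
    then show ?thesis using Q_last_le(2)[OF _ _ Qx] k d by auto
  qed
  then show "R (d - 1) = r (d - 1)" "x d = R (d - 1) / 2" by auto
qed

end

section \<open>Minkowski's theorem on linear forms\<close>

text \<open>The change of variables theorem of the library requires a well-ordered index type. It is
  transferred to arbitrary finite index types through this copy.\<close>

typedef (overloaded) ('n::finite) ordinal_copy = "{..<CARD('n)} :: nat set"
  by (rule exI[of _ 0]) simp

instantiation ordinal_copy :: (finite) wellorder
begin
definition "a \<le> b \<longleftrightarrow> Rep_ordinal_copy a \<le> Rep_ordinal_copy b"
definition "a < b \<longleftrightarrow> Rep_ordinal_copy a < Rep_ordinal_copy b"
instance
proof
  fix P and a :: "'a ordinal_copy"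
  assume step: "\<And>x. (\<And>y :: 'a ordinal_copy. y < x \<Longrightarrow> P y) \<Longrightarrow> P x"
  show "P a"
    by (induction a rule: measure_induct_rule[of Rep_ordinal_copy])
       (use step less_ordinal_copy_def in blast)
qed (auto simp: less_eq_ordinal_copy_def less_ordinal_copy_def Rep_ordinal_copy_inject)
end

instance ordinal_copy :: (finite) finite
proof
  show "finite (UNIV :: 'a ordinal_copy set)"
    using type_definition.univ[OF type_definition_ordinal_copy] by (metis finite_imageI finite_lessThan)
qed

lemma ex_bij_ordinal_copy: "\<exists>p :: 'n::finite ordinal_copy \<Rightarrow> 'n. bij p"
proof -
  have "card (UNIV :: 'n ordinal_copy set) = CARD('n)"
    by (metis type_definition.card[OF type_definition_ordinal_copy] card_lessThan)
  then show ?thesis by (metis finite_same_card_bij finite_class.finite_UNIV)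
qed

text \<open>Conjugation with \<open>p\<close> is a sign-preserving bijection between the
  permutations of the two index types.\<close>

lemma det_reindex:
  fixes A :: "real^'n^'n" and p :: "'m::finite \<Rightarrow> 'n::finite"
  assumes p: "bij p"
  shows "det (\<chi> i j. A $ p i $ p j) = det A"
proof -
  have ip: "inj_on p UNIV" and sp: "p ` UNIV = UNIV" using p by (auto simp: bij_betw_def)
  define M where "M q = map_permutation UNIV p q" for q :: "'m \<Rightarrow> 'm"
  have M_p: "M q (p i) = p (q i)" for q i
    using ip sp by (simp add: M_def map_permutation_def restrict_id_def)
  have "bij_betw M {q. q permutes UNIV} {q. q permutes UNIV}"
    unfolding bij_betw_def
  proof
    show "inj_on M {q. q permutes UNIV}"
      by (intro inj_onI ext) (metis M_p ip injD)
    have sub: "M ` {q. q permutes UNIV} \<subseteq> {q. q permutes UNIV}"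
      using map_permutation_permutes[OF p] by (auto simp: M_def)
    show "M ` {q. q permutes UNIV} = {q. q permutes UNIV}"
    proof (intro equalityI sub subsetI)
      fix r :: "'n \<Rightarrow> 'n" assume r: "r \<in> {q. q permutes UNIV}"
      have "inv p \<circ> r \<circ> p permutes UNIV"
        using permutes_bij[of r] r p by (intro bij_imp_permutes bij_comp bij_imp_bij_inv) auto
      moreover have "M (inv p \<circ> r \<circ> p) = r"
      proof
        fix x obtain i where "x = p i" using sp by blast
        then show "M (inv p \<circ> r \<circ> p) x = r x" using sp by (simp add: M_p surj_f_inv_f)
      qed
      ultimately show "r \<in> M ` {q. q permutes UNIV}" by (metis image_eqI mem_Collect_eq)
    qed
  qed
  then have "det A = (\<Sum>q | q permutes UNIV. of_int (sign (M q)) * (\<Prod>i\<in>UNIV. A $ i $ M q i))"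
    unfolding det_def by (rule sum.reindex_bij_betw[symmetric])
  also have "\<dots> = det (\<chi> i j. A $ p i $ p j)"
    unfolding det_def
  proof (intro sum.cong refl)
    fix q :: "'m \<Rightarrow> 'm" assume "q \<in> {q. q permutes UNIV}"
    then have "sign (M q) = sign q" using ip by (simp add: M_def sign_map_permutation)
    moreover have "(\<Prod>i\<in>UNIV. A $ i $ M q i) = (\<Prod>i\<in>UNIV. A $ p i $ M q (p i))"
      using p by (intro prod.reindex_bij_betw[symmetric])
    ultimately show "of_int (sign (M q)) * (\<Prod>i\<in>UNIV. A $ i $ M q i)
        = of_int (sign q) * (\<Prod>i\<in>UNIV. (\<chi> i j. A $ p i $ p j) $ i $ q i)"
      by (simp add: M_p)
  qed
  finally show ?thesis by simp
qed

lemma lborel_reindex: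
  fixes p :: "'m::finite \<Rightarrow> 'n::finite"
  assumes p: "bij p"
  shows "lborel = distr lborel borel (\<lambda>x::real^'n. (\<chi> j. x $ p j) :: real^'m)"
proof (rule lborel_eqI)
  fix l u :: "real^'m"
  assume lu: "\<And>b. b \<in> Basis \<Longrightarrow> l \<bullet> b \<le> u \<bullet> b"
  have lu': "l $ i \<le> u $ i" for i using lu[of "axis i 1"] by (simp add: inner_axis)
  define l' u' :: "real^'n" where "l' = (\<chi> i. l $ inv p i)" and "u' = (\<chi> i. u $ inv p i)"
  have m: "(\<lambda>x::real^'n. (\<chi> j. x $ p j) :: real^'m) \<in> borel_measurable lborel"
    by (simp, intro borel_measurable_continuous_onI continuous_intros)
  have "(\<lambda>x::real^'n. (\<chi> j. x $ p j) :: real^'m) -` box l u = box l' u'"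
    using p by (auto simp: mem_box_cart l'_def u'_def) (metis bij_inv_eq_iff)+
  then have "emeasure (distr lborel borel (\<lambda>x::real^'n. (\<chi> j. x $ p j) :: real^'m)) (box l u) = emeasure lborel (box l' u')"
    using m by (subst emeasure_distr) auto
  also have "\<dots> = ennreal (\<Prod>b\<in>Basis. (u' - l') \<bullet> b)"
  proof (rule emeasure_lborel_box)
    fix b :: "real^'n" assume "b \<in> Basis"
    then show "l' \<bullet> b \<le> u' \<bullet> b" using lu' by (auto simp: Basis_vec_def inner_axis l'_def u'_def)
  qed
  also have "(\<Prod>b\<in>Basis. (u' - l') \<bullet> b) = (\<Prod>i\<in>UNIV. u' $ i - l' $ i)"
    by (simp add: Basis_vec_def prod.UNION_disjoint axis_eq_axis inner_axis)
  also have "\<dots> = (\<Prod>j\<in>UNIV. u' $ p j - l' $ p j)"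
    using p by (intro prod.reindex_bij_betw[symmetric])
  also have "\<dots> = (\<Prod>j\<in>UNIV. u $ j - l $ j)" using p by (simp add: l'_def u'_def bij_is_inj)
  also have "\<dots> = (\<Prod>b\<in>Basis. (u - l) \<bullet> b)"
    by (simp add: Basis_vec_def prod.UNION_disjoint axis_eq_axis inner_axis)
  finally show "emeasure (distr lborel borel (\<lambda>x::real^'n. (\<chi> j. x $ p j) :: real^'m)) (box l u)
     = ennreal (\<Prod>b\<in>Basis. (u - l) \<bullet> b)" .
qed simp

text \<open>Renaming coordinates by \<open>T\<close> preserves Lebesgue measure and, by conjugation,
  the determinant, so the formula is transported from the ordered index type. Working with Borel
  sets makes all images measurable as preimages under continuous inverses.\<close>

lemma measure_linear_image_borel:
  fixes f :: "real^'n \<Rightarrow> real^'n"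
  assumes f: "linear f" "det (matrix f) \<noteq> 0" and S: "S \<in> sets borel" "bounded S"
  shows "f ` S \<in> sets borel" "measure lebesgue (f ` S) = \<bar>det (matrix f)\<bar> * measure lebesgue S"
proof -
  have img: "h ` X \<in> sets borel" if "continuous_on UNIV k" "\<And>x. k (h x) = x" "\<And>x. h (k x) = x" "X \<in> sets borel"
    for h :: "'a::euclidean_space \<Rightarrow> 'b::euclidean_space" and k X
  proof -
    have "h ` X = k -` X \<inter> space borel"
    proof (intro equalityI subsetI)
      fix y assume "y \<in> k -` X \<inter> space borel"
      then show "y \<in> h ` X" using that(3)[of y] by (intro image_eqI[of _ _ "k y"]) auto
    qed (use that in auto)
    moreover have "k \<in> borel_measurable borel" using that(1) by (rule borel_measurable_continuous_onI)
    ultimately show ?thesis using that(4) by (simp only: measurable_sets)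
  qed
  have "inj f" using f by (simp add: det_nz_iff_inj)
  then obtain g where g: "linear g" "g \<circ> f = id" using f(1) linear_injective_left_inverse by blast
  then have fg: "f \<circ> g = id" using f(1) by (metis linear_inverse_left)
  have gc: "continuous_on UNIV g" using g(1) by (simp add: linear_continuous_on linear_conv_bounded_linear)
  show fS: "f ` S \<in> sets borel"
    by (rule img[OF gc _ _ S(1)]) (use g fg in \<open>auto simp: o_def id_def fun_eq_iff\<close>)
  obtain p :: "'n ordinal_copy \<Rightarrow> 'n" where p: "bij p" using ex_bij_ordinal_copy by blast
  define T :: "real^'n \<Rightarrow> real^'n ordinal_copy" where "T x = (\<chi> j. x $ p j)" for x
  define T' :: "real^'n ordinal_copy \<Rightarrow> real^'n" where "T' x = (\<chi> j. x $ inv p j)" for x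
  have TT': "T (T' x) = x" for x using p by (simp add: T_def T'_def vec_eq_iff bij_is_inj)
  have T'T: "T' (T x) = x" for x using p by (simp add: T_def T'_def vec_eq_iff bij_is_surj surj_f_inv_f)
  have lT: "linear T" by (auto simp: T_def intro!: linearI simp: vec_eq_iff)
  have lT': "linear T'" by (auto simp: T'_def intro!: linearI simp: vec_eq_iff)
  have T'c: "continuous_on UNIV T'" using lT' by (simp add: linear_continuous_on linear_conv_bounded_linear)
  have TX: "T ` X \<in> sets borel" "measure lebesgue (T ` X) = measure lebesgue X" if X: "X \<in> sets borel" for X
  proof -
    show TXb: "T ` X \<in> sets borel" by (rule img[OF T'c T'T TT' X])
    have "lborel = distr lborel borel T'" unfolding T'_def using p by (intro lborel_reindex bij_imp_bij_inv)
    then have "measure lborel X = measure (distr lborel borel T') X" by simp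
    also have "\<dots> = measure lborel (T' -` X)"
      using X borel_measurable_continuous_onI[OF T'c] by (subst measure_distr) auto
    also have "T' -` X = T ` X"
    proof (intro equalityI subsetI)
      fix y assume "y \<in> T' -` X" then show "y \<in> T ` X" by (intro image_eqI[of _ _ "T' y"]) (auto simp: TT')
    qed (auto simp: T'T)
    finally show "measure lebesgue (T ` X) = measure lebesgue X" using TXb X by simp
  qed
  define f' where "f' = T \<circ> f \<circ> T'"
  have lf': "linear f'" unfolding f'_def using lT lT' f by (intro linear_compose)
  have "matrix f' = (\<chi> i j. matrix f $ p i $ p j)"
  proof -
    have "T' (axis j 1) = axis (p j) 1" for j
      using p by (auto simp: T'_def axis_def vec_eq_iff bij_is_surj surj_f_inv_f bij_is_inj)
    then have "f' (axis j 1) $ i = f (axis (p j) 1) $ p i" for i j by (simp add: f'_def T_def)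
    then show ?thesis by (simp add: matrix_def vec_eq_iff)
  qed
  then have df: "det (matrix f') = det (matrix f)" by (simp add: det_reindex[OF p])
  have "T ` S \<in> lmeasurable"
  proof -
    have "bounded (T ` S)" using S(2) lT by (simp add: bounded_linear_image linear_conv_bounded_linear)
    then show ?thesis using TX(1)[OF S(1)] by (auto intro!: bounded_set_imp_lmeasurable)
  qed
  then have "measure lebesgue (f' ` T ` S) = \<bar>det (matrix f')\<bar> * measure lebesgue (T ` S)"
    by (rule measure_linear_image[OF lf'])
  moreover have "f' ` T ` S = T ` f ` S" by (simp add: f'_def image_comp o_def T'T)
  ultimately show "measure lebesgue (f ` S) = \<bar>det (matrix f)\<bar> * measure lebesgue S"
    using TX(2)[OF fS] TX(2)[OF S(1)] df by simp
qed

section \<open>Integer points and Blichfeldt's theorem\<close>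

lemma Zd_add: "x \<in> Zd \<Longrightarrow> y \<in> Zd \<Longrightarrow> x + y \<in> Zd"
  and Zd_diff: "x \<in> Zd \<Longrightarrow> y \<in> Zd \<Longrightarrow> x - y \<in> Zd"
  and Zd_uminus: "x \<in> Zd \<Longrightarrow> - x \<in> Zd"
  and Zd_0: "0 \<in> Zd"
  and Zd_scale: "x \<in> Zd \<Longrightarrow> c \<in> \<int> \<Longrightarrow> c *\<^sub>R x \<in> Zd"
  by (auto simp: Zd_def)

lemma Zd_add_cancel: "x + y \<in> Zd \<Longrightarrow> x \<in> Zd \<Longrightarrow> y \<in> Zd"
  using Zd_diff[of "x + y" x] by simp

lemma Zd_sum: "(\<And>i. i \<in> I \<Longrightarrow> f i \<in> Zd) \<Longrightarrow> sum f I \<in> Zd"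
  by (induction I rule: infinite_finite_induct) (auto intro: Zd_add Zd_0)

lemma finite_Zd_bounded:
  fixes B :: "(real^'n) set"
  assumes "bounded B" shows "finite (B \<inter> Zd)"
proof -
  obtain K where K: "\<And>x. x \<in> B \<Longrightarrow> norm x \<le> K" using assms by (auto simp: bounded_iff)
  define F where "F = (of_int ` {-\<lceil>K\<rceil>..\<lceil>K\<rceil>} :: real set)"
  have "B \<inter> Zd \<subseteq> (\<lambda>f. \<chi> i. f i) ` (Pi\<^sub>E (UNIV :: 'n set) (\<lambda>_. F))"
  proof
    fix x assume x: "x \<in> B \<inter> Zd"
    have "x $ i \<in> F" for i
    proof -
      have "\<bar>x $ i\<bar> \<le> K" using K[of x] x component_le_norm_cart[of x i] by auto
      moreover obtain z where "x $ i = of_int z" using x by (auto simp: Zd_def elim: Ints_cases)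
      ultimately show ?thesis by (auto simp: F_def intro!: imageI) linarith+
    qed
    then show "x \<in> (\<lambda>f. \<chi> i. f i) ` (Pi\<^sub>E (UNIV :: 'n set) (\<lambda>_. F))"
      by (intro image_eqI[of _ _ "\<lambda>i. x $ i"]) (auto simp: vec_eq_iff)
  qed
  moreover have "finite (Pi\<^sub>E (UNIV :: 'n set) (\<lambda>_. F))" by (intro finite_PiE) (auto simp: F_def)
  ultimately show ?thesis using finite_subset by blast
qed

text \<open>Subtracting the integer part moves \<open>S\<close> piecewise into the unit cube. If no
  two points of \<open>S\<close> were congruent modulo the lattice, the pieces would be disjoint
  there and the volume of \<open>S\<close> at most 1.\<close>

lemma blichfeldt:
  fixes S :: "(real^'n) set"
  assumes "S \<in> lmeasurable" "bounded S" "1 < measure lebesgue S"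
  shows "\<exists>x\<in>S. \<exists>y\<in>S. x \<noteq> y \<and> x - y \<in> Zd"
proof (rule ccontr)
  assume neg: "\<not> ?thesis"
  define fl :: "real^'n \<Rightarrow> real^'n" where "fl x = (\<chi> i. of_int \<lfloor>x $ i\<rfloor>)" for x
  define C :: "(real^'n) set" where "C = {x. \<forall>i. 0 \<le> x $ i \<and> x $ i < 1}"
  have fl_Zd: "fl x \<in> Zd" for x by (simp add: fl_def Zd_def)
  have flC: "x - fl x \<in> C" for x by (auto simp: C_def fl_def) linarith
  have Cb: "C \<subseteq> cbox 0 1" by (auto simp: C_def mem_box_cart less_imp_le)
  define A where "A = fl ` S"
  have "bounded A"
  proof -
    obtain K where K: "\<And>x. x \<in> S \<Longrightarrow> norm x \<le> K" using assms by (auto simp: bounded_iff)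
    obtain L where L: "\<And>x. x \<in> C \<Longrightarrow> norm x \<le> L"
      using bounded_subset[OF bounded_cbox Cb] by (auto simp: bounded_iff)
    have "norm (fl x) \<le> K + L" if "x \<in> S" for x
      using norm_triangle_ineq4[of x "x - fl x"] K[OF that] L[OF flC[of x]] by simp
    then show ?thesis by (auto simp: A_def bounded_iff)
  qed
  then have finA: "finite A" using finite_Zd_bounded[of A] fl_Zd by (metis A_def image_subsetI inf.absorb1)
  have "C \<in> sets borel" unfolding C_def by measurable
  then have Cm: "C \<in> sets lebesgue" by simp
  define T where "T a = ((+) (- a)) ` S \<inter> C" for a
  have Tm: "T a \<in> lmeasurable" for a unfolding T_def
    using measurable_translation[OF assms(1), of "-a"] Cm by (intro fmeasurable_Int_fmeasurable)
  have "S \<subseteq> (\<Union>a\<in>A. ((+) a) ` T a)"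
  proof
    fix x assume x: "x \<in> S"
    have "- fl x + x \<in> T (fl x)" using x flC[of x] by (auto simp: T_def)
    then have "x \<in> ((+) (fl x)) ` T (fl x)" by (metis add_minus_cancel image_eqI)
    then show "x \<in> (\<Union>a\<in>A. ((+) a) ` T a)" using x by (auto simp: A_def)
  qed
  then have "measure lebesgue S \<le> measure lebesgue (\<Union>a\<in>A. ((+) a) ` T a)"
    using finA assms(1) by (intro measure_mono_fmeasurable fmeasurable.finite_UN measurable_translation Tm) auto
  also have "\<dots> \<le> (\<Sum>a\<in>A. measure lebesgue (((+) a) ` T a))"
    using finA Tm by (intro measure_UNION_le) (auto intro!: measurable_translation fmeasurableD)
  also have "\<dots> = (\<Sum>a\<in>A. measure lebesgue (T a))" by (simp add: measure_translation)
  also have "\<dots> = measure lebesgue (\<Union>a\<in>A. T a)"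
  proof (rule measure_finite_Union[symmetric])
    show "disjoint_family_on T A"
    proof (unfold disjoint_family_on_def, intro ballI impI)
      fix a b assume ab: "a \<in> A" "b \<in> A" "a \<noteq> b"
      show "T a \<inter> T b = {}"
      proof (rule ccontr)
        assume "T a \<inter> T b \<noteq> {}"
        then obtain x y where "x \<in> S" "y \<in> S" and e: "- a + x = - b + y" by (auto simp: T_def)
        moreover have "x - y = a - b" using arg_cong[OF e, of "\<lambda>z. z + a - y"] by (simp add: algebra_simps)
        moreover have "a - b \<in> Zd" using ab by (auto simp: A_def intro!: Zd_diff fl_Zd)
        ultimately show False using neg ab by (metis eq_iff_diff_eq_0)
      qed
    qed
    show "T ` A \<subseteq> sets lebesgue" using Tm by (auto intro: fmeasurableD)
    show "emeasure lebesgue (T a) \<noteq> \<infinity>" for a using fmeasurableD2[OF Tm] by simp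
  qed (fact finA)
  also have "\<dots> \<le> measure lebesgue (cbox 0 1 :: (real^'n) set)"
  proof (rule measure_mono_fmeasurable)
    show "(\<Union>a\<in>A. T a) \<subseteq> cbox 0 1" using Cb by (auto simp: T_def)
    show "(\<Union>a\<in>A. T a) \<in> sets lebesgue" using finA Tm by (intro sets.finite_UN fmeasurableD)
  qed simp
  also have "\<dots> = 1" by (simp add: content_cbox_cart interval_ne_empty_cart)
  finally show False using assms by simp
qed

text \<open>Apply \<open>blichfeldt\<close> to the preimage of \<open>B\<close>. Neither convexity
  nor symmetry is asked of \<open>B\<close>: in the equality case it is a union of two
  boxes.\<close>

lemma blichfeldt_linear:
  fixes f :: "real^'n \<Rightarrow> real^'n"
  assumes f: "linear f" "det (matrix f) \<noteq> 0"
    and B: "B \<in> sets borel" "bounded B" "\<bar>det (matrix f)\<bar> < measure lebesgue B"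
  shows "\<exists>x\<in>Zd. x \<noteq> 0 \<and> (\<exists>p\<in>B. \<exists>q\<in>B. f x = p - q)"
proof -
  have "inj f" using f by (simp add: det_nz_iff_inj)
  then obtain g where g: "linear g" "g \<circ> f = id" using f(1) linear_injective_left_inverse by blast
  then have fg: "f \<circ> g = id" using f(1) by (metis linear_inverse_left)
  have "matrix f ** matrix g = mat 1" using f g fg by (metis matrix_compose matrix_id_mat_1)
  then have "det (matrix f) * det (matrix g) = 1" by (metis det_I det_mul)
  then have dg: "\<bar>det (matrix g)\<bar> = 1 / \<bar>det (matrix f)\<bar>" using f(2)
    by (metis abs_mult abs_one nonzero_eq_divide_eq abs_eq_0 mult.commute)
  have dg0: "det (matrix g) \<noteq> 0" using dg f(2) by auto
  have "measure lebesgue (g ` B) = measure lebesgue B / \<bar>det (matrix f)\<bar>"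
    using measure_linear_image_borel(2)[OF g(1) dg0 B(1,2)] dg by simp
  also have "\<dots> > 1" using B(3) f(2) by simp
  finally have "1 < measure lebesgue (g ` B)" .
  moreover have bd: "bounded (g ` B)" using B(2) g(1) by (simp add: bounded_linear_image linear_conv_bounded_linear)
  moreover have "g ` B \<in> lmeasurable"
    using measure_linear_image_borel(1)[OF g(1) dg0 B(1,2)] bd by (auto intro: bounded_set_imp_lmeasurable)
  ultimately obtain p q where pq: "p \<in> B" "q \<in> B" "g p \<noteq> g q" "g p - g q \<in> Zd"
    using blichfeldt[of "g ` B"] by blast
  moreover have "f (g p - g q) = p - q" using fg f(1) by (metis comp_apply id_apply linear_diff)
  ultimately show ?thesis by (intro bexI[of _ "g p - g q"]) auto
qed

text \<open>In a half-open box two points differ by strictly less than the side length in each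
  coordinate, and a box attached behind a facet is disjoint from it.\<close>

lemma halfopen_box_cart:
  fixes c :: "'n::finite \<Rightarrow> real" and a :: "'n::finite \<Rightarrow> real"
  assumes "\<And>i. 0 < c i"
  defines "B \<equiv> {x::real^'n. \<forall>i. a i \<le> x $ i \<and> x $ i < a i + c i}"
  shows "B \<in> sets borel" "bounded B" "measure lebesgue B = (\<Prod>i\<in>UNIV. c i)"
proof -
  let ?l = "\<chi> i. a i" and ?u = "\<chi> i. a i + c i"
  have sub: "box ?l ?u \<subseteq> B" "B \<subseteq> cbox ?l ?u"
    by (auto simp: B_def mem_box_cart less_imp_le)
  show b: "bounded B" using sub(2) bounded_cbox bounded_subset by blast
  show "B \<in> sets borel" unfolding B_def by measurable
  with b have m: "B \<in> lmeasurable" by (auto intro: bounded_set_imp_lmeasurable)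
  have ne: "cbox ?l ?u \<noteq> {}" using assms(1) by (auto simp: interval_ne_empty_cart less_imp_le)
  have "measure lebesgue (cbox ?l ?u) = (\<Prod>i\<in>UNIV. c i)"
    using content_cbox_cart[OF ne] by simp
  moreover have "measure lebesgue (box ?l ?u) = measure lebesgue (cbox ?l ?u)"
    by (simp add: measure_lborel_box_eq measure_lborel_cbox_eq)
  moreover have "measure lebesgue (box ?l ?u) \<le> measure lebesgue B"
    using sub m by (intro measure_mono_fmeasurable) auto
  moreover have "measure lebesgue B \<le> measure lebesgue (cbox ?l ?u)"
    using sub m by (intro measure_mono_fmeasurable) auto
  ultimately show "measure lebesgue B = (\<Prod>i\<in>UNIV. c i)" by linarith
qed

lemma minkowski_linear_forms:
  fixes f :: "real^'n \<Rightarrow> real^'n"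
  assumes "linear f" "det (matrix f) \<noteq> 0" and c: "\<And>i. 0 < c i"
    and "\<bar>det (matrix f)\<bar> < (\<Prod>i\<in>UNIV. c i)"
  shows "\<exists>x\<in>Zd. x \<noteq> 0 \<and> (\<forall>i. \<bar>f x $ i\<bar> < c i)"
proof -
  let ?B = "{x::real^'n. \<forall>i. 0 \<le> x $ i \<and> x $ i < 0 + c i}"
  obtain x p q where x: "x \<in> Zd" "x \<noteq> 0" and pq: "p \<in> ?B" "q \<in> ?B" "f x = p - q"
    using blichfeldt_linear[OF assms(1,2), of ?B] halfopen_box_cart[of c "\<lambda>_. 0"] assms by auto
  have "\<bar>f x $ i\<bar> < c i" for i
  proof -
    have "0 \<le> p $ i" "p $ i < c i" "0 \<le> q $ i" "q $ i < c i" using pq by auto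
    then show ?thesis by (auto simp: pq(3))
  qed
  with x show ?thesis by blast
qed

section \<open>Lattice volume of simplices\<close>

text \<open>\<open>idx\<close> numbers the coordinates from 0, with inverse \<open>num\<close>.\<close>

definition idx :: "nat \<Rightarrow> 'n::finite" where "idx k = coord_enum (Suc k)"

lemma bij_coord_enum: "bij_betw (coord_enum :: nat \<Rightarrow> 'n::finite) {1..CARD('n)} UNIV"
proof -
  have "\<exists>e. bij_betw e {1..CARD('n)} (UNIV :: 'n set)"
    by (intro finite_same_card_bij) auto
  then show ?thesis unfolding coord_enum_def by (rule someI_ex)
qed

lemma bij_idx: "bij_betw (idx :: nat \<Rightarrow> 'n::finite) {..<CARD('n)} UNIV"
proof -
  have "bij_betw Suc {..<CARD('n)} {1..CARD('n)}"
    by (rule bij_betwI[of _ _ _ "\<lambda>k. k - 1"]) auto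
  from bij_betw_trans[OF this bij_coord_enum] show ?thesis by (simp add: idx_def[abs_def] o_def)
qed

definition num :: "'n::finite \<Rightarrow> nat" where "num i = inv_into {..<CARD('n)} idx i"

lemma num_less: "num (i :: 'n::finite) < CARD('n)"
  using bij_idx[where 'n='n] unfolding num_def by (metis bij_betw_def inv_into_into lessThan_iff UNIV_I)

lemma idx_num [simp]: "idx (num i) = i"
  using bij_idx unfolding num_def by (metis UNIV_I bij_betw_inv_into_right)

lemma num_idx [simp]: "k < CARD('n) \<Longrightarrow> num (idx k :: 'n::finite) = k"
  using bij_idx unfolding num_def by (metis bij_betw_inv_into_left lessThan_iff)

lemma all_idx: "(\<forall>i::'n::finite. P i) \<longleftrightarrow> (\<forall>k<CARD('n). P (idx k))"
  by (metis idx_num num_less)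

lemma prod_idx: "(\<Prod>i\<in>(UNIV :: 'n::finite set). f i) = (\<Prod>k<CARD('n). f (idx k))"
  by (rule prod.reindex_bij_betw[OF bij_idx, symmetric])

lemma sum_idx: "(\<Sum>i\<in>(UNIV :: 'n::finite set). f i) = (\<Sum>k<CARD('n). f (idx k))"
  by (rule sum.reindex_bij_betw[OF bij_idx, symmetric])

section \<open>Product measures and cylinders\<close>

lemma measurable_vec_of_PiM:
  "(\<lambda>f. (\<chi> i. f (num i)) :: real^'n) \<in> borel_measurable (Pi\<^sub>M {..<CARD('n)} (\<lambda>_. lborel :: real measure))"
  (is "_ \<in> borel_measurable ?P")
proof (rule borel_measurable_euclidean_space[THEN iffD2], intro ballI)
  fix b :: "real^'n" assume "b \<in> Basis"
  then obtain i where b: "b = axis i 1" by (auto simp: Basis_vec_def)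
  have "(\<lambda>f. f (num i)) \<in> measurable ?P lborel"
    by (rule measurable_component_singleton) (simp add: num_less)
  then show "(\<lambda>f. (\<chi> i. f (num i)) \<bullet> b) \<in> borel_measurable ?P" by (simp add: b inner_axis)
qed

text \<open>\<open>euclid_vol\<close> measures in a product over \<open>{..<i}\<close>, whereas
  determinants act on \<open>real^'n\<close>; this identification connects the two.\<close>

lemma lborel_eq_distr_PiM:
  "(lborel :: (real^'n) measure) =
    distr (Pi\<^sub>M {..<CARD('n)} (\<lambda>_. lborel)) borel (\<lambda>f. \<chi> i. f (num i))"
proof (rule lborel_eqI)
  let ?P = "Pi\<^sub>M {..<CARD('n)} (\<lambda>_. lborel :: real measure)"
  interpret product_sigma_finite "\<lambda>_::nat. lborel :: real measure" by standard
  have m: "(\<lambda>f. (\<chi> i. f (num i)) :: real^'n) \<in> borel_measurable ?P"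
    by (rule measurable_vec_of_PiM)
  fix l u :: "real^'n"
  assume lu: "\<And>b. b \<in> Basis \<Longrightarrow> l \<bullet> b \<le> u \<bullet> b"
  have lu': "l $ i \<le> u $ i" for i using lu[of "axis i 1"] by (simp add: inner_axis)
  have "emeasure (distr ?P borel (\<lambda>f. \<chi> i. f (num i))) (box l u)
    = emeasure ?P ((\<lambda>f. \<chi> i. f (num i)) -` box l u \<inter> space ?P)"
    using m by (subst emeasure_distr) auto
  also have "(\<lambda>f. \<chi> i. f (num i)) -` box l u \<inter> space ?P
     = Pi\<^sub>E {..<CARD('n)} (\<lambda>k. {l $ idx k <..< u $ idx k})"
  proof -
    have "(\<forall>i. l $ i < f (num i) \<and> f (num i) < u $ i) \<longleftrightarrow> (\<forall>k<CARD('n). l $ idx k < f k \<and> f k < u $ idx k)" for f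
      by (subst all_idx) (simp cong: conj_cong)
    then show ?thesis by (auto simp: mem_box_cart space_PiM PiE_iff)
  qed
  also have "emeasure ?P \<dots> = (\<Prod>k<CARD('n). emeasure lborel {l $ idx k <..< u $ idx k})"
    by (intro emeasure_PiM) auto
  also have "\<dots> = (\<Prod>k<CARD('n). ennreal (u $ idx k - l $ idx k))" using lu' by simp
  also have "\<dots> = ennreal (\<Prod>k<CARD('n). (u $ idx k - l $ idx k))" using lu' by (intro prod_ennreal) simp
  also have "(\<Prod>k<CARD('n). (u $ idx k - l $ idx k)) = (\<Prod>i\<in>UNIV. u $ i - l $ i)" by (rule prod_idx[symmetric])
  also have "\<dots> = (\<Prod>b\<in>Basis. (u - l) \<bullet> b)"
    by (simp add: Basis_vec_def prod.UNION_disjoint axis_eq_axis inner_axis)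
  finally show "emeasure (distr ?P borel (\<lambda>f. \<chi> i. f (num i))) (box l u)
     = ennreal (\<Prod>b\<in>Basis. (u - l) \<bullet> b)" .
qed simp

text \<open>Multiplying by a unit cube in the remaining coordinates turns \<open>l\<close>-dimensional volumes into
  \<open>d\<close>-dimensional ones, for which determinants are available.\<close>

definition cyl :: "nat \<Rightarrow> (nat \<Rightarrow> real) set \<Rightarrow> (real^'n) set" where
  "cyl l E = {x. (\<lambda>k\<in>{..<l}. x $ idx k) \<in> E \<and> (\<forall>k\<in>{l..<CARD('n)}. 0 \<le> x $ idx k \<and> x $ idx k \<le> 1)}"

text \<open>\<open>merge\<close> identifies the product over all coordinates with the product over
  the first \<open>l\<close> times the product over the rest; there the cylinder is \<open>E\<close>
  times a cube of measure 1.\<close>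

lemma measure_cyl:
  assumes l: "l \<le> CARD('n)" and E: "E \<in> sets (Pi\<^sub>M {..<l} (\<lambda>_. lborel))"
  shows "(cyl l E :: (real^'n) set) \<in> sets borel"
    and "measure lebesgue (cyl l E :: (real^'n) set) = measure (Pi\<^sub>M {..<l} (\<lambda>_. lborel)) E"
proof -
  let ?d = "CARD('n)"
  let ?L = "\<lambda>_::nat. lborel :: real measure"
  let ?I = "{..<l}" and ?J = "{l..<CARD('n)}"
  interpret product_sigma_finite ?L by standard
  have m1: "(\<lambda>x::real^'n. \<lambda>k\<in>?I. x $ idx k) \<in> measurable borel (Pi\<^sub>M ?I ?L)"
    by (intro measurable_restrict) auto
  have "(\<lambda>x::real^'n. \<lambda>k\<in>?I. x $ idx k) -` E \<inter> space borel \<in> sets borel"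
    using m1 E by (rule measurable_sets)
  moreover have "{x::real^'n. \<forall>k\<in>?J. 0 \<le> x $ idx k \<and> x $ idx k \<le> 1} \<in> sets borel"
    by measurable
  moreover have "(cyl l E :: (real^'n) set) = ((\<lambda>x. \<lambda>k\<in>?I. x $ idx k) -` E \<inter> space borel) \<inter> {x. \<forall>k\<in>?J. 0 \<le> x $ idx k \<and> x $ idx k \<le> 1}"
    by (auto simp: cyl_def)
  ultimately show cb: "(cyl l E :: (real^'n) set) \<in> sets borel" by auto
  have IJ: "?I \<union> ?J = {..<?d}" "?I \<inter> ?J = {}" using l by auto
  let ?\<Phi> = "\<lambda>f. (\<chi> i. f (num i)) :: real^'n"
  let ?A = "?\<Phi> -` cyl l E \<inter> space (Pi\<^sub>M {..<?d} ?L)"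
  have m: "?\<Phi> \<in> measurable (Pi\<^sub>M {..<?d} ?L) borel"
    by (rule measurable_vec_of_PiM)
  have Am: "?A \<in> sets (Pi\<^sub>M {..<?d} ?L)" using m cb by (rule measurable_sets)
  have spE: "E \<subseteq> space (Pi\<^sub>M ?I ?L)" using E by (rule sets.sets_into_space)
  have "emeasure lborel (cyl l E :: (real^'n) set) = emeasure (Pi\<^sub>M {..<?d} ?L) ?A"
    by (subst lborel_eq_distr_PiM, subst emeasure_distr[OF m cb]) simp
  also have "\<dots> = emeasure (distr (Pi\<^sub>M ?I ?L \<Otimes>\<^sub>M Pi\<^sub>M ?J ?L) (Pi\<^sub>M (?I \<union> ?J) ?L) (merge ?I ?J)) ?A"
    using IJ by (subst distr_merge) (auto simp: IJ)
  also have "\<dots> = emeasure (Pi\<^sub>M ?I ?L \<Otimes>\<^sub>M Pi\<^sub>M ?J ?L) (merge ?I ?J -` ?A \<inter> space (Pi\<^sub>M ?I ?L \<Otimes>\<^sub>M Pi\<^sub>M ?J ?L))"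
    using Am by (intro emeasure_distr measurable_merge) (simp add: IJ)
  also have "merge ?I ?J -` ?A \<inter> space (Pi\<^sub>M ?I ?L \<Otimes>\<^sub>M Pi\<^sub>M ?J ?L) = E \<times> Pi\<^sub>E ?J (\<lambda>_. {0..1})"
  proof (intro equalityI subsetI)
    fix p assume p: "p \<in> merge ?I ?J -` ?A \<inter> space (Pi\<^sub>M ?I ?L \<Otimes>\<^sub>M Pi\<^sub>M ?J ?L)"
    obtain f g where fg: "p = (f, g)" by (cases p)
    from p fg have f: "f \<in> extensional ?I" and g: "g \<in> extensional ?J"
      by (auto simp: space_pair_measure space_PiM PiE_def)
    from p fg have c: "?\<Phi> (merge ?I ?J (f, g)) \<in> cyl l E" by auto
    have "(\<lambda>k\<in>?I. ?\<Phi> (merge ?I ?J (f, g)) $ idx k) = f"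
    proof
      fix k show "(\<lambda>k\<in>?I. ?\<Phi> (merge ?I ?J (f, g)) $ idx k) k = f k"
        using f l by (cases "k < l") (auto simp: merge_def extensional_def)
    qed
    then have "f \<in> E" using c by (simp add: cyl_def)
    moreover have "0 \<le> g k \<and> g k \<le> 1" if "k \<in> ?J" for k
    proof -
      have "?\<Phi> (merge ?I ?J (f, g)) $ idx k = g k" using that by (auto simp: merge_def)
      moreover have "\<forall>k\<in>?J. 0 \<le> ?\<Phi> (merge ?I ?J (f, g)) $ idx k \<and> ?\<Phi> (merge ?I ?J (f, g)) $ idx k \<le> 1"
        using c unfolding cyl_def by blast
      ultimately show ?thesis using that by metis
    qed
    ultimately show "p \<in> E \<times> Pi\<^sub>E ?J (\<lambda>_. {0..1})" using fg g by (auto simp: PiE_def)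
  next
    fix p :: "(nat \<Rightarrow> real) \<times> (nat \<Rightarrow> real)" assume "p \<in> E \<times> Pi\<^sub>E ?J (\<lambda>_. {0..1})"
    then obtain f g where fg: "p = (f, g)" "f \<in> E" "g \<in> Pi\<^sub>E ?J (\<lambda>_. {0..1})" by (cases p) auto
    have f: "f \<in> extensional ?I" using fg spE by (auto simp: space_PiM PiE_def)
    have "(\<lambda>k\<in>?I. ?\<Phi> (merge ?I ?J (f, g)) $ idx k) = f"
    proof
      fix k show "(\<lambda>k\<in>?I. ?\<Phi> (merge ?I ?J (f, g)) $ idx k) k = f k"
        using f l by (cases "k < l") (auto simp: merge_def extensional_def)
    qed
    moreover have "?\<Phi> (merge ?I ?J (f, g)) $ idx k = g k" if "k \<in> ?J" for k using that by (auto simp: merge_def)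
    moreover have "\<forall>k\<in>?J. 0 \<le> g k \<and> g k \<le> 1" using fg(3) by (auto simp: PiE_iff)
    ultimately have "?\<Phi> (merge ?I ?J (f, g)) \<in> cyl l E" using fg(2) unfolding cyl_def mem_Collect_eq by metis
    moreover have "merge ?I ?J (f, g) \<in> space (Pi\<^sub>M {..<?d} ?L)"
      using l by (auto simp: space_PiM PiE_def merge_def extensional_def)
    ultimately show "p \<in> merge ?I ?J -` ?A \<inter> space (Pi\<^sub>M ?I ?L \<Otimes>\<^sub>M Pi\<^sub>M ?J ?L)"
      using fg spE by (auto simp: space_pair_measure space_PiM PiE_def)
  qed
  also have "emeasure (Pi\<^sub>M ?I ?L \<Otimes>\<^sub>M Pi\<^sub>M ?J ?L) (E \<times> Pi\<^sub>E ?J (\<lambda>_. {0..1}))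
    = emeasure (Pi\<^sub>M ?I ?L) E * emeasure (Pi\<^sub>M ?J ?L) (Pi\<^sub>E ?J (\<lambda>_. {0..1}))"
  proof -
    interpret J: sigma_finite_measure "Pi\<^sub>M ?J ?L" by (rule sigma_finite) simp
    show ?thesis using E by (intro J.emeasure_pair_measure_Times sets_PiM_I_finite) auto
  qed
  also have "emeasure (Pi\<^sub>M ?J ?L) (Pi\<^sub>E ?J (\<lambda>_. {0..1})) = 1" by (subst emeasure_PiM) auto
  finally show "measure lebesgue (cyl l E :: (real^'n) set) = measure (Pi\<^sub>M {..<l} ?L) E"
    using cb by (simp add: measure_def)
qed

lemma bounded_cyl:
  assumes "\<And>y k. y \<in> E \<Longrightarrow> k < l \<Longrightarrow> 0 \<le> y k \<and> y k \<le> 1"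
  shows "bounded (cyl l E :: (real^'n) set)"
proof -
  have "cyl l E \<subseteq> (cbox 0 1 :: (real^'n) set)"
  proof
    fix x :: "real^'n" assume x: "x \<in> cyl l E"
    have "0 \<le> x $ idx k \<and> x $ idx k \<le> 1" if "k < CARD('n)" for k
    proof (cases "k < l")
      case True
      with x assms[of "\<lambda>k\<in>{..<l}. x $ idx k" k] show ?thesis by (auto simp: cyl_def)
    qed (use x that in \<open>auto simp: cyl_def\<close>)
    then show "x \<in> cbox 0 1" unfolding mem_box_cart by (subst all_idx) simp
  qed
  then show ?thesis using bounded_cbox bounded_subset by blast
qed

section \<open>Euclidean volume as a determinant\<close>

definition comb :: "(nat \<Rightarrow> real^'n) \<Rightarrow> real^'n \<Rightarrow> real^'n" where
  "comb p x = (\<Sum>k<CARD('n). x $ idx k *\<^sub>R p k)"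

lemma linear_comb: "linear (comb p)"
  by (rule linearI) (auto simp: comb_def algebra_simps sum.distrib scaleR_sum_right)

definition fill :: "nat \<Rightarrow> (nat \<Rightarrow> 'a) \<Rightarrow> (nat \<Rightarrow> 'a) \<Rightarrow> nat \<Rightarrow> 'a" where
  "fill l w z k = (if k < l then w k else z k)"

lemma comb_fill:
  assumes "l \<le> CARD('n)"
  shows "comb (fill l w z) (x::real^'n) = (\<Sum>k<l. x $ idx k *\<^sub>R w k) + (\<Sum>k\<in>{l..<CARD('n)}. x $ idx k *\<^sub>R z k)"
proof -
  have e: "{..<CARD('n)} = {..<l} \<union> {l..<CARD('n)}" using assms by auto
  show ?thesis unfolding comb_def e
    by (subst sum.union_disjoint) (auto simp: fill_def intro!: arg_cong2[of _ _ _ _ "(+)"] sum.cong)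
qed

lemma ex_onb:
  fixes V :: "'a::euclidean_space set"
  assumes "subspace V" shows "\<exists>u. is_onb V (dim V) u"
proof -
  obtain B where B: "B \<subseteq> V" "pairwise orthogonal B" "\<And>x. x \<in> B \<Longrightarrow> norm x = 1" "independent B" "card B = dim V" "span B = V"
    using orthonormal_basis_subspace[OF assms] by blast
  have "finite B" using B(4) by (simp add: independent_imp_finite)
  then obtain u where u: "bij_betw u {..<dim V} B"
    using B(5) by (metis atLeast0LessThan ex_bij_betw_nat_finite)
  have "is_onb V (dim V) u" unfolding is_onb_def
  proof (intro conjI allI impI)
    show "u k \<in> V" if "k < dim V" for k using u that B(1) by (auto simp: bij_betw_def)
    show "span (u ` {..<dim V}) = V" using u B(6) by (simp add: bij_betw_def)
    fix j k assume jk: "j < dim V" "k < dim V"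
    then have mem: "u j \<in> B" "u k \<in> B" using u by (auto simp: bij_betw_def)
    show "u j \<bullet> u k = (if j = k then 1 else 0)"
    proof (cases "j = k")
      case True then show ?thesis using B(3)[OF mem(1)] by (simp add: dot_square_norm)
    next
      case False
      then have "u j \<noteq> u k" using u jk by (auto simp: bij_betw_def inj_on_def)
      then show ?thesis using B(2) mem False by (auto simp: pairwise_def orthogonal_def)
    qed
  qed
  then show ?thesis by blast
qed

text \<open>For \<open>dim V = l\<close> this is an orthonormal basis of the orthogonal complement
  of \<open>V\<close>. Its indices start at \<open>l\<close>, so that \<open>fill\<close> can place
  it behind \<open>l\<close> vectors of \<open>V\<close>.\<close>

definition compl_onb :: "(real^'n) set \<Rightarrow> nat \<Rightarrow> (nat \<Rightarrow> real^'n) \<Rightarrow> bool" where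
  "compl_onb V l z \<longleftrightarrow> (\<forall>k\<in>{l..<CARD('n)}. \<forall>x\<in>V. z k \<bullet> x = 0) \<and>
     (\<forall>j\<in>{l..<CARD('n)}. \<forall>k\<in>{l..<CARD('n)}. z j \<bullet> z k = (if j = k then 1 else 0))"

lemma ex_compl_onb:
  fixes V :: "(real^'n) set"
  assumes "subspace V" shows "\<exists>z. compl_onb V (dim V) z"
proof -
  let ?W = "{y \<in> UNIV. \<forall>x\<in>V. orthogonal x y}"
  have "subspace ?W" using subspace_orthogonal_to_vectors[of V] by simp
  then obtain u where u: "is_onb ?W (dim ?W) u" using ex_onb by blast
  have d: "dim ?W + dim V = CARD('n)"
    using dim_subspace_orthogonal_to_vectors[OF assms subspace_UNIV] by simp
  have "compl_onb V (dim V) (\<lambda>k. u (k - dim V))"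
    unfolding compl_onb_def
  proof (intro conjI ballI)
    fix k x assume "k \<in> {dim V..<CARD('n)}" "x \<in> V"
    then show "u (k - dim V) \<bullet> x = 0" using u d unfolding is_onb_def by (auto simp: orthogonal_def inner_commute)
  next
    fix j k assume "j \<in> {dim V..<CARD('n)}" "k \<in> {dim V..<CARD('n)}"
    moreover from this have "j - dim V = k - dim V \<longleftrightarrow> j = k" by auto
    ultimately show "u (j - dim V) \<bullet> u (k - dim V) = (if j = k then 1 else 0)"
      using u d unfolding is_onb_def by auto
  qed
  then show ?thesis by blast
qed

lemma orthogonal_comb:
  fixes p :: "nat \<Rightarrow> real^'n"
  assumes "\<And>j k. j < CARD('n) \<Longrightarrow> k < CARD('n) \<Longrightarrow> p j \<bullet> p k = (if j = k then 1 else 0)"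
  shows "orthogonal_transformation (comb p)"
proof -
  have "comb p x \<bullet> comb p y = x \<bullet> y" for x y
  proof -
    have "comb p x \<bullet> comb p y = (\<Sum>j<CARD('n). \<Sum>k<CARD('n). (x $ idx j * y $ idx k) * (p j \<bullet> p k))"
      unfolding comb_def inner_sum_left inner_sum_right
      by (subst sum.swap) (simp add: mult_ac)
    also have "\<dots> = (\<Sum>j<CARD('n). \<Sum>k<CARD('n). (if j = k then x $ idx j * y $ idx k else 0))"
      by (intro sum.cong refl) (auto simp: assms)
    also have "\<dots> = (\<Sum>j<CARD('n). x $ idx j * y $ idx j)" by simp
    also have "\<dots> = x \<bullet> y" unfolding inner_vec_def sum_idx by simp
    finally show ?thesis .
  qed
  then show ?thesis by (simp add: orthogonal_transformation_def linear_comb)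
qed

text \<open>The comparison takes place in dimension \<open>d\<close>: the cylinder over the domain
  \<open>X\<close> measured by \<open>euclid_vol\<close>, mapped by the orthonormal frame
  \<open>u\<close>, \<open>z\<close>, and the cylinder over \<open>E\<close>, mapped by
  \<open>w\<close>, \<open>z\<close>, are translates of each other, as both add the same unit cube
  along \<open>z\<close>. The frame map has determinant 1 in absolute value, so the arbitrary
  choices of \<open>u\<close> and of the base point \<open>a\<close> drop out.\<close>

lemma euclid_vol_param:
  fixes F :: "(real^'n) set" and w :: "nat \<Rightarrow> real^'n"
  assumes V: "diff_space F = V" "dim V = l" and z: "compl_onb V l z"
    and w: "\<And>k. k < l \<Longrightarrow> w k \<in> V"
    and E: "E \<in> sets (Pi\<^sub>M {..<l} (\<lambda>_. lborel))" "bounded (cyl l E :: (real^'n) set)"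
    and F: "F = {v + (\<Sum>k<l. y k *\<^sub>R w k) | y. y \<in> E}" "F \<noteq> {}" "F \<in> sets borel"
    and det: "det (matrix (comb (fill l w z))) \<noteq> 0"
  shows "euclid_vol F = \<bar>det (matrix (comb (fill l w z)))\<bar> * measure (Pi\<^sub>M {..<l} (\<lambda>_. lborel)) E"
proof -
  let ?d = "CARD('n)"
  let ?M = "Pi\<^sub>M {..<l} (\<lambda>_. lborel :: real measure)"
  have sV: "subspace V" unfolding V(1)[symmetric] diff_space_def by (rule subspace_span)
  have ld: "l \<le> ?d" using V(2) dim_subset_UNIV[of V] by simp
  define u where "u = (SOME u. is_onb V l u)"
  have u: "is_onb V l u" unfolding u_def using ex_onb[OF sV] unfolding V(2) by (rule someI_ex)
  define a where "a = (SOME a. a \<in> F)"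
  have aF: "a \<in> F" unfolding a_def using F(2) by (simp add: some_in_eq)
  define X where "X = {t \<in> space ?M. a + (\<Sum>k<l. t k *\<^sub>R u k) \<in> F}"
  have vol: "euclid_vol F = measure ?M X"
    unfolding euclid_vol_def Let_def V u_def a_def X_def ..
  have Xm: "X \<in> sets ?M"
  proof -
    have "(\<lambda>t. a + (\<Sum>k<l. t k *\<^sub>R u k)) \<in> borel_measurable ?M" by measurable
    then have "(\<lambda>t. a + (\<Sum>k<l. t k *\<^sub>R u k)) -` F \<inter> space ?M \<in> sets ?M" using F(3) by (rule measurable_sets)
    moreover have "X = (\<lambda>t. a + (\<Sum>k<l. t k *\<^sub>R u k)) -` F \<inter> space ?M" by (auto simp: X_def)
    ultimately show ?thesis by simp
  qed
  let ?U = "comb (fill l u z)" and ?W = "comb (fill l w z)"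
  have orthU: "orthogonal_transformation ?U"
  proof (rule orthogonal_comb)
    fix j k assume "j < ?d" "k < ?d"
    then show "fill l u z j \<bullet> fill l u z k = (if j = k then 1 else 0)"
      using u z by (auto simp: fill_def is_onb_def compl_onb_def inner_commute)
  qed
  have detU: "\<bar>det (matrix ?U)\<bar> = 1" using orthogonal_transformation_det[OF orthU] .
  have va: "v - a \<in> V"
  proof -
    obtain y where "a = v + (\<Sum>k<l. y k *\<^sub>R w k)" using aF unfolding F(1) by blast
    then have "v - a = - (\<Sum>k<l. y k *\<^sub>R w k)" by simp
    then show ?thesis using w sV by (auto intro!: subspace_neg subspace_sum subspace_scale)
  qed
  have spE: "E \<subseteq> space ?M" using E(1) by (rule sets.sets_into_space)
  \<comment> \<open>Only the first \<open>l\<close> coordinates change, between expansions in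
    \<open>u\<close> and in \<open>w\<close>; the coordinates along \<open>z\<close> are
    copied.\<close>
  have eq: "?U ` cyl l X = (+) (v - a) ` ?W ` cyl l E"
  proof (intro equalityI subsetI)
    fix q assume "q \<in> ?U ` cyl l X"
    then obtain x where x: "x \<in> cyl l X" "q = ?U x" by auto
    then have "a + (\<Sum>k<l. x $ idx k *\<^sub>R u k) \<in> F" by (simp add: cyl_def X_def)
    then obtain y where y: "y \<in> E" "a + (\<Sum>k<l. x $ idx k *\<^sub>R u k) = v + (\<Sum>k<l. y k *\<^sub>R w k)" unfolding F(1) by blast
    define x' :: "real^'n" where "x' = (\<chi> i. if num i < l then y (num i) else x $ i)"
    have x'1: "x' $ idx k = y k" if "k < l" for k using that ld by (simp add: x'_def)
    have x'2: "x' $ idx k = x $ idx k" if "k \<in> {l..<?d}" for k using that ld by (simp add: x'_def)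
    have "(\<lambda>k\<in>{..<l}. x' $ idx k) = y"
      using y(1) spE x'1 by (auto simp: space_PiM PiE_def extensional_def fun_eq_iff)
    moreover have "\<forall>k\<in>{l..<?d}. 0 \<le> x $ idx k \<and> x $ idx k \<le> 1" using x(1) unfolding cyl_def by blast
    ultimately have "x' \<in> cyl l E" unfolding cyl_def mem_Collect_eq using y(1) x'2 by simp
    moreover have "q = (v - a) + ?W x'"
      unfolding x(2) comb_fill[OF ld] using y(2) x'1 x'2 by (simp add: algebra_simps)
    ultimately show "q \<in> (+) (v - a) ` ?W ` cyl l E" by blast
  next
    fix q assume "q \<in> (+) (v - a) ` ?W ` cyl l E"
    then obtain x' where x': "x' \<in> cyl l E" "q = v - a + ?W x'" by auto
    have "v - a + (\<Sum>k<l. x' $ idx k *\<^sub>R w k) \<in> V"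
      using va w sV by (auto intro!: subspace_add subspace_sum subspace_scale)
    then have "v - a + (\<Sum>k<l. x' $ idx k *\<^sub>R w k) \<in> span (u ` {..<l})" using u by (simp add: is_onb_def)
    moreover have "inj_on u {..<l}"
    proof (rule inj_onI)
      fix j k assume "j \<in> {..<l}" "k \<in> {..<l}" "u j = u k"
      then show "j = k" using u unfolding is_onb_def by (metis lessThan_iff zero_neq_one)
    qed
    ultimately obtain c where "(\<Sum>b\<in>u ` {..<l}. c b *\<^sub>R b) = v - a + (\<Sum>k<l. x' $ idx k *\<^sub>R w k)"
      using span_finite[of "u ` {..<l}"] by auto
    then have c: "(\<Sum>k<l. c (u k) *\<^sub>R u k) = v - a + (\<Sum>k<l. x' $ idx k *\<^sub>R w k)"
      using \<open>inj_on u {..<l}\<close> by (simp add: sum.reindex)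
    define x :: "real^'n" where "x = (\<chi> i. if num i < l then c (u (num i)) else x' $ i)"
    have x1: "x $ idx k = c (u k)" if "k < l" for k using that ld by (simp add: x_def)
    have x2: "x $ idx k = x' $ idx k" if "k \<in> {l..<?d}" for k using that ld by (simp add: x_def)
    have "a + (\<Sum>k<l. x $ idx k *\<^sub>R u k) = v + (\<Sum>k<l. (\<lambda>k\<in>{..<l}. x' $ idx k) k *\<^sub>R w k)" using c x1 by simp
    then have "a + (\<Sum>k<l. x $ idx k *\<^sub>R u k) \<in> F" using x'(1) unfolding F(1) cyl_def by blast
    then have "(\<lambda>k\<in>{..<l}. x $ idx k) \<in> X" by (auto simp: X_def space_PiM)
    moreover have "\<forall>k\<in>{l..<?d}. 0 \<le> x' $ idx k \<and> x' $ idx k \<le> 1" using x'(1) unfolding cyl_def by blast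
    ultimately have "x \<in> cyl l X" unfolding cyl_def mem_Collect_eq using x2 by simp
    moreover have "q = ?U x" unfolding x'(2) comb_fill[OF ld] using c x1 x2 by simp
    ultimately show "q \<in> ?U ` cyl l X" by blast
  qed
  have Wb: "?W ` cyl l E \<in> sets borel" and Wm: "measure lebesgue (?W ` cyl l E) = \<bar>det (matrix ?W)\<bar> * measure ?M E"
    using measure_linear_image_borel[OF linear_comb det measure_cyl(1)[OF ld E(1)] E(2)] measure_cyl(2)[OF ld E(1)] by auto
  have "bounded (?W ` cyl l E)" using E(2) by (intro bounded_linear_image) (auto simp: linear_conv_bounded_linear[symmetric] linear_comb)
  then have "bounded (?U ` cyl l X)" unfolding eq by (rule bounded_translation)
  then have "bounded (cyl l X :: (real^'n) set)"
    using orthU by (simp add: bounded_iff orthogonal_transformation_norm)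
  then have "measure lebesgue (?U ` cyl l X) = 1 * measure ?M X"
    using measure_linear_image_borel(2)[OF linear_comb _ measure_cyl(1)[OF ld Xm], of "fill l u z"] detU measure_cyl(2)[OF ld Xm] by auto
  then have "measure ?M X = measure lebesgue ((+) (v - a) ` ?W ` cyl l E)" unfolding eq by simp
  also have "\<dots> = measure lebesgue (?W ` cyl l E)" by (rule measure_translation)
  finally show ?thesis using vol Wm by simp
qed

section \<open>Independent families and lattice bases\<close>

definition fam_indep :: "nat \<Rightarrow> (nat \<Rightarrow> 'a::real_vector) \<Rightarrow> bool" where
  "fam_indep l w \<longleftrightarrow> (\<forall>c. (\<Sum>k<l. c k *\<^sub>R w k) = 0 \<longrightarrow> (\<forall>k<l. c k = (0::real)))"

lemma fam_indepD: "fam_indep l w \<Longrightarrow> (\<Sum>k<l. c k *\<^sub>R w k) = 0 \<Longrightarrow> k < l \<Longrightarrow> c k = 0"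
  by (auto simp: fam_indep_def)

lemma fam_indep_iff: "fam_indep l w \<longleftrightarrow> inj_on w {..<l} \<and> independent (w ` {..<l})"
proof
  assume f: "fam_indep l w"
  have inj: "inj_on w {..<l}"
  proof (rule inj_onI, rule ccontr)
    fix i j assume ij: "i \<in> {..<l}" "j \<in> {..<l}" "w i = w j" "i \<noteq> j"
    let ?c = "\<lambda>k. (if k = i then 1 else 0) - (if k = j then 1 else (0::real))"
    have "(\<Sum>k<l. ?c k *\<^sub>R w k) = 0" using ij
      by (simp add: scaleR_diff_left sum_subtractf if_distrib[of "\<lambda>c. c *\<^sub>R _"] cong: if_cong)
    from fam_indepD[OF f this, of i] ij show False by auto
  qed
  moreover have "independent (w ` {..<l})"
  proof (rule independent_if_scalars_zero)
    fix u x assume s: "(\<Sum>x\<in>w ` {..<l}. u x *\<^sub>R x) = 0" and x: "x \<in> w ` {..<l}"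
    have "(\<Sum>k<l. u (w k) *\<^sub>R w k) = 0" using s inj by (simp add: sum.reindex)
    from fam_indepD[OF f this] x show "u x = 0" by auto
  qed simp
  ultimately show "inj_on w {..<l} \<and> independent (w ` {..<l})" by blast
next
  assume a: "inj_on w {..<l} \<and> independent (w ` {..<l})"
  show "fam_indep l w" unfolding fam_indep_def
  proof (intro allI impI)
    fix c k assume s: "(\<Sum>k<l. c k *\<^sub>R w k) = 0" and k: "k < l"
    let ?u = "\<lambda>x. c (inv_into {..<l} w x)"
    have "(\<Sum>x\<in>w ` {..<l}. ?u x *\<^sub>R x) = (\<Sum>k<l. ?u (w k) *\<^sub>R w k)" using a by (simp add: sum.reindex)
    also have "\<dots> = (\<Sum>k<l. c k *\<^sub>R w k)" using a by (intro sum.cong) auto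
    finally have "(\<Sum>x\<in>w ` {..<l}. ?u x *\<^sub>R x) = 0" using s by simp
    then have "?u (w k) = 0" using a k by (intro independentD[of "w ` {..<l}" "w ` {..<l}"]) auto
    then show "c k = 0" using a k by simp
  qed
qed

lemma fam_sum_in_span: "(\<Sum>k<l. c k *\<^sub>R w k) \<in> span (w ` {..<l::nat})"
  by (intro span_sum span_scale span_base) auto

lemma span_fam: "span (w ` {..<l::nat}) = {\<Sum>k<l. c k *\<^sub>R w k | c. True}"
proof (intro equalityI subsetI)
  fix x assume "x \<in> span (w ` {..<l})"
  then show "x \<in> {\<Sum>k<l. c k *\<^sub>R w k | c. True}"
  proof (induction rule: span_induct_alt)
    case base
    show ?case by (auto intro!: exI[of _ "\<lambda>_. 0"])
  next
    case (step a x y)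
    then obtain k c where k: "k < l" "x = w k" "y = (\<Sum>k<l. c k *\<^sub>R w k)" by auto
    have "a *\<^sub>R x + y = (\<Sum>i<l. (c i + (if i = k then a else 0)) *\<^sub>R w i)"
      using k by (simp add: scaleR_add_left sum.distrib if_distrib[of "\<lambda>c. c *\<^sub>R _"] cong: if_cong)
    then show ?case by auto
  qed
qed (auto simp: fam_sum_in_span)

lemma is_lattice_basis_iff:
  "is_lattice_basis L l b \<longleftrightarrow> fam_indep l b \<and> L = {\<Sum>k<l. of_int (z k) *\<^sub>R b k | z. True}"
  unfolding is_lattice_basis_def fam_indep_iff by auto

lemma lattice_basis_mem: "is_lattice_basis L l b \<Longrightarrow> k < l \<Longrightarrow> b k \<in> L"
  unfolding is_lattice_basis_iff
  by (auto intro!: exI[of _ "\<lambda>i. if i = k then 1 else 0"] simp: if_distrib[of "\<lambda>c. c *\<^sub>R _"] if_distrib[of of_int] cong: if_cong)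

lemma dim_fam: "fam_indep l w \<Longrightarrow> dim (span (w ` {..<l})) = l"
  by (simp add: fam_indep_iff dim_eq_card_independent card_image)

text \<open>Let the height of a vector be its coefficient at \<open>w l\<close>, given by the
  functional \<open>g\<close>. The new basis vector \<open>a\<close> is a lattice point of least
  positive height; all other heights are integer multiples of it, since division with remainder
  would otherwise produce a smaller one.\<close>

lemma ex_lattice_basis:
  fixes w :: "nat \<Rightarrow> real^'n"
  assumes "\<And>k. k < l \<Longrightarrow> w k \<in> Zd" "fam_indep l w"
  shows "\<exists>b. is_lattice_basis (Zd \<inter> span (w ` {..<l})) l b"
  using assms
proof (induction l)
  case 0
  show ?case by (auto simp: is_lattice_basis_iff fam_indep_def Zd_0)
next
  case (Suc l)
  have fl: "fam_indep l w"
    unfolding fam_indep_def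
  proof (intro allI impI)
    fix c k assume s: "(\<Sum>k<l. c k *\<^sub>R w k) = 0" and k: "k < l"
    let ?c = "\<lambda>i. if i < l then c i else 0"
    have "(\<Sum>k<Suc l. ?c k *\<^sub>R w k) = 0" using s by simp
    from fam_indepD[OF Suc.prems(2) this, of k] k show "c k = 0" by simp
  qed
  with Suc obtain b where b: "is_lattice_basis (Zd \<inter> span (w ` {..<l})) l b" by auto
  have ind: "inj_on w {..<Suc l}" "independent (w ` {..<Suc l})" using Suc.prems(2) by (auto simp: fam_indep_iff)
  obtain g :: "real^'n \<Rightarrow> real" where g: "linear g" "\<And>x. x \<in> w ` {..<Suc l} \<Longrightarrow> g x = (if x = w l then 1 else 0)"
    using linear_independent_extend[OF ind(2), of "\<lambda>x. if x = w l then 1 else 0"] by blast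
  have gl: "g (w l) = 1" using g(2)[of "w l"] by simp
  have gk: "g (w k) = 0" if "k < l" for k
  proof -
    have "w k \<noteq> w l" using ind(1) that by (auto simp: inj_on_def)
    then show ?thesis using g(2)[of "w k"] that by auto
  qed
  have gsum: "g (\<Sum>k<l. c k *\<^sub>R w k) = 0" for c
    using g(1) gk by (simp add: linear_sum linear_cmul)
  have gspan: "g x = 0" if "x \<in> span (w ` {..<l})" for x using that gsum by (auto simp: span_fam)
  \<comment> \<open>Lattice points of height at most 1, reduced modulo
    \<open>w 0, ..., w (l - 1)\<close>. This makes the set bounded, hence finite, so a least height
    is attained; \<open>w l\<close> shows that it is not empty.\<close>
  define A where "A = {x \<in> Zd. \<exists>c. x = (\<Sum>k<l. c k *\<^sub>R w k) + g x *\<^sub>R w l \<and> 0 < g x \<and> g x \<le> 1 \<and> (\<forall>k<l. 0 \<le> c k \<and> c k < 1)}"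
  have "finite A"
  proof -
    have "norm x \<le> (\<Sum>k<l. norm (w k)) + norm (w l)" if x: "x \<in> A" for x
    proof -
      obtain c where c: "x = (\<Sum>k<l. c k *\<^sub>R w k) + g x *\<^sub>R w l" "0 < g x" "g x \<le> 1" "\<forall>k<l. 0 \<le> c k \<and> c k < 1"
        using x by (auto simp: A_def)
      have "norm x \<le> norm (\<Sum>k<l. c k *\<^sub>R w k) + norm (g x *\<^sub>R w l)" by (subst c(1)) (rule norm_triangle_ineq)
      also have "norm (\<Sum>k<l. c k *\<^sub>R w k) \<le> (\<Sum>k<l. norm (w k))"
        using c(4) by (intro sum_norm_le) (auto intro!: mult_left_le_one_le)
      also have "norm (g x *\<^sub>R w l) \<le> norm (w l)" using c by (auto intro!: mult_left_le_one_le)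
      finally show ?thesis by simp
    qed
    then have "bounded A" unfolding bounded_iff by blast
    then have "finite (A \<inter> Zd)" by (rule finite_Zd_bounded)
    then show ?thesis by (simp add: A_def Int_def conj_ac)
  qed
  moreover have "w l \<in> A" using Suc.prems(1)[of l] gl by (auto simp: A_def intro!: exI[of _ "\<lambda>_. 0"])
  ultimately have "Min (g ` A) \<in> g ` A" "\<And>x. x \<in> A \<Longrightarrow> Min (g ` A) \<le> g x" by (auto intro: Min_in)
  then obtain a where a: "a \<in> A" "\<And>x. x \<in> A \<Longrightarrow> g a \<le> g x" by force
  have ga: "0 < g a" "g a \<le> 1" "a \<in> Zd" using a(1) by (auto simp: A_def)
  have aspan: "a \<in> span (w ` {..<Suc l})"
  proof -
    obtain c where c: "a = (\<Sum>k<l. c k *\<^sub>R w k) + g a *\<^sub>R w l" using a(1) by (auto simp: A_def)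
    have "(\<Sum>k<l. c k *\<^sub>R w k) + g a *\<^sub>R w l \<in> span (w ` {..<Suc l})"
      by (intro span_add span_sum span_scale span_base) auto
    then show ?thesis using c by simp
  qed
  define b' where "b' = b(l := a)"
  have bL: "b k \<in> Zd" "b k \<in> span (w ` {..<l})" if "k < l" for k using lattice_basis_mem[OF b that] by auto
  have sub: "span (w ` {..<l}) \<subseteq> span (w ` {..<Suc l})" by (intro span_mono) auto
  have s': "(\<Sum>k<Suc l. c k *\<^sub>R b' k) = (\<Sum>k<l. c k *\<^sub>R b k) + c l *\<^sub>R a" for c by (simp add: b'_def)
  have "fam_indep (Suc l) b'"
    unfolding fam_indep_def
  proof (intro allI impI)
    fix c k assume s: "(\<Sum>k<Suc l. c k *\<^sub>R b' k) = 0" and k: "k < Suc l"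
    have "g ((\<Sum>k<l. c k *\<^sub>R b k) + c l *\<^sub>R a) = 0" using s s'[of c] g(1) by (simp add: linear_0)
    moreover have "g (\<Sum>k<l. c k *\<^sub>R b k) = 0" using bL by (intro gspan span_sum span_scale) auto
    ultimately have cl: "c l = 0" using g(1) ga by (simp add: linear_add linear_cmul)
    then have "(\<Sum>k<l. c k *\<^sub>R b k) = 0" using s s'[of c] by simp
    moreover have "fam_indep l b" using b by (simp add: is_lattice_basis_iff)
    ultimately show "c k = 0" using k cl fam_indepD[of l b c k] by (cases "k = l") auto
  qed
  moreover have "Zd \<inter> span (w ` {..<Suc l}) = {\<Sum>k<Suc l. of_int (z k) *\<^sub>R b' k | z. True}"
  proof (intro equalityI subsetI)
    fix x assume "x \<in> {\<Sum>k<Suc l. of_int (z k) *\<^sub>R b' k | z. True}"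
    then obtain z where x: "x = (\<Sum>k<l. of_int (z k) *\<^sub>R b k) + of_int (z l) *\<^sub>R a"
      using s'[of "\<lambda>k. of_int (z k)" for z] by auto
    have "x \<in> Zd" unfolding x using bL ga by (intro Zd_add Zd_sum Zd_scale) auto
    moreover have "x \<in> span (w ` {..<Suc l})" unfolding x using bL aspan sub by (intro span_add span_sum span_scale) auto
    ultimately show "x \<in> Zd \<inter> span (w ` {..<Suc l})" by blast
  next
    fix x assume x: "x \<in> Zd \<inter> span (w ` {..<Suc l})"
    define q where "q = \<lfloor>g x / g a\<rfloor>"
    define y where "y = x - of_int q *\<^sub>R a"
    have yZ: "y \<in> Zd" unfolding y_def using x ga by (intro Zd_diff Zd_scale) auto
    have gy: "g y = g x - of_int q * g a" using g(1) by (simp add: y_def linear_diff linear_cmul)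
    have "of_int q * g a \<le> g x / g a * g a" using ga unfolding q_def by (intro mult_right_mono) auto
    then have gy0: "0 \<le> g y" using gy ga by simp
    have "g x / g a * g a < (of_int q + 1) * g a" using ga unfolding q_def by (intro mult_strict_right_mono) linarith+
    then have gy1: "g y < g a" using gy ga by (simp add: algebra_simps)
    have "y \<in> span (w ` {..<Suc l})" unfolding y_def using x aspan by (auto intro!: span_diff span_scale)
    then obtain c where c: "y = (\<Sum>k<Suc l. c k *\<^sub>R w k)" unfolding span_fam by blast
    then have "g y = c l" using gsum[of c] gl g(1) by (simp add: linear_add linear_cmul)
    then have c': "y = (\<Sum>k<l. c k *\<^sub>R w k) + g y *\<^sub>R w l" using c by simp
    have "g y = 0"
    proof (rule ccontr)
      assume "g y \<noteq> 0"
      then have pos: "0 < g y" using gy0 by simp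
      \<comment> \<open>Removing the integer parts of the lower coefficients keeps \<open>y\<close>
        in the lattice and at its height, but moves it into \<open>A\<close>, below the
        minimum.\<close>
      define y' where "y' = y - (\<Sum>k<l. of_int \<lfloor>c k\<rfloor> *\<^sub>R w k)"
      have gy': "g y' = g y" using gsum g(1) by (simp add: y'_def linear_diff)
      have "y' \<in> Zd" unfolding y'_def using yZ Suc.prems(1) by (intro Zd_diff Zd_sum Zd_scale) auto
      moreover have "y' = (\<Sum>k<l. frac (c k) *\<^sub>R w k) + g y' *\<^sub>R w l"
      proof -
        have "y' = ((\<Sum>k<l. c k *\<^sub>R w k) + g y *\<^sub>R w l) - (\<Sum>k<l. of_int \<lfloor>c k\<rfloor> *\<^sub>R w k)"
          unfolding y'_def using c' by simp
        then show ?thesis unfolding gy' by (simp add: frac_def scaleR_diff_left sum_subtractf)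
      qed
      ultimately have "y' \<in> A" using pos gy1 ga gy' unfolding A_def
        by (auto intro!: exI[of _ "\<lambda>k. frac (c k)"] simp: frac_lt_1)
      then show False using a(2) gy' gy1 by force
    qed
    then have "y \<in> span (w ` {..<l})" using c' unfolding span_fam by auto
    then obtain z where z: "y = (\<Sum>k<l. of_int (z k) *\<^sub>R b k)" using b yZ unfolding is_lattice_basis_iff by auto
    have "x = (\<Sum>k<l. of_int ((z(l := q)) k) *\<^sub>R b k) + of_int ((z(l := q)) l) *\<^sub>R a" using z by (simp add: y_def algebra_simps)
    then have "x = (\<Sum>k<Suc l. of_int ((z(l := q)) k) *\<^sub>R b' k)"
      unfolding s'[of "\<lambda>k. of_int ((z(l := q)) k)"] .
    then show "x \<in> {\<Sum>k<Suc l. of_int (z k) *\<^sub>R b' k | z. True}" by blast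
  qed
  ultimately show ?case unfolding is_lattice_basis_iff by blast
qed

text \<open>If \<open>z\<close> is an orthonormal basis of the complement of \<open>span w\<close>, then \<open>\<bar>cdet l w z\<bar>\<close> is the
  \<open>l\<close>-dimensional volume of the parallelepiped spanned by \<open>w\<close>.\<close>

definition cdet :: "nat \<Rightarrow> (nat \<Rightarrow> real^'n) \<Rightarrow> (nat \<Rightarrow> real^'n) \<Rightarrow> real" where
  "cdet l w z = det (matrix (comb (fill l w z)))"

lemma cdet_nonzero:
  fixes w :: "nat \<Rightarrow> real^'n"
  assumes l: "l \<le> CARD('n)" and w: "fam_indep l w" "\<And>k. k < l \<Longrightarrow> w k \<in> V" and z: "compl_onb V l z" and V: "subspace V"
  shows "cdet l w z \<noteq> 0"
proof -
  have "inj (comb (fill l w z))"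
  proof (rule linear_injective_0[OF linear_comb, THEN iffD2], intro allI impI)
    fix x :: "real^'n" assume "comb (fill l w z) x = 0"
    then have s: "(\<Sum>k<l. x $ idx k *\<^sub>R w k) + (\<Sum>k\<in>{l..<CARD('n)}. x $ idx k *\<^sub>R z k) = 0"
      by (simp add: comb_fill[OF l])
    have x2: "x $ idx j = 0" if j: "j \<in> {l..<CARD('n)}" for j
    proof -
      have "(\<Sum>k<l. x $ idx k *\<^sub>R w k) \<in> V" using w V by (intro subspace_sum subspace_scale) auto
      then have "z j \<bullet> (\<Sum>k<l. x $ idx k *\<^sub>R w k) = 0" using z j by (auto simp: compl_onb_def)
      moreover have "z j \<bullet> (\<Sum>k\<in>{l..<CARD('n)}. x $ idx k *\<^sub>R z k) = (\<Sum>k\<in>{l..<CARD('n)}. if k = j then x $ idx k else 0)"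
        unfolding inner_sum_right using z j by (intro sum.cong) (auto simp: compl_onb_def)
      moreover have "z j \<bullet> ((\<Sum>k<l. x $ idx k *\<^sub>R w k) + (\<Sum>k\<in>{l..<CARD('n)}. x $ idx k *\<^sub>R z k)) = 0" using s by simp
      ultimately show ?thesis using j by (simp add: inner_add_right)
    qed
    then have "(\<Sum>k<l. x $ idx k *\<^sub>R w k) = 0" using s by simp
    then have "x $ idx k = 0" if "k < l" for k using fam_indepD[OF w(1), of "\<lambda>k. x $ idx k"] that by simp
    with x2 have "x $ idx k = 0" if "k < CARD('n)" for k using that by (cases "k < l") auto
    then have "\<forall>i. x $ i = 0" by (subst all_idx) simp
    then show "x = 0" by (simp add: vec_eq_iff)
  qed
  then show ?thesis by (simp add: cdet_def det_nz_iff_inj linear_comb)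
qed

section \<open>Determinants under change of basis\<close>

lemma det_Ints:
  fixes A :: "real^'n^'n"
  assumes "\<And>i j. A $ i $ j \<in> \<int>" shows "det A \<in> \<int>"
  unfolding det_def using assms by (auto intro!: Ints_sum Ints_mult Ints_prod)

text \<open>The transpose of \<open>A\<close> in one block and the identity in the other: rows of
  \<open>A\<close> express vectors, so coordinates change by the transpose, while the vectors of the
  complement stay fixed.\<close>

definition tmat :: "nat \<Rightarrow> (nat \<Rightarrow> nat \<Rightarrow> real) \<Rightarrow> real^'n^'n" where
  "tmat l A = (\<chi> i j. if num i < l \<and> num j < l then A (num j) (num i) else if i = j then 1 else 0)"

lemma idx_eq_iff: "k < CARD('n) \<Longrightarrow> j < CARD('n) \<Longrightarrow> (idx k :: 'n::finite) = idx j \<longleftrightarrow> k = j"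
  by (metis num_idx)

lemma tmat_mult_low:
  fixes x :: "real^'n"
  assumes l: "l \<le> CARD('n)" and j: "j < l"
  shows "((tmat l A :: real^'n^'n) *v x) $ idx j = (\<Sum>k<l. x $ idx k * A k j)"
proof -
  have "((tmat l A :: real^'n^'n) *v x) $ idx j = (\<Sum>k<CARD('n). (tmat l A :: real^'n^'n) $ idx j $ idx k * x $ idx k)"
    unfolding matrix_vector_mult_def by (simp only: vec_lambda_beta sum_idx)
  also have "\<dots> = (\<Sum>k<CARD('n). if k < l then x $ idx k * A k j else 0)"
    using j l by (intro sum.cong refl) (auto simp: tmat_def idx_eq_iff)
  also have "\<dots> = (\<Sum>k\<in>{..<CARD('n)} \<inter> {k. k < l}. x $ idx k * A k j)" by (simp add: sum.If_cases)
  also have "{..<CARD('n)} \<inter> {k. k < l} = {..<l}" using l by auto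
  finally show ?thesis .
qed

lemma tmat_mult_high:
  fixes x :: "real^'n"
  assumes j: "l \<le> j" "j < CARD('n)"
  shows "((tmat l A :: real^'n^'n) *v x) $ idx j = x $ idx j"
proof -
  have "((tmat l A :: real^'n^'n) *v x) $ idx j = (\<Sum>k<CARD('n). (tmat l A :: real^'n^'n) $ idx j $ idx k * x $ idx k)"
    unfolding matrix_vector_mult_def by (simp only: vec_lambda_beta sum_idx)
  also have "\<dots> = (\<Sum>k<CARD('n). if k = j then x $ idx k else 0)"
    using j by (intro sum.cong refl) (auto simp: tmat_def idx_eq_iff)
  finally show ?thesis using j by simp
qed

lemma tmat_mult_sum:
  fixes b c :: "nat \<Rightarrow> real^'n" and x :: "real^'n"
  assumes l: "l \<le> CARD('n)" and b: "\<And>k. k < l \<Longrightarrow> b k = (\<Sum>j<l. A k j *\<^sub>R c j)"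
  shows "(\<Sum>k<l. x $ idx k *\<^sub>R b k) = (\<Sum>j<l. ((tmat l A :: real^'n^'n) *v x) $ idx j *\<^sub>R c j)"
proof -
  have "(\<Sum>k<l. x $ idx k *\<^sub>R b k) = (\<Sum>k<l. \<Sum>j<l. (x $ idx k * A k j) *\<^sub>R c j)"
    using b by (simp add: scaleR_sum_right)
  also have "\<dots> = (\<Sum>j<l. ((tmat l A :: real^'n^'n) *v x) $ idx j *\<^sub>R c j)"
    using l by (subst sum.swap) (simp add: tmat_mult_low scaleR_sum_left)
  finally show ?thesis .
qed

lemma cdet_transform:
  fixes b c :: "nat \<Rightarrow> real^'n"
  assumes l: "l \<le> CARD('n)" and b: "\<And>k. k < l \<Longrightarrow> b k = (\<Sum>j<l. A k j *\<^sub>R c j)"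
  shows "cdet l b z = cdet l c z * det (tmat l A :: real^'n^'n)"
proof -
  let ?M = "tmat l A :: real^'n^'n"
  have "comb (fill l b z) x = comb (fill l c z) (?M *v x)" for x
    unfolding comb_fill[OF l] by (simp add: tmat_mult_sum[OF l b] tmat_mult_high)
  then have "comb (fill l b z) = comb (fill l c z) \<circ> ((*v) ?M)" by auto
  then have "matrix (comb (fill l b z)) = matrix (comb (fill l c z)) ** ?M"
    by (simp add: matrix_compose linear_comb matrix_vector_mul_linear)
  then show ?thesis unfolding cdet_def by (simp only: det_mul)
qed

text \<open>The matrix expressing \<open>b\<close> in the basis \<open>c\<close> is integral, and a
  nonzero integer determinant is at least 1 in absolute value. Used in both directions, this shows
  that \<open>lattice_det\<close> is independent of the basis.\<close>

lemma cdet_lattice_le: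
  fixes b c :: "nat \<Rightarrow> real^'n"
  assumes l: "l \<le> CARD('n)" and c: "is_lattice_basis L l c" and b: "\<And>k. k < l \<Longrightarrow> b k \<in> L" and nz: "cdet l b z \<noteq> 0"
  shows "\<bar>cdet l c z\<bar> \<le> \<bar>cdet l b z\<bar>"
proof -
  have "\<forall>k. \<exists>a. k < l \<longrightarrow> b k = (\<Sum>j<l. of_int (a j) *\<^sub>R c j)" using b c unfolding is_lattice_basis_iff by blast
  then obtain A where A: "\<And>k. k < l \<Longrightarrow> b k = (\<Sum>j<l. of_int (A k j) *\<^sub>R c j)" by metis
  define D where "D = det (tmat l (\<lambda>k j. of_int (A k j)) :: real^'n^'n)"
  have e: "cdet l b z = cdet l c z * D" unfolding D_def by (rule cdet_transform[OF l A])
  have "D \<in> \<int>" unfolding D_def by (rule det_Ints) (simp add: tmat_def)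
  moreover have "D \<noteq> 0" using e nz by auto
  ultimately have "1 \<le> \<bar>D\<bar>" by (rule Ints_nonzero_abs_ge1)
  then have "\<bar>cdet l c z\<bar> * 1 \<le> \<bar>cdet l c z\<bar> * \<bar>D\<bar>" by (intro mult_left_mono) auto
  then show ?thesis using e by (simp add: abs_mult)
qed

section \<open>Normalized volume of lattice simplices\<close>

lemma diff_space_diff: "x \<in> F \<Longrightarrow> y \<in> F \<Longrightarrow> x - y \<in> diff_space F"
  unfolding diff_space_def by (rule span_base) blast

definition std_spx :: "nat \<Rightarrow> (nat \<Rightarrow> real) set" where
  "std_spx l = {x. (\<forall>i\<in>{..<l}. 0 \<le> x i) \<and> sum x {..<l} \<le> 1} \<inter> space (Pi\<^sub>M {..<l} (\<lambda>_. lborel))"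

lemma measure_std_spx: "measure (Pi\<^sub>M {..<l} (\<lambda>_. lborel)) (std_spx l) = 1 / fact l"
proof -
  have "emeasure (Pi\<^sub>M {..<l} (\<lambda>_. lborel)) (std_spx l) = ennreal (1 ^ card {..<l} / fact (card {..<l}))"
    unfolding std_spx_def by (rule emeasure_std_simplex_aux) auto
  then show ?thesis by (simp add: measure_def)
qed

lemma sets_std_spx: "std_spx l \<in> sets (Pi\<^sub>M {..<l} (\<lambda>_. lborel))" (is "_ \<in> sets ?M")
proof -
  have "std_spx l = Pi\<^sub>E {..<l} (\<lambda>_. {0..}) \<inter> (\<lambda>x. sum x {..<l}) -` {..1} \<inter> space ?M"
    by (auto simp: std_spx_def space_PiM)
  also have "\<dots> \<in> sets ?M" by measurable
  finally show ?thesis .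
qed

lemma bounded_cyl_std_spx: "bounded (cyl l (std_spx l) :: (real^'n) set)"
proof (rule bounded_cyl)
  fix y k assume y: "y \<in> std_spx l" and k: "k < l"
  then have "y k \<le> sum y {..<l}" by (intro member_le_sum) (auto simp: std_spx_def)
  with y k show "0 \<le> y k \<and> y k \<le> 1" by (auto simp: std_spx_def)
qed

definition spx :: "real^'n \<Rightarrow> nat \<Rightarrow> (nat \<Rightarrow> real^'n) \<Rightarrow> (real^'n) set" where
  "spx v l w = convex hull (insert v ((\<lambda>k. v + w k) ` {..<l}))"

lemma spx_param:
  assumes "fam_indep l w"
  shows "spx v l w = {v + (\<Sum>k<l. y k *\<^sub>R w k) | y. y \<in> std_spx l}"
proof -
  have inj: "inj_on w {..<l}" and "independent (w ` {..<l})" using assms by (auto simp: fam_indep_iff)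
  then have 0: "0 \<notin> w ` {..<l}" by (metis dependent_zero)
  have "insert v ((\<lambda>k. v + w k) ` {..<l}) = (+) v ` (insert 0 (w ` {..<l}))" by (auto simp: image_image)
  then have "spx v l w = (+) v ` (convex hull (insert 0 (w ` {..<l})))"
    unfolding spx_def by (simp only: convex_hull_translation)
  also have "convex hull (insert 0 (w ` {..<l})) = {y. \<exists>u. (\<forall>x\<in>w ` {..<l}. 0 \<le> u x) \<and> sum u (w ` {..<l}) \<le> 1 \<and> (\<Sum>x\<in>w ` {..<l}. u x *\<^sub>R x) = y}"
    using 0 by (intro Starlike.simplex) auto
  also have "\<dots> = {\<Sum>k<l. y k *\<^sub>R w k | y. y \<in> std_spx l}" (is "?A = ?B")
  proof (intro equalityI subsetI)
    fix q assume "q \<in> ?A"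
    then obtain u where u: "\<forall>x\<in>w ` {..<l}. 0 \<le> u x" "sum u (w ` {..<l}) \<le> 1" "(\<Sum>x\<in>w ` {..<l}. u x *\<^sub>R x) = q" by auto
    show "q \<in> ?B" unfolding std_spx_def
      using u inj by (intro CollectI exI[of _ "\<lambda>k\<in>{..<l}. u (w k)"]) (auto simp: sum.reindex space_PiM)
  next
    fix q assume "q \<in> ?B"
    then obtain y where y: "\<forall>i<l. 0 \<le> y i" "sum y {..<l} \<le> 1" "q = (\<Sum>k<l. y k *\<^sub>R w k)" unfolding std_spx_def by auto
    have e: "y (inv_into {..<l} w (w k)) = y k" if "k \<in> {..<l}" for k using inj that by simp
    show "q \<in> ?A"
      using y inj e by (auto simp: sum.reindex intro!: exI[of _ "\<lambda>x. y (inv_into {..<l} w x)"])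
  qed
  finally show ?thesis by blast
qed

lemma spx_mem: "v \<in> spx v l w" "k < l \<Longrightarrow> v + w k \<in> spx v l w"
  unfolding spx_def by (auto intro!: hull_inc)

lemma diff_space_spx:
  assumes "fam_indep l w" shows "diff_space (spx v l w) = span (w ` {..<l})"
proof
  show "diff_space (spx v l w) \<subseteq> span (w ` {..<l})" unfolding diff_space_def
  proof (rule span_minimal)
    show "{x - y |x y. x \<in> spx v l w \<and> y \<in> spx v l w} \<subseteq> span (w ` {..<l})"
    proof
      fix q assume "q \<in> {x - y |x y. x \<in> spx v l w \<and> y \<in> spx v l w}"
      then obtain a b where "q = (v + (\<Sum>k<l. a k *\<^sub>R w k)) - (v + (\<Sum>k<l. b k *\<^sub>R w k))"
        unfolding spx_param[OF assms] by blast
      then have "q = (\<Sum>k<l. a k *\<^sub>R w k) - (\<Sum>k<l. b k *\<^sub>R w k)" by simp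
      then show "q \<in> span (w ` {..<l})" by (simp add: span_diff fam_sum_in_span)
    qed
  qed simp
  have "w k \<in> diff_space (spx v l w)" if "k < l" for k
    using diff_space_diff[OF spx_mem(2)[OF that, of v w] spx_mem(1)] by (simp only: add_diff_cancel_left')
  then show "span (w ` {..<l}) \<subseteq> diff_space (spx v l w)"
    by (intro span_minimal) (auto simp: diff_space_def)
qed

lemma spx_cong: "(\<And>k. k < l \<Longrightarrow> w k = w' k) \<Longrightarrow> spx v l w = spx v l w'"
  unfolding spx_def by (intro arg_cong[of _ _ "(hull) convex"] arg_cong2[of _ _ _ _ insert] image_cong) auto

lemma affine_image_spx:
  assumes "linear g" shows "(\<lambda>x. g x + b) ` spx v l w = spx (g v + b) l (\<lambda>k. g (w k))"
proof -
  have "(\<lambda>x. g x + b) ` spx v l w = (+) b ` g ` spx v l w"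
    unfolding image_image by (simp only: add.commute)
  also have "\<dots> = convex hull ((+) b ` g ` insert v ((\<lambda>k. v + w k) ` {..<l}))"
    unfolding spx_def by (simp only: convex_hull_linear_image[OF assms] convex_hull_translation)
  also have "(+) b ` g ` insert v ((\<lambda>k. v + w k) ` {..<l}) = insert (g v + b) ((\<lambda>k. (g v + b) + g (w k)) ` {..<l})"
    unfolding image_insert image_image linear_add[OF assms] by (simp only: add_ac)
  finally show ?thesis unfolding spx_def .
qed

lemma compact_spx: "compact (spx v l w)"
  unfolding spx_def by (intro finite_imp_compact_convex_hull) auto

lemma euclid_vol_spx:
  fixes w :: "nat \<Rightarrow> real^'n"
  assumes l: "l \<le> CARD('n)" and w: "fam_indep l w" and z: "compl_onb (span (w ` {..<l})) l z"
  shows "euclid_vol (spx v l w) = \<bar>cdet l w z\<bar> / fact l"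
proof -
  have "euclid_vol (spx v l w) = \<bar>cdet l w z\<bar> * measure (Pi\<^sub>M {..<l} (\<lambda>_. lborel)) (std_spx l)"
    unfolding cdet_def
  proof (intro euclid_vol_param[OF diff_space_spx[OF w] dim_fam[OF w] z _ sets_std_spx _ spx_param[OF w]])
    show "spx v l w \<noteq> {}" using spx_mem(1) by blast
    show "spx v l w \<in> sets borel" using compact_spx by (rule borel_compact)
    show "det (matrix (comb (fill l w z))) \<noteq> 0"
      using cdet_nonzero[OF l w _ z] by (auto simp: cdet_def span_base)
  qed (auto intro: span_base bounded_cyl_std_spx)
  then show ?thesis by (simp add: measure_std_spx)
qed

lemma euclid_vol_parallelepiped:
  fixes b :: "nat \<Rightarrow> real^'n"
  assumes l: "l \<le> CARD('n)" and b: "fam_indep l b" and z: "compl_onb (span (b ` {..<l})) l z"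
  shows "euclid_vol {\<Sum>k<l. t k *\<^sub>R b k | t. \<forall>k<l. 0 \<le> t k \<and> t k \<le> (1::real)} = \<bar>cdet l b z\<bar>"
proof -
  let ?M = "Pi\<^sub>M {..<l} (\<lambda>_. lborel :: real measure)"
  let ?E = "Pi\<^sub>E {..<l} (\<lambda>_. {0..1::real})"
  let ?P = "{\<Sum>k<l. t k *\<^sub>R b k | t. \<forall>k<l. 0 \<le> t k \<and> t k \<le> (1::real)}"
  interpret product_sigma_finite "\<lambda>_::nat. lborel :: real measure" by standard
  have em: "emeasure ?M ?E = 1" by (subst emeasure_PiM) auto
  have m: "?E \<in> sets ?M" by (intro sets_PiM_I_finite) auto
  have bd: "bounded (cyl l ?E :: (real^'n) set)" by (rule bounded_cyl) (auto simp: PiE_iff)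
  have P: "?P = {0 + (\<Sum>k<l. y k *\<^sub>R b k) | y. y \<in> ?E}"
  proof (intro equalityI subsetI)
    fix q assume "q \<in> ?P"
    then obtain t where "q = (\<Sum>k<l. t k *\<^sub>R b k)" "\<forall>k<l. 0 \<le> t k \<and> t k \<le> 1" by blast
    then show "q \<in> {0 + (\<Sum>k<l. y k *\<^sub>R b k) | y. y \<in> ?E}" by (intro CollectI exI[of _ "restrict t {..<l}"]) (auto simp: PiE_iff)
  qed (auto simp: PiE_iff)
  have ds: "diff_space ?P = span (b ` {..<l})"
  proof
    show "diff_space ?P \<subseteq> span (b ` {..<l})" unfolding diff_space_def
      by (rule span_minimal) (auto simp: span_diff fam_sum_in_span)
    have "b k \<in> diff_space ?P" if k: "k < l" for k
    proof -
      have "(\<Sum>i<l. (if i = k then 1 else 0) *\<^sub>R b i) = b k"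
        using k by (simp add: if_distrib[of "\<lambda>c. c *\<^sub>R _"] cong: if_cong)
      then have "b k \<in> ?P" by (intro CollectI exI[of _ "\<lambda>i. if i = k then 1 else 0"]) auto
      moreover have "0 \<in> ?P" by (intro CollectI exI[of _ "\<lambda>i. 0"]) auto
      ultimately have "b k - 0 \<in> diff_space ?P" by (rule diff_space_diff)
      then show ?thesis by (simp only: diff_zero)
    qed
    then show "span (b ` {..<l}) \<subseteq> diff_space ?P" by (intro span_minimal) (auto simp: diff_space_def)
  qed
  have cp: "compact ?P"
  proof -
    have "?P = (\<lambda>x::real^'n. \<Sum>k<l. x $ idx k *\<^sub>R b k) ` cbox 0 1"
    proof (intro equalityI subsetI)
      fix q assume "q \<in> ?P"
      then obtain t where t: "q = (\<Sum>k<l. t k *\<^sub>R b k)" "\<forall>k<l. 0 \<le> t k \<and> t k \<le> 1" by blast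
      define x :: "real^'n" where "x = (\<chi> i. if num i < l then t (num i) else 0)"
      have "x \<in> cbox 0 1" using t by (auto simp: x_def mem_box_cart)
      moreover have "q = (\<Sum>k<l. x $ idx k *\<^sub>R b k)" using t l by (simp add: x_def)
      ultimately show "q \<in> (\<lambda>x::real^'n. \<Sum>k<l. x $ idx k *\<^sub>R b k) ` cbox 0 1" by blast
    qed (auto simp: mem_box_cart)
    moreover have "compact ((\<lambda>x::real^'n. \<Sum>k<l. x $ idx k *\<^sub>R b k) ` cbox 0 1)"
      by (intro compact_continuous_image continuous_intros) auto
    ultimately show ?thesis by simp
  qed
  have "euclid_vol ?P = \<bar>cdet l b z\<bar> * measure ?M ?E"
    unfolding cdet_def
  proof (intro euclid_vol_param[OF ds dim_fam[OF b] z _ m bd P])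
    show "?P \<noteq> {}" by (auto intro!: exI[of _ "\<lambda>_. 0"])
    show "?P \<in> sets borel" using cp by (simp add: borel_compact)
    show "det (matrix (comb (fill l b z))) \<noteq> 0"
      using cdet_nonzero[OF l b _ z] by (auto simp: cdet_def span_base)
  qed (auto intro: span_base)
  then show ?thesis using em by (simp add: measure_def)
qed

lemma span_lattice_basis:
  assumes "is_lattice_basis (Zd \<inter> span (w ` {..<l})) l b" "fam_indep l w"
  shows "span (b ` {..<l}) = span (w ` {..<l})"
proof -
  have sub: "b ` {..<l} \<subseteq> span (w ` {..<l})" using lattice_basis_mem[OF assms(1)] by auto
  have "dim (span (b ` {..<l})) = l" using assms(1) by (intro dim_fam) (simp add: is_lattice_basis_iff)
  then show ?thesis using dim_eq_span[OF sub] dim_fam[OF assms(2)] by (simp add: span_span)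
qed

text \<open>\<open>lattice_det\<close> picks its basis by choice. Two bases of one lattice have the
  same \<open>\<bar>cdet\<bar>\<close>, so any convenient basis \<open>b\<close> can be supplied;
  the volume of the complement cube cancels in the quotient.\<close>

lemma volZ_spx:
  fixes w :: "nat \<Rightarrow> real^'n"
  assumes l: "l \<le> CARD('n)" and w: "fam_indep l w" "\<And>k. k < l \<Longrightarrow> w k \<in> Zd"
    and z: "compl_onb (span (w ` {..<l})) l z" and b: "is_lattice_basis (Zd \<inter> span (w ` {..<l})) l b"
  shows "volZ (spx v l w) = \<bar>cdet l w z\<bar> / (fact l * \<bar>cdet l b z\<bar>)"
proof -
  let ?V = "span (w ` {..<l})" and ?L = "Zd \<inter> span (w ` {..<l})"
  have L: "lattice_of (spx v l w) = ?L" by (simp add: lattice_of_def diff_space_spx[OF w(1)])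
  have "span ?L = ?V"
  proof
    show "?V \<subseteq> span ?L" using w(2) by (intro span_minimal) (auto intro!: span_base)
    show "span ?L \<subseteq> ?V" by (rule span_minimal) auto
  qed
  then have dl: "dim (span ?L) = l" by (metis dim_fam w(1))
  define b0 where "b0 = (SOME b. is_lattice_basis ?L l b)"
  have b0: "is_lattice_basis ?L l b0" unfolding b0_def using b someI_ex[of "is_lattice_basis ?L l"] by blast
  have sp: "span (b ` {..<l}) = ?V" "span (b0 ` {..<l}) = ?V" using span_lattice_basis[OF b w(1)] span_lattice_basis[OF b0 w(1)] .
  have ind: "fam_indep l b" "fam_indep l b0" using b b0 by (auto simp: is_lattice_basis_iff)
  have "lattice_det ?L = \<bar>cdet l b0 z\<bar>"
    unfolding lattice_det_def Let_def dl b0_def[symmetric]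
    using z by (intro euclid_vol_parallelepiped[OF l ind(2)]) (simp add: sp)
  moreover have nz: "cdet l b z \<noteq> 0" "cdet l b0 z \<noteq> 0"
    by (rule cdet_nonzero[OF l ind(1) _ z subspace_span] cdet_nonzero[OF l ind(2) _ z subspace_span],
        use lattice_basis_mem[OF b] lattice_basis_mem[OF b0] in blast)+
  moreover have "\<bar>cdet l b0 z\<bar> = \<bar>cdet l b z\<bar>"
    by (intro antisym cdet_lattice_le[OF l b0] cdet_lattice_le[OF l b] lattice_basis_mem[OF b] lattice_basis_mem[OF b0] nz)
  ultimately show ?thesis by (simp add: volZ_def L euclid_vol_spx[OF l w(1) z])
qed

section \<open>Simplices with one interior lattice point\<close>

text \<open>Let \<open>E\<close> be the identity with row \<open>p\<close> replaced by
  \<open>b\<close>, and \<open>T\<close> the identity with column \<open>p\<close> replaced by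
  \<open>x\<close>. Then \<open>E ** A = T ** E\<close>, the determinants of \<open>E\<close> and
  \<open>T\<close> are the entries at \<open>p\<close>, and \<open>det E = b $ p\<close>
  cancels.\<close>

lemma det_rank_one_update:
  fixes a b :: "real^'n"
  shows "det (\<chi> i j. (if i = j then 1 else 0) - a $ i * b $ j) = 1 - a \<bullet> b"
proof (cases "b = 0")
  case True
  have "(\<chi> i j. if i = j then 1 else 0) = (mat 1 :: real^'n^'n)" by (simp add: mat_def)
  then have "det ((\<chi> i j. if i = j then 1 else 0) :: real^'n^'n) = 1" by simp
  then show ?thesis unfolding True by simp
next
  case False
  then obtain p where p: "b $ p \<noteq> 0" by (auto simp: vec_eq_iff)
  let ?A = "(\<chi> i j. (if i = j then 1 else 0) - a $ i * b $ j) :: real^'n^'n"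
  let ?E = "(\<chi> i j. if i = p then b $ j else if i = j then 1 else 0) :: real^'n^'n"
  let ?x = "(\<chi> i. if i = p then 1 - a \<bullet> b else - (a $ i)) :: real^'n"
  let ?T = "(\<chi> i j. if j = p then ?x $ i else if i = j then 1 else 0) :: real^'n^'n"
  have colrep: "det ((\<chi> i j. if j = p then x $ i else if i = j then 1 else 0) :: real^'n^'n) = x $ p" for x :: "real^'n"
  proof -
    have "det ((\<chi> i j. if j = p then (mat 1 *v x) $ i else (mat 1 :: real^'n^'n) $ i $ j) :: real^'n^'n) = x $ p * det (mat 1 :: real^'n^'n)"
      by (rule cramer_lemma)
    then show ?thesis unfolding matrix_vector_mul_lid det_I by (simp add: mat_def cong: if_cong)
  qed
  have dT: "det ?T = 1 - a \<bullet> b" using colrep[of ?x] by simp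
  have dE: "det ?E = b $ p"
  proof -
    have "transpose ?E = (\<chi> i j. if j = p then b $ i else if i = j then 1 else 0)"
      by (auto simp: transpose_def vec_eq_iff)
    then have "det (transpose ?E) = b $ p" using colrep[of b] by simp
    then show ?thesis by (simp only: det_transpose)
  qed
  have "?E ** ?A = ?T ** ?E"
  proof -
    have "(?E ** ?A) $ i $ j = (?T ** ?E) $ i $ j" for i j
    proof (cases "i = p")
      case True
      have "(?E ** ?A) $ i $ j = (\<Sum>k\<in>UNIV. b $ k * ((if k = j then 1 else 0) - a $ k * b $ j))"
        unfolding matrix_matrix_mult_def vec_lambda_beta using True by simp
      also have "\<dots> = (\<Sum>k\<in>UNIV. (if k = j then b $ k else 0)) - (\<Sum>k\<in>UNIV. a $ k * b $ k) * b $ j"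
        unfolding sum_distrib_right sum_subtractf[symmetric] by (intro sum.cong) (auto simp: algebra_simps)
      also have "\<dots> = (1 - a \<bullet> b) * b $ j" by (simp add: inner_vec_def algebra_simps)
      also have "\<dots> = (\<Sum>k\<in>UNIV. (if k = p then (1 - a \<bullet> b) * b $ j else 0))" by simp
      also have "\<dots> = (?T ** ?E) $ i $ j"
        unfolding matrix_matrix_mult_def vec_lambda_beta using True by (intro sum.cong) auto
      finally show ?thesis .
    next
      case False
      have "(?E ** ?A) $ i $ j = (\<Sum>k\<in>UNIV. if k = i then (if k = j then 1 else 0) - a $ k * b $ j else 0)"
        unfolding matrix_matrix_mult_def vec_lambda_beta using False by (intro sum.cong) auto
      also have "\<dots> = (if i = j then 1 else 0) - a $ i * b $ j" by simp
      also have "\<dots> = (\<Sum>k\<in>UNIV. (if k = p then - (a $ i) * b $ j else 0) + (if k = i then (if i = j then 1 else 0) else 0))"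
        by (simp add: sum.distrib)
      also have "\<dots> = (?T ** ?E) $ i $ j"
        unfolding matrix_matrix_mult_def vec_lambda_beta using False by (intro sum.cong) auto
      finally show ?thesis .
    qed
    then show ?thesis unfolding vec_eq_iff by blast
  qed
  then have "det (?E ** ?A) = det (?T ** ?E)" by (rule arg_cong)
  then have "det ?E * det ?A = det ?T * det ?E" unfolding det_mul .
  then show ?thesis unfolding dT dE using p by simp
qed

lemma span_coeffs:
  fixes l :: nat
  assumes "\<And>k. k < l \<Longrightarrow> b k \<in> span (w ` {..<l})"
  obtains A where "\<And>k. k < l \<Longrightarrow> b k = (\<Sum>j<l. A k j *\<^sub>R w j)"
proof -
  have "\<exists>a. b k = (\<Sum>j<l. a j *\<^sub>R w j)" if "k < l" for k
  proof -
    from assms[OF that] have "b k \<in> {\<Sum>j<l. c j *\<^sub>R w j | c. True}" unfolding span_fam .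
    then show ?thesis by blast
  qed
  then have *: "b k = (\<Sum>j<l. (SOME a. b k = (\<Sum>j<l. a j *\<^sub>R w j)) j *\<^sub>R w j)" if "k < l" for k
    using someI_ex[of "\<lambda>a. b k = (\<Sum>j<l. a j *\<^sub>R w j)"] that by simp
  show ?thesis using * by (rule that)
qed

text \<open>Interior points of a full-dimensional simplex are the combinations with positive
  weights, so \<open>unique\<close> states in barycentric terms that there is only one interior
  lattice point.\<close>

locale one_point_simplex =
  fixes C :: "(real^'n) set" and \<beta> :: "real^'n \<Rightarrow> real"
  assumes indep: "\<not> affine_dependent C" and card_C: "card C = CARD('n) + 1" and C_Zd: "C \<subseteq> Zd"
    and pos: "\<And>v. v \<in> C \<Longrightarrow> 0 < \<beta> v" and sum1: "sum \<beta> C = 1"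
    and centre: "(\<Sum>v\<in>C. \<beta> v *\<^sub>R v) \<in> Zd"
    and unique: "\<And>u. (\<And>v. v \<in> C \<Longrightarrow> 0 < u v) \<Longrightarrow> sum u C = 1 \<Longrightarrow> (\<Sum>v\<in>C. u v *\<^sub>R v) \<in> Zd
       \<Longrightarrow> \<forall>v\<in>C. u v = \<beta> v"
begin

lemma finite_C: "finite C"
  using card_C by (intro card_ge_0_finite) simp

lemma perturbation_zero:
  assumes "\<And>v. v \<in> C \<Longrightarrow> 0 < \<beta> v + y v" "sum y C = 0" "(\<Sum>v\<in>C. y v *\<^sub>R v) \<in> Zd" "v \<in> C"
  shows "y v = 0"
proof -
  have "\<forall>v\<in>C. \<beta> v + y v = \<beta> v"
  proof (rule unique)
    show "(\<Sum>v\<in>C. (\<beta> v + y v) *\<^sub>R v) \<in> Zd"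
      using Zd_add[OF centre assms(3)] by (simp add: scaleR_add_left sum.distrib)
    show "0 < \<beta> v + y v" if "v \<in> C" for v using assms(1)[OF that] .
    show "(\<Sum>v\<in>C. \<beta> v + y v) = 1" using assms(2) sum1 by (simp add: sum.distrib)
  qed
  with assms(4) show ?thesis by auto
qed


text \<open>If this failed, Minkowski's theorem would apply to the forms
  \<open>x i - \<beta> i * m\<close>, with \<open>m\<close> the sum of the \<open>x i\<close> over
  \<open>J\<close> and bounds \<open>\<beta> i\<close>: their matrix is the identity minus a
  rank-one matrix, with determinant \<open>1 - sum \<beta> J = sum \<beta> (C - J)\<close>. A
  solution makes \<open>m * \<beta>\<close> minus \<open>x\<close> an admissible nonzero
  perturbation.\<close>

lemma product_sum:
  assumes J: "J \<subseteq> C" "J \<noteq> C"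
  shows "prod \<beta> J \<le> sum \<beta> (C - J)"
proof (rule ccontr)
  assume neg: "\<not> ?thesis"
  obtain c where c: "c \<in> C" "c \<notin> J" using J by blast
  \<comment> \<open>Leaving out one vertex \<open>c\<close> outside \<open>J\<close> lets the other
    vertices index the coordinates of \<open>real^'n\<close>.\<close>
  have "card (UNIV :: 'n set) = card (C - {c})" using c card_C finite_C by simp
  then obtain h :: "'n \<Rightarrow> real^'n" where h: "bij_betw h UNIV (C - {c})"
    using finite_same_card_bij[of "UNIV :: 'n set" "C - {c}"] finite_C by auto
  define K where "K = h -` J"
  have hinj: "inj h" using h by (simp add: bij_betw_def)
  have hC: "h i \<in> C" for i using h by (auto simp: bij_betw_def)
  have hK: "bij_betw h K J"
    unfolding bij_betw_def K_def using hinj h J c by (auto simp: bij_betw_def inj_on_def)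
  define a b :: "real^'n" where "a = (\<chi> i. if i \<in> K then \<beta> (h i) else 0)" and "b = (\<chi> i. if i \<in> K then 1 else 0)"
  let ?A = "(\<chi> i j. (if i = j then 1 else 0) - a $ i * b $ j) :: real^'n^'n"
  have Ax: "(?A *v x) $ i = x $ i - a $ i * (\<Sum>k\<in>K. x $ k)" for x i
  proof -
    have "(?A *v x) $ i = (\<Sum>j\<in>UNIV. (if i = j then x $ j else 0) - a $ i * (if j \<in> K then x $ j else 0))"
      unfolding matrix_vector_mult_def vec_lambda_beta by (intro sum.cong) (auto simp: b_def algebra_simps)
    also have "\<dots> = x $ i - a $ i * (\<Sum>j\<in>UNIV. if j \<in> K then x $ j else 0)"
      by (simp add: sum_subtractf sum_distrib_left)
    also have "(\<Sum>j\<in>UNIV. if j \<in> K then x $ j else 0) = (\<Sum>k\<in>K. x $ k)"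
      by (simp add: sum.If_cases)
    finally show ?thesis .
  qed
  have "a \<bullet> b = (\<Sum>i\<in>UNIV. if i \<in> K then \<beta> (h i) else 0)"
    unfolding inner_vec_def by (intro sum.cong) (auto simp: a_def b_def)
  also have "\<dots> = (\<Sum>i\<in>K. \<beta> (h i))" by (simp add: sum.If_cases)
  also have "\<dots> = sum \<beta> J" using hK by (rule sum.reindex_bij_betw)
  finally have "det ?A = 1 - sum \<beta> J" by (simp add: det_rank_one_update)
  also have "\<dots> = sum \<beta> (C - J)" using sum1 J finite_C by (simp add: sum_diff)
  finally have dA: "det ?A = sum \<beta> (C - J)" .
  have "0 < sum \<beta> (C - J)" using c finite_C pos by (intro sum_pos) auto
  then have dA': "det (matrix ((*v) ?A)) \<noteq> 0" using dA by (simp add: matrix_of_matrix_vector_mul)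
  \<comment> \<open>Coordinates outside \<open>K\<close> get the bound 1, which forces an integer to
    vanish and does not change the product of the bounds.\<close>
  let ?b = "\<lambda>i. if i \<in> K then \<beta> (h i) else 1"
  have "(\<Prod>i\<in>UNIV. ?b i) = (\<Prod>i\<in>K. \<beta> (h i))" by (simp add: prod.If_cases)
  also have "\<dots> = prod \<beta> J" using hK by (rule prod.reindex_bij_betw)
  finally have "\<bar>det (matrix ((*v) ?A))\<bar> < (\<Prod>i\<in>UNIV. ?b i)"
    using neg dA \<open>0 < sum \<beta> (C - J)\<close> by (simp add: matrix_of_matrix_vector_mul)
  moreover have "0 < ?b i" for i using pos[OF hC[of i]] by simp
  ultimately obtain x0 where x0: "x0 \<in> Zd" "x0 \<noteq> 0" "\<And>i. \<bar>(?A *v x0) $ i\<bar> < ?b i"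
    using minkowski_linear_forms[OF matrix_vector_mul_linear dA', of ?b] by blast
  \<comment> \<open>With a nonnegative sum \<open>m\<close>, the weights outside \<open>J\<close>,
    which change by \<open>m * \<beta> v\<close>, cannot decrease.\<close>
  define x where "x = (if (\<Sum>k\<in>K. x0 $ k) \<ge> 0 then x0 else - x0)"
  have x: "x \<in> Zd" "x \<noteq> 0" "\<And>i. \<bar>(?A *v x) $ i\<bar> < ?b i" "0 \<le> (\<Sum>k\<in>K. x $ k)"
  proof -
    show "x \<in> Zd" "x \<noteq> 0" using x0 by (auto simp: x_def Zd_uminus)
    show "\<bar>(?A *v x) $ i\<bar> < ?b i" for i
      using x0(3)[of i] unfolding Ax by (auto simp: x_def sum_negf)
    show "0 \<le> (\<Sum>k\<in>K. x $ k)" by (auto simp: x_def sum_negf)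
  qed
  define m where "m = (\<Sum>k\<in>K. x $ k)"
  have xZ: "x $ i \<in> \<int>" for i using x(1) by (simp add: Zd_def)
  have mZ: "m \<in> \<int>" unfolding m_def using xZ by (intro Ints_sum)
  have x_out: "x $ i = 0" if "i \<notin> K" for i
    using x(3)[of i] that xZ[of i] unfolding Ax by (simp add: a_def Ints_eq_abs_less1)
  have x_in: "\<bar>x $ i - \<beta> (h i) * m\<bar> < \<beta> (h i)" if "i \<in> K" for i
    using x(3)[of i] that unfolding Ax by (simp add: a_def m_def)
  have "m \<noteq> 0"
  proof
    assume m0: "m = 0"
    have "x $ i = 0" for i
    proof (cases "i \<in> K")
      case True
      have "\<beta> (h i) \<le> sum \<beta> C" using hC finite_C pos by (intro member_le_sum) (auto intro: less_imp_le)
      then show ?thesis using x_in[OF True] m0 sum1 xZ[of i] by (auto simp: Ints_eq_abs_less1)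
    qed (simp add: x_out)
    then show False using x(2) by (simp add: vec_eq_iff)
  qed
  then have m1: "0 < m" using x(4) by (simp add: m_def)
  \<comment> \<open>\<open>\<beta> + y\<close> are the barycentric coordinates of \<open>(m + 1) *\<^sub>R p - (\<Sum>i\<in>K. x $ i *\<^sub>R h i)\<close> for the interior point \<open>p\<close>.\<close>
  define y where "y v = m * \<beta> v - (if v \<in> J then x $ inv_into UNIV h v else 0)" for v
  have inv: "inv_into UNIV h (h i) = i" for i using hinj by simp
  have sJ: "(\<Sum>v\<in>C. if v \<in> J then f v else 0) = (\<Sum>i\<in>K. f (h i))" for f :: "real^'n \<Rightarrow> 'a::comm_monoid_add"
  proof -
    have "(\<Sum>v\<in>C. if v \<in> J then f v else 0) = sum f J"
      using finite_C J by (simp add: sum.If_cases Int_absorb1)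
    also have "\<dots> = (\<Sum>i\<in>K. f (h i))" using hK by (rule sum.reindex_bij_betw[symmetric])
    finally show ?thesis .
  qed
  have "y c = 0"
  proof (rule perturbation_zero[OF _ _ _ c(1)])
    fix v assume v: "v \<in> C"
    show "0 < \<beta> v + y v"
    proof (cases "v \<in> J")
      case True
      then obtain i where i: "i \<in> K" "v = h i" using hK by (auto simp: bij_betw_def)
      then show ?thesis using True x_in[OF i(1)] by (simp add: y_def inv abs_less_iff mult.commute)
    next
      case False
      have "0 < \<beta> v" "0 < m * \<beta> v" using pos[OF v] m1 by auto
      then show ?thesis using False by (simp add: y_def)
    qed
  next
    have "sum y C = m * sum \<beta> C - (\<Sum>i\<in>K. x $ inv_into UNIV h (h i))"
      unfolding y_def sum_subtractf sum_distrib_left[symmetric] sJ ..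
    then show "sum y C = 0" by (simp add: inv sum1 m_def)
  next
    have "(\<Sum>v\<in>C. y v *\<^sub>R v) = (\<Sum>v\<in>C. m *\<^sub>R (\<beta> v *\<^sub>R v)) - (\<Sum>v\<in>C. if v \<in> J then x $ inv_into UNIV h v *\<^sub>R v else 0)"
      unfolding sum_subtractf[symmetric] by (intro sum.cong) (auto simp: y_def scaleR_diff_left)
    also have "\<dots> = m *\<^sub>R (\<Sum>v\<in>C. \<beta> v *\<^sub>R v) - (\<Sum>i\<in>K. x $ i *\<^sub>R h i)"
      unfolding sJ by (simp add: scaleR_sum_right inv)
    also have "\<dots> \<in> Zd"
    proof (rule Zd_diff[OF Zd_scale[OF centre mZ]])
      show "(\<Sum>i\<in>K. x $ i *\<^sub>R h i) \<in> Zd" using xZ hC C_Zd by (intro Zd_sum Zd_scale) auto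
    qed
    finally show "(\<Sum>v\<in>C. y v *\<^sub>R v) \<in> Zd" .
  qed
  then show False using c m1 pos[of c] by (simp add: y_def)
qed


text \<open>Adding \<open>\<Sum>k<l. y k *\<^sub>R (p k - k0)\<close> to the interior point raises
  the weight of \<open>p k\<close> by \<open>y k\<close> and lowers that of \<open>k0\<close> by
  their sum. So one-sided bounds suffice, a precision on which the equality case relies.\<close>

lemma face_perturbation_zero:
  assumes k0: "k0 \<in> C" and p: "inj_on p {..<l}" "p ` {..<l} \<subseteq> C - {k0}"
    and y: "\<And>k. k < l \<Longrightarrow> - \<beta> (p k) < y k" "(\<Sum>k<l. y k) < \<beta> k0"
    and Z: "(\<Sum>k<l. y k *\<^sub>R (p k - k0)) \<in> Zd" and k: "k < l"
  shows "y k = 0"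
proof -
  define Y where "Y v = (if v \<in> p ` {..<l} then y (inv_into {..<l} p v) else 0) - (if v = k0 then (\<Sum>k<l. y k) else 0)" for v
  have inv: "inv_into {..<l} p (p k) = k" if "k < l" for k using p that by simp
  have s: "(\<Sum>v\<in>C. if v \<in> p ` {..<l} then f v else 0) = (\<Sum>k<l. f (p k))" for f :: "real^'n \<Rightarrow> 'z::comm_monoid_add"
  proof -
    have "C \<inter> p ` {..<l} = p ` {..<l}" using p by auto
    then have "(\<Sum>v\<in>C. if v \<in> p ` {..<l} then f v else 0) = sum f (p ` {..<l})"
      using finite_C by (simp add: sum.If_cases)
    also have "\<dots> = (\<Sum>k<l. f (p k))" using p by (simp add: sum.reindex)
    finally show ?thesis .
  qed
  have "Y (p k) = 0"
  proof (rule perturbation_zero)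
    show "p k \<in> C" using p k by auto
    fix v assume v: "v \<in> C"
    show "0 < \<beta> v + Y v"
    proof (cases "v = k0")
      case True
      then show ?thesis using y(2) p by (auto simp: Y_def)
    next
      case False
      show ?thesis
      proof (cases "v \<in> p ` {..<l}")
        case True
        then obtain j where j: "j < l" "v = p j" by auto
        then show ?thesis using y(1)[of j] False True by (simp add: Y_def inv)
      qed (use False pos[OF v] in \<open>simp add: Y_def\<close>)
    qed
  next
    have "sum Y C = (\<Sum>k<l. y (inv_into {..<l} p (p k))) - (\<Sum>k<l. y k)"
      unfolding Y_def sum_subtractf s using k0 finite_C by simp
    then show "sum Y C = 0" by (simp add: inv)
  next
    have "(\<Sum>v\<in>C. Y v *\<^sub>R v) = (\<Sum>v\<in>C. if v \<in> p ` {..<l} then y (inv_into {..<l} p v) *\<^sub>R v else 0) - (\<Sum>v\<in>C. if v = k0 then (\<Sum>k<l. y k) *\<^sub>R v else 0)"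
      unfolding sum_subtractf[symmetric] by (intro sum.cong) (auto simp: Y_def scaleR_diff_left)
    also have "\<dots> = (\<Sum>k<l. y k *\<^sub>R p k) - (\<Sum>k<l. y k) *\<^sub>R k0"
      unfolding s using k0 finite_C by (simp add: inv)
    also have "\<dots> = (\<Sum>k<l. y k *\<^sub>R (p k - k0))" by (simp add: scaleR_diff_right sum_subtractf scaleR_sum_left)
    finally show "(\<Sum>v\<in>C. Y v *\<^sub>R v) \<in> Zd" using Z by simp
  qed
  moreover have "p k \<noteq> k0" "p k \<in> p ` {..<l}" using p k by auto
  ultimately show ?thesis using k by (simp add: Y_def inv)
qed

section \<open>Edge vectors and the volume bound for a face\<close>

lemma fam_indep_edges:
  assumes k0: "k0 \<in> C" and p: "inj_on p {..<l}" "p ` {..<l} \<subseteq> C - {k0}"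
  shows "fam_indep l (\<lambda>k. p k - k0)"
proof -
  have "\<not> affine_dependent (insert k0 (p ` {..<l}))"
    using affine_dependent_subset[of "insert k0 (p ` {..<l})" C] k0 p indep by blast
  then have "independent ((\<lambda>x. - k0 + x) ` p ` {..<l})"
    using affine_dependent_iff_dependent[of k0 "p ` {..<l}"] p by blast
  then show ?thesis using p(1) by (auto simp: fam_indep_iff image_image inj_on_def)
qed


text \<open>Either \<open>y\<close> or \<open>- y\<close> has a nonpositive sum, and for that sign
  the condition at \<open>k0\<close> holds automatically.\<close>

lemma face_perturbation_abs_zero:
  assumes k0: "k0 \<in> C" and p: "inj_on p {..<l}" "p ` {..<l} \<subseteq> C - {k0}"
    and y: "\<And>k. k < l \<Longrightarrow> \<bar>y k\<bar> < \<beta> (p k)"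
    and Z: "(\<Sum>k<l. y k *\<^sub>R (p k - k0)) \<in> Zd" and k: "k < l"
  shows "y k = 0"
proof (cases "(\<Sum>k<l. y k) \<le> 0")
  case True
  show ?thesis
  proof (rule face_perturbation_zero[OF k0 p _ _ Z k])
    show "- \<beta> (p k) < y k" if "k < l" for k using y[OF that] by linarith
    show "(\<Sum>k<l. y k) < \<beta> k0" using True pos[OF k0] by linarith
  qed
next
  case False
  have Zn: "(\<Sum>k<l. (- y k) *\<^sub>R (p k - k0)) \<in> Zd" using Zd_uminus[OF Z] by (simp add: sum_negf)
  have "- y k = 0"
  proof (rule face_perturbation_zero[OF k0 p _ _ Zn k])
    show "- \<beta> (p k) < - y k" if "k < l" for k using y[OF that] by linarith
    have "(\<Sum>k<l. - y k) = - (\<Sum>k<l. y k)" by (rule sum_negf)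
    then show "(\<Sum>k<l. - y k) < \<beta> k0" using False pos[OF k0] by linarith
  qed
  then show ?thesis by simp
qed

text \<open>\<open>M\<close> converts coordinates in a basis of the lattice of the face into
  coordinates along the edges, so \<open>1 / \<bar>det M\<bar>\<close> is the index of the
  sublattice spanned by the edges. Coordinates from \<open>l\<close> on are kept.\<close>

lemma face_matrix:
  assumes l: "l \<le> CARD('n)" and k0: "k0 \<in> C" and p: "inj_on p {..<l}" "p ` {..<l} \<subseteq> C - {k0}"
  obtains M :: "real^'n^'n" where "det M \<noteq> 0" "fact l * volZ (spx k0 l (\<lambda>k. p k - k0)) = 1 / \<bar>det M\<bar>"
    "\<And>x. x \<in> Zd \<Longrightarrow> (\<Sum>k<l. (M *v x) $ idx k *\<^sub>R (p k - k0)) \<in> Zd"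
    "\<And>x k. l \<le> k \<Longrightarrow> k < CARD('n) \<Longrightarrow> (M *v x) $ idx k = x $ idx k"
proof -
  let ?w = "\<lambda>k. p k - k0"
  let ?V = "span (?w ` {..<l})"
  have pC: "p k \<in> C" "p k \<noteq> k0" if "k < l" for k using p that by auto
  have w: "fam_indep l ?w" by (rule fam_indep_edges[OF k0 p])
  have wZ: "?w k \<in> Zd" if "k < l" for k using pC[OF that] k0 C_Zd by (auto intro: Zd_diff)
  obtain b where b: "is_lattice_basis (Zd \<inter> ?V) l b" using ex_lattice_basis[OF wZ w] by blast
  obtain z where z: "compl_onb ?V l z" using ex_compl_onb[of ?V] dim_fam[OF w] by auto
  have bV: "b k \<in> ?V" "b k \<in> Zd" if "k < l" for k using lattice_basis_mem[OF b that] by auto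
  obtain A where A: "\<And>k. k < l \<Longrightarrow> b k = (\<Sum>j<l. A k j *\<^sub>R ?w j)"
    by (rule span_coeffs[of l b ?w]) (use bV(1) in auto)
  let ?M = "tmat l A :: real^'n^'n"
  have cd: "cdet l b z = cdet l ?w z * det ?M" by (rule cdet_transform[OF l A])
  have nzw: "cdet l ?w z \<noteq> 0" by (rule cdet_nonzero[OF l w _ z]) (auto intro: span_base)
  have "fam_indep l b" using b unfolding is_lattice_basis_iff by blast
  then have nzb: "cdet l b z \<noteq> 0" by (rule cdet_nonzero[OF l _ bV(1) z subspace_span])
  have dM: "det ?M \<noteq> 0" using cd nzb by auto
  have vol: "fact l * volZ (spx k0 l ?w) = 1 / \<bar>det ?M\<bar>"
  proof -
    have v: "volZ (spx k0 l ?w) = \<bar>cdet l ?w z\<bar> / (fact l * \<bar>cdet l b z\<bar>)" by (rule volZ_spx[OF l w wZ z b])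
    show ?thesis unfolding v cd abs_mult using nzw by simp
  qed
  have "(\<Sum>k<l. (?M *v x) $ idx k *\<^sub>R (p k - k0)) \<in> Zd" if x: "x \<in> Zd" for x
  proof -
    have "(\<Sum>k<l. x $ idx k *\<^sub>R b k) \<in> Zd" using x bV by (intro Zd_sum Zd_scale) (auto simp: Zd_def)
    then show ?thesis using tmat_mult_sum[OF l A, where x=x] by simp
  qed
  then show ?thesis using that[OF dM vol] tmat_mult_high by blast
qed

text \<open>A larger volume would let Minkowski's theorem find a nonzero lattice vector of the face
  whose edge coordinates are below the weights \<open>\<beta> (p k)\<close>. The coordinates from
  \<open>l\<close> on get the bound 1 and vanish by integrality.\<close>

lemma volZ_face_bound:
  assumes l: "l \<le> CARD('n)" and k0: "k0 \<in> C" and p: "inj_on p {..<l}" "p ` {..<l} \<subseteq> C - {k0}"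
  shows "fact l * volZ (spx k0 l (\<lambda>k. p k - k0)) * (\<Prod>k<l. \<beta> (p k)) \<le> 1"
proof (rule ccontr)
  assume neg: "\<not> ?thesis"
  have pC: "p k \<in> C" if "k < l" for k using p that by auto
  obtain M :: "real^'n^'n" where dM: "det M \<noteq> 0"
    and vol: "fact l * volZ (spx k0 l (\<lambda>k. p k - k0)) = 1 / \<bar>det M\<bar>"
    and MZ: "\<And>x. x \<in> Zd \<Longrightarrow> (\<Sum>k<l. (M *v x) $ idx k *\<^sub>R (p k - k0)) \<in> Zd"
    and high: "\<And>x k. l \<le> k \<Longrightarrow> k < CARD('n) \<Longrightarrow> (M *v x) $ idx k = x $ idx k"
    using that by (rule face_matrix[OF l k0 p])
  have lt: "\<bar>det M\<bar> < (\<Prod>k<l. \<beta> (p k))"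
  proof -
    have "1 < 1 / \<bar>det M\<bar> * (\<Prod>k<l. \<beta> (p k))" using neg unfolding vol by (simp only: not_le)
    then show ?thesis using dM by (simp add: less_divide_eq)
  qed
  let ?c = "\<lambda>i::'n. if num i < l then \<beta> (p (num i)) else 1"
  have "(\<Prod>i\<in>UNIV. ?c i) = (\<Prod>k<CARD('n). if k < l then \<beta> (p k) else 1)"
    unfolding prod_idx by (intro prod.cong) auto
  also have "\<dots> = (\<Prod>k\<in>{..<CARD('n)} \<inter> {k. k < l}. \<beta> (p k))" by (simp add: prod.If_cases)
  also have "{..<CARD('n)} \<inter> {k. k < l} = {..<l}" using l by auto
  finally have "\<bar>det (matrix ((*v) M))\<bar> < (\<Prod>i\<in>UNIV. ?c i)" using lt by (simp add: matrix_of_matrix_vector_mul)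
  moreover have "0 < ?c i" for i using pos[OF pC] by simp
  moreover have "det (matrix ((*v) M)) \<noteq> 0" using dM by (simp add: matrix_of_matrix_vector_mul)
  ultimately obtain x where x: "x \<in> Zd" "x \<noteq> 0" "\<And>i. \<bar>(M *v x) $ i\<bar> < ?c i"
    using minkowski_linear_forms[OF matrix_vector_mul_linear, of M ?c] by blast
  have xZ: "x $ i \<in> \<int>" for i using x(1) by (simp add: Zd_def)
  have M0: "(M *v x) $ idx k = 0" if "k < CARD('n)" for k
  proof (cases "k < l")
    case True
    show ?thesis
    proof (rule face_perturbation_abs_zero[OF k0 p _ MZ[OF x(1)] True])
      show "\<bar>(M *v x) $ idx k\<bar> < \<beta> (p k)" if "k < l" for k using x(3)[of "idx k"] that l by simp
    qed
  next
    case False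
    then show ?thesis using x(3)[of "idx k"] high[of k x] that xZ[of "idx k"] by (simp add: Ints_eq_abs_less1)
  qed
  then have "\<forall>i. (M *v x) $ i = 0" by (subst all_idx) simp
  then have "M *v x = 0" by (simp add: vec_eq_iff)
  moreover have "inj ((*v) M)"
    using dM det_nz_iff_inj[OF matrix_vector_mul_linear, of M] by (simp add: matrix_of_matrix_vector_mul)
  ultimately have "x = 0" using injD[of "(*v) M" x 0] by simp
  with x(2) show False ..
qed

end

lemma one_point_simplex_exists:
  fixes S :: "(real^'n) set"
  assumes "S \<in> lattice_simplices_one"
  obtains C \<beta> where "S = convex hull C" "one_point_simplex C \<beta>"
proof -
  obtain C where C: "\<not> affine_dependent C" "card C = CARD('n) + 1" "C \<subseteq> Zd" "S = convex hull C" "card (interior S \<inter> Zd) = 1"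
    using assms by (auto simp: lattice_simplices_one_def)
  have fin: "finite C" using C(2) by (intro card_ge_0_finite) simp
  obtain p where p: "interior S \<inter> Zd = {p}" using C(5) by (auto simp: card_1_singleton_iff)
  have int: "interior S = {y. \<exists>u. (\<forall>x\<in>C. 0 < u x) \<and> sum u C = 1 \<and> (\<Sum>x\<in>C. u x *\<^sub>R x) = y}"
    unfolding C(4) using interior_convex_hull_explicit_minimal[OF C(1)] C(2) by simp
  obtain \<beta> where b: "\<forall>x\<in>C. 0 < \<beta> x" "sum \<beta> C = 1" "(\<Sum>x\<in>C. \<beta> x *\<^sub>R x) = p" using p int by blast
  have pZ: "p \<in> Zd" using p by auto
  have "one_point_simplex C \<beta>"
  proof
    fix u assume u: "\<And>v. v \<in> C \<Longrightarrow> 0 < u v" "sum u C = 1" "(\<Sum>v\<in>C. u v *\<^sub>R v) \<in> Zd"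
    then have "(\<Sum>v\<in>C. u v *\<^sub>R v) \<in> interior S" unfolding int by blast
    then have up: "(\<Sum>v\<in>C. u v *\<^sub>R v) = p" using u(3) p by blast
    have "sum (\<lambda>v. u v - \<beta> v) C = 0" "(\<Sum>v\<in>C. (u v - \<beta> v) *\<^sub>R v) = 0"
      using u(2) b(2,3) up by (auto simp: sum_subtractf scaleR_diff_left)
    moreover have "\<not> (\<exists>U. sum U C = 0 \<and> (\<exists>v\<in>C. U v \<noteq> 0) \<and> (\<Sum>v\<in>C. U v *\<^sub>R v) = 0)"
      using C(1) affine_dependent_explicit_finite[OF fin] by blast
    ultimately have "\<not> (\<exists>v\<in>C. u v - \<beta> v \<noteq> 0)" by blast
    then show "\<forall>v\<in>C. u v = \<beta> v" by simp
  qed (use C b pZ in auto)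
  then show ?thesis using that C(4) by blast
qed

text \<open>Replaces a limit \<open>e \<rightarrow> 0\<close>: over a finite set of values one
  \<open>e\<close> is small enough for estimates up to \<open>e\<close> to become exact
  signs.\<close>

lemma finite_positive_gap:
  fixes T :: "real set"
  assumes "finite T" "0 < e0"
  obtains e where "0 < e" "e \<le> e0" "\<And>t. t \<in> T \<Longrightarrow> t < e \<Longrightarrow> t \<le> 0"
proof
  let ?P = "insert e0 {t \<in> T. 0 < t}"
  have fin: "finite ?P" using assms by simp
  show "0 < Min ?P" using fin assms by (subst Min_gr_iff) auto
  show "Min ?P \<le> e0" using fin by (intro Min_le) auto
  show "t \<le> 0" if "t \<in> T" "t < Min ?P" for t
  proof (rule ccontr)
    assume "\<not> t \<le> 0"
    then have "Min ?P \<le> t" using fin that by (intro Min_le) auto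
    with that show False by simp
  qed
qed

lemma finite_Zd_linear_preimage:
  fixes M :: "real^'n^'n"
  assumes "inj ((*v) M)"
  shows "finite {x \<in> Zd. \<forall>i. \<bar>(M *v x) $ i\<bar> \<le> K}"
proof -
  obtain B where B: "B > 0" "\<And>x. B * norm x \<le> norm (M *v x)"
    using linear_inj_bounded_below_pos[OF matrix_vector_mul_linear assms] by blast
  let ?X = "{x. \<forall>i. \<bar>(M *v x) $ i\<bar> \<le> K}"
  have "norm x \<le> real CARD('n) * K / B" if "x \<in> ?X" for x
  proof -
    have "B * norm x \<le> norm (M *v x)" by (rule B(2))
    also have "\<dots> \<le> (\<Sum>i\<in>UNIV. \<bar>(M *v x) $ i\<bar>)" by (rule norm_le_l1_cart)
    also have "\<dots> \<le> (\<Sum>i\<in>(UNIV::'n set). K)" using that by (intro sum_mono) auto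
    finally show ?thesis using B(1) by (simp add: field_simps)
  qed
  then have "bounded ?X" unfolding bounded_iff by blast
  then have "finite (?X \<inter> Zd)" by (rule finite_Zd_bounded)
  moreover have "?X \<inter> Zd = {x \<in> Zd. \<forall>i. \<bar>(M *v x) $ i\<bar> \<le> K}" by auto
  ultimately show ?thesis by simp
qed

section \<open>Equality in the volume bound\<close>

context one_point_simplex
begin

lemma beta_less_1:
  assumes "v \<in> C" "u \<in> C" "u \<noteq> v" shows "\<beta> v < 1"
proof -
  have "\<beta> v + \<beta> u = sum \<beta> {v, u}" using assms by simp
  also have "\<dots> \<le> sum \<beta> C" using assms finite_C pos by (intro sum_mono2) (auto intro: less_imp_le)
  finally show ?thesis using sum1 pos[OF assms(2)] by simp
qed

text \<open>If the volume bound is attained, the translates of a half-open box by the lattice leave no room for a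
  further small box placed behind the facet in direction \<open>m\<close>. The resulting overlap is one-sided in all other
  directions, so it gives a second interior lattice point unless it is exactly the edge direction.\<close>

lemma maximal_volume_edge:
  assumes k0: "k0 \<in> C" and p: "inj_on p {..<CARD('n)}" "p ` {..<CARD('n)} \<subseteq> C - {k0}"
    and m: "m < CARD('n)" "\<beta> (p m) = \<beta> k0"
    and vol: "fact CARD('n) * volZ (spx k0 CARD('n) (\<lambda>k. p k - k0)) * (\<Prod>k<CARD('n). \<beta> (p k)) = 1"
  shows "\<beta> (p m) *\<^sub>R (p m - k0) \<in> Zd"
proof -
  let ?d = "CARD('n)"
  have pC: "p k \<in> C" "p k \<noteq> k0" if "k < ?d" for k using p that by auto
  obtain M :: "real^'n^'n" where dM: "det M \<noteq> 0"
    and volM: "fact ?d * volZ (spx k0 ?d (\<lambda>k. p k - k0)) = 1 / \<bar>det M\<bar>"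
    and MZ: "\<And>x. x \<in> Zd \<Longrightarrow> (\<Sum>k<?d. (M *v x) $ idx k *\<^sub>R (p k - k0)) \<in> Zd"
    and "\<And>x k. ?d \<le> k \<Longrightarrow> k < ?d \<Longrightarrow> (M *v x) $ idx k = x $ idx k"
    using that by (rule face_matrix[OF order_refl k0 p])
  have injM: "inj ((*v) M)"
    using dM det_nz_iff_inj[OF matrix_vector_mul_linear, of M] by (simp add: matrix_of_matrix_vector_mul)
  define c where "c i = \<beta> (p (num i))" for i :: 'n
  have cpos: "0 < c i" for i unfolding c_def by (intro pos pC num_less)
  have c1: "c i < 1" for i unfolding c_def using beta_less_1[OF pC(1) k0] pC(2) num_less[of i] by metis
  have cidx: "c (idx k) = \<beta> (p k)" if "k < ?d" for k using that by (simp add: c_def)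
  have detM: "\<bar>det M\<bar> = (\<Prod>i\<in>UNIV. c i)"
  proof -
    have "(\<Prod>i\<in>UNIV. c i) = (\<Prod>k<?d. \<beta> (p k))" unfolding prod_idx by (intro prod.cong) (auto simp: cidx)
    moreover have "1 / \<bar>det M\<bar> * (\<Prod>k<?d. \<beta> (p k)) = 1" using vol unfolding volM .
    ultimately show ?thesis using dM by (simp add: field_simps)
  qed
  define q :: 'n where "q = idx m"
  have cq: "c q = \<beta> k0" using cidx[OF m(1)] m(2) by (simp add: q_def)
  \<comment> \<open>The vector found below has entries between \<open>- c i\<close> and
    \<open>a i + e\<close>, where \<open>e \<le> c i < 1\<close> and \<open>a i \<le> c i\<close>;
    hence the bound 2. \<open>T\<close> collects the values that \<open>e\<close> has to separate
    from 0.\<close>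
  define X where "X = {x \<in> Zd. \<forall>i. \<bar>(M *v x) $ i\<bar> \<le> 2}"
  define T where "T = (\<lambda>(x, i). (M *v x) $ i) ` (X \<times> UNIV) \<union> (\<lambda>x. (M *v x) $ q - c q) ` X"
  have "finite T" unfolding T_def X_def using finite_Zd_linear_preimage[OF injM, of 2] by auto
  moreover have "0 < Min (range c)" by (subst Min_gr_iff) (auto simp: cpos)
  ultimately obtain e where e: "0 < e" "e \<le> Min (range c)" "\<And>t. t \<in> T \<Longrightarrow> t < e \<Longrightarrow> t \<le> 0"
    using finite_positive_gap by metis
  have ec: "e \<le> c i" for i using e(2) by (rule order_trans) simp
  define B0 where "B0 = {x::real^'n. \<forall>i. 0 \<le> x $ i \<and> x $ i < 0 + c i}"
  define a where "a i = (if i = q then c q else 0)" for i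
  \<comment> \<open>A cube of side \<open>e\<close> just behind the facet of \<open>B0\<close> in
    direction \<open>q\<close>. Since \<open>B0\<close> has volume exactly
    \<open>\<bar>det M\<bar>\<close>, this cube supplies the excess that Blichfeldt's theorem
    needs.\<close>
  define B1 where "B1 = {x::real^'n. \<forall>i. a i \<le> x $ i \<and> x $ i < a i + e}"
  have b0: "B0 \<in> sets borel" "bounded B0" "measure lebesgue B0 = (\<Prod>i\<in>UNIV. c i)"
    unfolding B0_def using halfopen_box_cart[of c "\<lambda>_. 0", OF cpos] by blast+
  have b1: "B1 \<in> sets borel" "bounded B1" "measure lebesgue B1 = (\<Prod>i\<in>(UNIV :: 'n set). e)"
    unfolding B1_def using halfopen_box_cart[of "\<lambda>_. e" a, OF e(1)] by blast+
  have lm: "B0 \<in> lmeasurable" "B1 \<in> lmeasurable"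
    using b0 b1 by (auto intro: bounded_set_imp_lmeasurable)
  have "B0 \<inter> B1 = {}"
  proof (rule ccontr)
    assume "B0 \<inter> B1 \<noteq> {}"
    then obtain x where "x \<in> B0" "x \<in> B1" by blast
    then have "x $ q < 0 + c q" "a q \<le> x $ q" unfolding B0_def B1_def by blast+
    then show False by (simp add: a_def)
  qed
  then have "measure lebesgue (B0 \<union> B1) = measure lebesgue B0 + measure lebesgue B1"
    using lm by (intro measure_Union) (auto simp: fmeasurable_def)
  then have "\<bar>det (matrix ((*v) M))\<bar> < measure lebesgue (B0 \<union> B1)"
    using e(1) by (simp add: matrix_of_matrix_vector_mul detM b0(3) b1(3) prod_pos)
  moreover have "det (matrix ((*v) M)) \<noteq> 0" using dM by (simp add: matrix_of_matrix_vector_mul)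
  ultimately obtain x P Q where x: "x \<in> Zd" "x \<noteq> 0" "P \<in> B0 \<union> B1" "Q \<in> B0 \<union> B1" "M *v x = P - Q"
    using blichfeldt_linear[OF matrix_vector_mul_linear, of M "B0 \<union> B1"] b0(1,2) b1(1,2) sets.Un bounded_Un by metis
  have small: False if x: "x \<in> Zd" "x \<noteq> 0" and le: "\<And>i. \<bar>(M *v x) $ i\<bar> < c i" for x
  proof -
    have "(M *v x) $ idx k = 0" if "k < ?d" for k
    proof (rule face_perturbation_abs_zero[OF k0 p _ MZ[OF x(1)] that])
      show "\<bar>(M *v x) $ idx k\<bar> < \<beta> (p k)" if "k < ?d" for k using le[of "idx k"] that cidx by simp
    qed
    then have "\<forall>i. (M *v x) $ i = 0" by (subst all_idx) simp
    then have "M *v x = 0" by (simp add: vec_eq_iff)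
    then have "x = 0" using injD[OF injM, of x 0] by simp
    with x(2) show False ..
  qed
  have B0D: "0 \<le> x $ i" "x $ i < c i" if "x \<in> B0" for x i using that by (auto simp: B0_def)
  have B1D: "a i \<le> x $ i" "x $ i < a i + e" if "x \<in> B1" for x i using that by (auto simp: B1_def)
  \<comment> \<open>Two points of the same box differ by less than \<open>c i\<close> in every
    coordinate, for \<open>B1\<close> because \<open>e \<le> c i\<close>, and \<open>small\<close>
    excludes that. Up to sign the difference therefore leads from \<open>B0\<close> to
    \<open>B1\<close>.\<close>
  have "\<exists>x\<in>Zd. \<exists>P\<in>B1. \<exists>Q\<in>B0. M *v x = P - Q"
  proof -
    consider "P \<in> B0" "Q \<in> B0" | "P \<in> B1" "Q \<in> B1" | "P \<in> B1" "Q \<in> B0" | "P \<in> B0" "Q \<in> B1" using x(3,4) by blast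
    then show ?thesis
    proof cases
      case 1
      have "\<bar>(M *v x) $ i\<bar> < c i" for i
        using B0D[OF 1(1), of i] B0D[OF 1(2), of i] unfolding x(5) by simp
      with small[OF x(1,2)] have False by blast
      then show ?thesis ..
    next
      case 2
      have "\<bar>(M *v x) $ i\<bar> < c i" for i
        using B1D[OF 2(1), of i] B1D[OF 2(2), of i] ec[of i] unfolding x(5) by simp
      with small[OF x(1,2)] have False by blast
      then show ?thesis ..
    next
      case 3 then show ?thesis using x by blast
    next
      case 4
      have "M *v (- x) = - (M *v x)" by (simp add: linear_neg[OF matrix_vector_mul_linear])
      then have "M *v (- x) = Q - P" by (simp add: x(5))
      then show ?thesis using 4 Zd_uminus[OF x(1)] by blast
    qed
  qed
  then obtain x P Q where x: "x \<in> Zd" "P \<in> B1" "Q \<in> B0" "M *v x = P - Q" by blast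
  have y1: "- c i < (M *v x) $ i" "(M *v x) $ i < a i + e" for i
    using B1D[OF x(2), of i] B0D[OF x(3), of i] cpos[of i] cpos[of q] unfolding x(4) by (auto simp: a_def split: if_splits)
  have yq: "0 < (M *v x) $ q" using B1D[OF x(2), of q] B0D[OF x(3), of q] unfolding x(4) by (simp add: a_def)
  have "x \<in> X"
  proof -
    have "\<bar>(M *v x) $ i\<bar> \<le> 2" for i
    proof -
      have "a i \<le> c i" using cpos[of i] by (simp add: a_def)
      then show ?thesis using y1[of i] c1[of i] ec[of i] cpos[of i] by linarith
    qed
    then show ?thesis using x(1) by (simp add: X_def)
  qed
  have yi: "(M *v x) $ i \<le> 0" if "i \<noteq> q" for i
  proof (rule e(3))
    show "(M *v x) $ i \<in> T" unfolding T_def using \<open>x \<in> X\<close> by force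
    show "(M *v x) $ i < e" using y1(2)[of i] that by (simp add: a_def)
  qed
  have yq2: "(M *v x) $ q - c q \<le> 0"
  proof (rule e(3))
    show "(M *v x) $ q - c q \<in> T" unfolding T_def using \<open>x \<in> X\<close> by blast
    show "(M *v x) $ q - c q < e" using y1(2)[of q] by (simp add: a_def)
  qed
  have s: "(\<Sum>k<?d. (M *v x) $ idx k) = (M *v x) $ q + (\<Sum>i\<in>UNIV - {q}. (M *v x) $ i)"
    by (simp add: sum_idx[symmetric] sum.remove[of UNIV q])
  have neg: "(\<Sum>i\<in>UNIV - {q}. (M *v x) $ i) \<le> 0" using yi by (intro sum_nonpos) auto
  \<comment> \<open>All entries exceed \<open>- c i\<close>, so only the weight of \<open>k0\<close>
    can prevent a second interior lattice point. Thus the sum of the entries is at least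
    \<open>\<beta> k0 = c q\<close>; but it is an entry at most \<open>c q\<close> plus nonpositive
    ones, which forces equality throughout.\<close>
  have ge: "\<not> (\<Sum>k<?d. (M *v x) $ idx k) < \<beta> k0"
  proof
    assume lt: "(\<Sum>k<?d. (M *v x) $ idx k) < \<beta> k0"
    have "(M *v x) $ idx m = 0"
    proof (rule face_perturbation_zero[OF k0 p _ lt MZ[OF x(1)] m(1)])
      show "- \<beta> (p k) < (M *v x) $ idx k" if "k < ?d" for k using y1(1)[of "idx k"] cidx[OF that] by simp
    qed
    then show False using yq by (simp add: q_def)
  qed
  then have s0: "(\<Sum>i\<in>UNIV - {q}. (M *v x) $ i) = 0" and yqc: "(M *v x) $ q = c q" using s neg yq2 cq by linarith+
  have "(M *v x) $ i = 0" if "i \<noteq> q" for i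
  proof -
    have "(\<Sum>i\<in>UNIV - {q}. - (M *v x) $ i) = 0" using s0 by (simp add: sum_negf)
    moreover have "\<forall>i\<in>UNIV - {q}. 0 \<le> - (M *v x) $ i" using yi by simp
    ultimately show ?thesis using that sum_nonneg_eq_0_iff[of "UNIV - {q}" "\<lambda>i. - (M *v x) $ i"] by simp
  qed
  then have "(M *v x) $ idx k *\<^sub>R (p k - k0) = (if k = m then \<beta> (p m) *\<^sub>R (p m - k0) else 0)" if "k < ?d" for k
    using that yqc cidx[OF m(1)] m(1) by (auto simp: q_def idx_eq_iff)
  then have "(\<Sum>k<?d. (M *v x) $ idx k *\<^sub>R (p k - k0)) = (\<Sum>k<?d. if k = m then \<beta> (p m) *\<^sub>R (p m - k0) else 0)"
    by (intro sum.cong) auto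
  also have "\<dots> = \<beta> (p m) *\<^sub>R (p m - k0)" using m(1) by simp
  finally show ?thesis using MZ[OF x(1)] by simp
qed

end

section \<open>Full-dimensional simplices and unimodular bases\<close>

lemma cdet_scale:
  fixes f :: "nat \<Rightarrow> real^'n"
  assumes l: "l \<le> CARD('n)"
  shows "cdet l (\<lambda>k. q k *\<^sub>R f k) z = cdet l f z * (\<Prod>k<l. q k)"
proof -
  let ?A = "\<lambda>k j. if j = k then q k else 0 :: real"
  have "q k *\<^sub>R f k = (\<Sum>j<l. ?A k j *\<^sub>R f j)" if "k < l" for k
  proof -
    have "(\<Sum>j<l. ?A k j *\<^sub>R f j) = (\<Sum>j<l. if j = k then q k *\<^sub>R f k else 0)" by (intro sum.cong) auto
    then show ?thesis using that by simp
  qed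
  then have "cdet l (\<lambda>k. q k *\<^sub>R f k) z = cdet l f z * det (tmat l ?A :: real^'n^'n)"
    by (rule cdet_transform[OF l])
  also have "det (tmat l ?A :: real^'n^'n) = (\<Prod>i\<in>UNIV. (tmat l ?A :: real^'n^'n) $ i $ i)"
  proof (rule det_diagonal)
    fix i j :: 'n assume "i \<noteq> j"
    then have "num i \<noteq> num j" by (metis idx_num)
    then show "(tmat l ?A :: real^'n^'n) $ i $ j = 0" using \<open>i \<noteq> j\<close> by (simp add: tmat_def)
  qed
  also have "\<dots> = (\<Prod>k<CARD('n). if k < l then q k else 1)"
    unfolding prod_idx by (intro prod.cong) (auto simp: tmat_def)
  also have "\<dots> = (\<Prod>k\<in>{..<CARD('n)} \<inter> {k. k < l}. q k)" by (simp add: prod.If_cases)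
  also have "{..<CARD('n)} \<inter> {k. k < l} = {..<l}" using l by auto
  finally show ?thesis .
qed

definition unit :: "nat \<Rightarrow> real^'n" where "unit k = axis (idx k) 1"

lemma comb_unit: "comb unit x = (x :: real^'n)"
proof -
  have "comb unit x $ i = x $ i" for i
  proof -
    have "comb unit x $ i = (\<Sum>k<CARD('n). if k = num i then x $ i else 0)"
      unfolding comb_def sum_component
      by (intro sum.cong) (auto simp: unit_def axis_def)
    also have "\<dots> = x $ i" using num_less[of i] by simp
    finally show ?thesis .
  qed
  then show ?thesis by (simp add: vec_eq_iff)
qed

lemma comb_apply_unit: "k < CARD('n) \<Longrightarrow> comb f (unit k) = (f k :: real^'n)"
proof -
  assume k: "k < CARD('n)"
  have "comb f (unit k) = (\<Sum>j<CARD('n). if j = k then f k else 0)"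
    unfolding comb_def using k by (intro sum.cong) (auto simp: unit_def axis_def idx_eq_iff)
  then show ?thesis using k by simp
qed

lemma unit_Zd: "unit k \<in> Zd"
  by (simp add: unit_def Zd_def axis_def)

lemma comb_fill_full: "comb (fill CARD('n) w z) = (comb w :: real^'n \<Rightarrow> real^'n)"
  by (rule ext) (auto simp: comb_def fill_def intro!: sum.cong)

lemma fam_indep_unit: "fam_indep CARD('n) (unit :: nat \<Rightarrow> real^'n)"
  unfolding fam_indep_def
proof (intro allI impI)
  fix c :: "nat \<Rightarrow> real" and k assume s: "(\<Sum>k<CARD('n). c k *\<^sub>R unit k) = (0 :: real^'n)" and k: "k < CARD('n)"
  let ?x = "(\<chi> i. c (num i)) :: real^'n"
  have "comb unit ?x = (\<Sum>k<CARD('n). c k *\<^sub>R (unit k :: real^'n))" unfolding comb_def by (intro sum.cong) auto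
  then have "?x = 0" using s unfolding comb_unit by simp
  then have "?x $ idx k = 0" by simp
  then show "c k = 0" using k by simp
qed

lemma span_full:
  fixes w :: "nat \<Rightarrow> real^'n"
  assumes "fam_indep CARD('n) w" shows "span (w ` {..<CARD('n)}) = UNIV"
  using dim_fam[OF assms] by (simp add: dim_eq_full[symmetric])

lemma lattice_basis_unit: "is_lattice_basis (Zd :: (real^'n) set) CARD('n) unit"
proof -
  have "(Zd :: (real^'n) set) = {\<Sum>k<CARD('n). of_int (z k) *\<^sub>R unit k | z. True}"
  proof (intro equalityI subsetI)
    fix x :: "real^'n" assume x: "x \<in> Zd"
    have "of_int \<lfloor>x $ idx k\<rfloor> = x $ idx k" for k using x by (simp add: Zd_def)
    then have "(\<Sum>k<CARD('n). of_int \<lfloor>x $ idx k\<rfloor> *\<^sub>R unit k) = comb unit x" unfolding comb_def by (simp only:)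
    then show "x \<in> {\<Sum>k<CARD('n). of_int (z k) *\<^sub>R unit k | z. True}"
      unfolding comb_unit by (intro CollectI exI[of _ "\<lambda>k. \<lfloor>x $ idx k\<rfloor>"]) simp
  next
    fix x :: "real^'n" assume "x \<in> {\<Sum>k<CARD('n). of_int (z k) *\<^sub>R unit k | z. True}"
    then show "x \<in> Zd" by (auto intro!: Zd_sum Zd_scale unit_Zd)
  qed
  then show ?thesis using fam_indep_unit unfolding is_lattice_basis_iff by blast
qed

lemma cdet_unit: "cdet CARD('n) unit z = (1::real)" for z :: "nat \<Rightarrow> real^'n"
proof -
  have "comb unit = (id :: real^'n \<Rightarrow> real^'n)" by (rule ext) (simp add: comb_unit)
  then show ?thesis unfolding cdet_def comb_fill_full by (simp add: matrix_id_mat_1)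
qed

lemma volZ_spx_full:
  fixes w :: "nat \<Rightarrow> real^'n"
  assumes w: "fam_indep CARD('n) w" "\<And>k. k < CARD('n) \<Longrightarrow> w k \<in> Zd"
  shows "fact CARD('n) * volZ (spx v CARD('n) w) = \<bar>cdet CARD('n) w z\<bar>"
proof -
  have V: "span (w ` {..<CARD('n)}) = UNIV" by (rule span_full[OF w(1)])
  obtain z' where z': "compl_onb (UNIV :: (real^'n) set) CARD('n) z'" using ex_compl_onb[of UNIV] by auto
  have eq: "cdet CARD('n) w z' = cdet CARD('n) w z" unfolding cdet_def comb_fill_full ..
  have "volZ (spx v CARD('n) w) = \<bar>cdet CARD('n) w z'\<bar> / (fact CARD('n) * \<bar>cdet CARD('n) unit z'\<bar>)"
    by (rule volZ_spx[OF order_refl w, unfolded V, OF _ z']) (simp_all add: lattice_basis_unit)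
  then show ?thesis unfolding cdet_unit eq by simp
qed

lemma measure_spx_full:
  fixes w :: "nat \<Rightarrow> real^'n"
  assumes w: "fam_indep CARD('n) w"
  shows "measure lebesgue (spx v CARD('n) w) = \<bar>cdet CARD('n) w z\<bar> / fact CARD('n)"
proof -
  let ?d = "CARD('n)"
  let ?E = "std_spx CARD('n)"
  obtain z' where z': "compl_onb (UNIV :: (real^'n) set) ?d z'" using ex_compl_onb[of UNIV] by auto
  have nz: "det (matrix (comb w)) \<noteq> 0"
    using cdet_nonzero[OF order_refl w _ z'] unfolding cdet_def comb_fill_full by simp
  have "spx v ?d w = (+) v ` comb w ` cyl ?d ?E"
  proof (intro equalityI subsetI)
    fix x assume "x \<in> spx v ?d w"
    then obtain y where y: "y \<in> ?E" "x = v + (\<Sum>k<?d. y k *\<^sub>R w k)" unfolding spx_param[OF w] by blast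
    let ?x = "(\<chi> i. y (num i)) :: real^'n"
    have "(\<lambda>k\<in>{..<?d}. ?x $ idx k) = y"
    proof
      fix k show "(\<lambda>k\<in>{..<?d}. ?x $ idx k) k = y k"
        using y(1) by (cases "k < ?d") (auto simp: std_spx_def space_PiM PiE_def extensional_def)
    qed
    then have "?x \<in> cyl ?d ?E" unfolding cyl_def using y(1) by simp
    moreover have "x = v + comb w ?x" unfolding y(2) comb_def by simp
    ultimately show "x \<in> (+) v ` comb w ` cyl ?d ?E" by blast
  next
    fix x assume "x \<in> (+) v ` comb w ` cyl ?d ?E"
    then obtain y where y: "y \<in> cyl ?d ?E" "x = v + comb w y" by auto
    have "(\<lambda>k\<in>{..<?d}. y $ idx k) \<in> ?E" using y(1) unfolding cyl_def by blast
    moreover have "x = v + (\<Sum>k<?d. (\<lambda>k\<in>{..<?d}. y $ idx k) k *\<^sub>R w k)" unfolding y(2) comb_def by simp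
    ultimately show "x \<in> spx v ?d w" unfolding spx_param[OF w] by blast
  qed
  then have "measure lebesgue (spx v ?d w) = measure lebesgue (comb w ` cyl ?d ?E)" by (simp only: measure_translation)
  also have "\<dots> = \<bar>det (matrix (comb w))\<bar> * (1 / fact ?d)"
    using measure_linear_image_borel(2)[OF linear_comb nz measure_cyl(1)[OF order_refl sets_std_spx] bounded_cyl_std_spx]
      measure_cyl(2)[OF order_refl sets_std_spx, where 'n='n] by (simp add: measure_std_spx)
  finally show ?thesis unfolding cdet_def comb_fill_full by simp
qed

text \<open>Cramer's rule writes the preimage of an integer vector with integer determinants over
  the denominator \<open>1\<close> or \<open>- 1\<close>.\<close>

lemma comb_Zd_bij:
  fixes f :: "nat \<Rightarrow> real^'n"
  assumes f: "\<And>k. k < CARD('n) \<Longrightarrow> f k \<in> Zd" and d: "\<bar>det (matrix (comb f))\<bar> = 1"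
  shows "comb f ` Zd = Zd"
proof (intro equalityI subsetI)
  fix y assume "y \<in> comb f ` Zd"
  then obtain x where x: "x \<in> Zd" "y = comb f x" by blast
  have "x $ i \<in> \<int>" for i using x(1) by (simp add: Zd_def)
  then show "y \<in> Zd" unfolding x(2) comb_def using f by (intro Zd_sum Zd_scale) auto
next
  fix y :: "real^'n" assume y: "y \<in> Zd"
  let ?A = "matrix (comb f)"
  have nz: "det ?A \<noteq> 0" using d by auto
  define x where "x = (\<chi> k. det (\<chi> i j. if j = k then y $ i else ?A $ i $ j) / det ?A)"
  have "?A *v x = y" using cramer[OF nz, of x y] by (simp add: x_def)
  then have "comb f x = y" by (simp add: matrix_works linear_comb)
  moreover have "x \<in> Zd"
  proof -
    have "?A $ i $ j \<in> \<int>" for i j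
    proof -
      have "comb f (unit (num j)) = f (num j)" by (rule comb_apply_unit[OF num_less])
      then have "?A $ i $ j = f (num j) $ i" by (simp add: matrix_def unit_def)
      then show ?thesis using f[OF num_less[of j]] by (simp add: Zd_def)
    qed
    then have "det (\<chi> i j. if j = k then y $ i else ?A $ i $ j) \<in> \<int>" for k
      using y by (intro det_Ints) (simp add: Zd_def)
    moreover have "det ?A = 1 \<or> det ?A = - 1" using d by linarith
    ultimately show ?thesis unfolding Zd_def x_def by auto
  qed
  ultimately show "y \<in> comb f ` Zd" by blast
qed

text \<open>By Bezout \<open>1 / b\<close> is an integer combination of \<open>a / b\<close> and
  1.\<close>

lemma Zd_coprime_division:
  assumes "coprime a b" "(real a / real b) *\<^sub>R w \<in> Zd" "w \<in> Zd" "b \<noteq> 0"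
  shows "(1 / real b) *\<^sub>R w \<in> Zd"
proof -
  have "gcd (int a) (int b) = 1" using assms(1) by simp
  then obtain u v where uv: "u * int a + v * int b = 1" using bezout_int[of "int a" "int b"] by metis
  have "real_of_int (u * int a + v * int b) = 1" unfolding uv by simp
  then have "1 / real b = of_int u * (real a / real b) + of_int v" using assms(4) by (simp add: field_simps)
  then have "(1 / real b) *\<^sub>R w = of_int u *\<^sub>R ((real a / real b) *\<^sub>R w) + of_int v *\<^sub>R w"
    by (simp add: scaleR_add_left)
  also have "\<dots> \<in> Zd" by (rule Zd_add[OF Zd_scale[OF assms(2)] Zd_scale[OF assms(3)]]) auto
  finally show ?thesis .
qed

text \<open>Multiplying the sum by the product \<open>n\<close> of the other denominators makes all
  other terms integral. This leaves \<open>n / s k\<close> times \<open>w k\<close>, where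
  \<open>n\<close> and \<open>s k\<close> are coprime.\<close>

lemma Zd_pairwise_coprime_division:
  fixes w :: "nat \<Rightarrow> real^'n" and s :: "nat \<Rightarrow> nat"
  assumes w: "\<And>k. k < l \<Longrightarrow> w k \<in> Zd" and s: "\<And>k. k < l \<Longrightarrow> s k \<noteq> 0"
    and cop: "\<And>j k. j < l \<Longrightarrow> k < l \<Longrightarrow> j \<noteq> k \<Longrightarrow> coprime (s j) (s k)"
    and sum: "(\<Sum>k<l. (1 / real (s k)) *\<^sub>R w k) \<in> Zd" and k: "k < l"
  shows "(1 / real (s k)) *\<^sub>R w k \<in> Zd"
proof -
  define n where "n = (\<Prod>j\<in>{..<l} - {k}. s j)"
  have rest: "(real n / real (s j)) *\<^sub>R w j \<in> Zd" if j: "j \<in> {..<l} - {k}" for j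
  proof -
    have "s j dvd n" unfolding n_def using j by (intro dvd_prodI) auto
    then obtain m where "n = s j * m" by (rule dvdE)
    then have "real n / real (s j) = of_int (int m)" using s[of j] j by simp
    then show ?thesis using w[of j] j by (intro Zd_scale) auto
  qed
  have "(\<Sum>j<l. (real n / real (s j)) *\<^sub>R w j) = real n *\<^sub>R (\<Sum>j<l. (1 / real (s j)) *\<^sub>R w j)"
    by (simp add: scaleR_sum_right)
  also have "\<dots> \<in> Zd" by (intro Zd_scale sum) auto
  finally have "(\<Sum>j<l. (real n / real (s j)) *\<^sub>R w j) \<in> Zd" .
  moreover have "(\<Sum>j<l. (real n / real (s j)) *\<^sub>R w j) = (real n / real (s k)) *\<^sub>R w k + (\<Sum>j\<in>{..<l} - {k}. (real n / real (s j)) *\<^sub>R w j)"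
    using k by (intro sum.remove) auto
  moreover have "(\<Sum>j\<in>{..<l} - {k}. (real n / real (s j)) *\<^sub>R w j) \<in> Zd" by (intro Zd_sum rest)
  ultimately have "(real n / real (s k)) *\<^sub>R w k \<in> Zd"
    using Zd_add_cancel[of "(\<Sum>j\<in>{..<l} - {k}. (real n / real (s j)) *\<^sub>R w j)" "(real n / real (s k)) *\<^sub>R w k"]
    by (simp only: add.commute)
  moreover have "coprime n (s k)" unfolding n_def using cop k by (intro prod_coprime_left) auto
  ultimately show ?thesis using w[OF k] s[OF k] by (intro Zd_coprime_division[of n])
qed

section \<open>The extremal simplex\<close>

text \<open>The edge lengths of \<open>S_d_1\<close> at the origin, with coordinates numbered from
  0. Their reciprocals are the extremal weights of the vertices other than the origin.\<close>

definition sylv_weight :: "nat \<Rightarrow> nat \<Rightarrow> real" where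
  "sylv_weight d k = (if k = d - 1 then 2 * (real (sylv d) - 1) else real (sylv (Suc k)))"

lemma S_d_1_eq_spx:
  "(S_d_1 :: (real^'n) set) = spx 0 CARD('n) (\<lambda>k. sylv_weight CARD('n) k *\<^sub>R unit k)"
proof -
  let ?d = "CARD('n)"
  have d: "0 < ?d" by simp
  have ax: "c *\<^sub>R (axis i 1 :: real^'n) = axis i c" for c and i :: 'n by (simp add: axis_def vec_eq_iff)
  have e1: "{axis (coord_enum i :: 'n) (real (sylv i)) | i. 1 \<le> i \<and> i \<le> ?d - 1} = (\<lambda>k. sylv_weight ?d k *\<^sub>R unit k) ` {..<?d-1}"
  proof (intro equalityI subsetI)
    fix x :: "real^'n" assume "x \<in> {axis (coord_enum i) (real (sylv i)) | i. 1 \<le> i \<and> i \<le> ?d - 1}"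
    then obtain i where "x = axis (coord_enum i) (real (sylv i))" "1 \<le> i" "i \<le> ?d - 1" by blast
    then show "x \<in> (\<lambda>k. sylv_weight ?d k *\<^sub>R unit k) ` {..<?d-1}"
      by (intro image_eqI[of _ _ "i - 1"]) (auto simp: sylv_weight_def unit_def ax idx_def)
  next
    fix x :: "real^'n" assume "x \<in> (\<lambda>k. sylv_weight ?d k *\<^sub>R unit k) ` {..<?d-1}"
    then obtain k where "k < ?d - 1" "x = sylv_weight ?d k *\<^sub>R unit k" by blast
    then show "x \<in> {axis (coord_enum i) (real (sylv i)) | i. 1 \<le> i \<and> i \<le> ?d - 1}"
      by (intro CollectI exI[of _ "Suc k"]) (auto simp: sylv_weight_def unit_def ax idx_def)
  qed
  have e2: "axis (coord_enum ?d :: 'n) (2 * (real (sylv ?d) - 1)) = sylv_weight ?d (?d-1) *\<^sub>R unit (?d-1)"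
    by (simp add: sylv_weight_def unit_def ax idx_def)
  have e3: "{..<?d} = insert (?d-1) {..<?d-1}" using d by auto
  have "{0} \<union> {axis (coord_enum i :: 'n) (real (sylv i)) | i. 1 \<le> i \<and> i \<le> ?d - 1} \<union> {axis (coord_enum ?d) (2 * (real (sylv ?d) - 1))}
     = insert 0 ((\<lambda>k. 0 + sylv_weight ?d k *\<^sub>R unit k) ` {..<?d})"
    unfolding e1 e2 add_0_left by (subst e3) blast
  then show ?thesis unfolding S_d_1_def Let_def spx_def by (simp only:)
qed

lemma sylv_weight_pos: "0 < sylv_weight d k"
  using sylv_ge_2[of d] sylv_ge_2[of "Suc k"] by (simp add: sylv_weight_def)

text \<open>The required map is the inverse of \<open>comb f\<close> followed by a translation; it
  sends \<open>v0\<close> to 0 and carries each direction \<open>f k\<close> to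
  \<open>unit k\<close>.\<close>

lemma unimod_equiv_S_d_1:
  fixes v0 :: "real^'n" and f :: "nat \<Rightarrow> real^'n"
  assumes v0: "v0 \<in> Zd" and f: "\<And>k. k < CARD('n) \<Longrightarrow> f k \<in> Zd" and d: "\<bar>det (matrix (comb f))\<bar> = 1"
  shows "unimod_equiv (spx v0 CARD('n) (\<lambda>k. sylv_weight CARD('n) k *\<^sub>R f k)) S_d_1"
proof -
  let ?d = "CARD('n)" and ?q = "sylv_weight CARD('n)"
  have "det (matrix (comb f)) \<noteq> 0" using d by auto
  then have inj: "inj (comb f)" using det_nz_iff_inj[OF linear_comb, of f] by simp
  then obtain g where g: "linear g" "g \<circ> comb f = id" using linear_injective_left_inverse[OF linear_comb inj] by blast
  then have fg: "comb f \<circ> g = id" using linear_inverse_left[OF linear_comb g(1), of f] by (simp only:)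
  have gf: "g (comb f x) = x" "comb f (g x) = x" for x
    using fun_cong[OF g(2), of x] fun_cong[OF fg, of x] by auto
  have gfk: "g (f k) = unit k" if "k < ?d" for k using gf(1)[of "unit k"] comb_apply_unit[OF that, of f] by simp
  have Z: "comb f ` Zd = Zd" by (rule comb_Zd_bij[OF f d])
  have gZ: "g x \<in> Zd" if "x \<in> Zd" for x
  proof -
    have "x \<in> comb f ` Zd" unfolding Z by (rule that)
    then obtain y where y: "y \<in> Zd" "x = comb f y" by (rule imageE)
    show ?thesis unfolding y(2) gf by (rule y(1))
  qed
  have cZ: "comb f x \<in> Zd" if "x \<in> Zd" for x using imageI[OF that, of "comb f"] unfolding Z .
  let ?\<phi> = "\<lambda>x. g x + (- g v0)"
  have 1: "bij ?\<phi>"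
  proof (rule bij_betwI[of _ _ _ "\<lambda>y. comb f (y + g v0)"])
    show "comb f (?\<phi> x + g v0) = x" for x by (simp add: gf)
    show "?\<phi> (comb f (y + g v0)) = y" for y by (simp add: gf)
  qed auto
  have 2: "?\<phi> ` Zd = Zd"
  proof (intro equalityI subsetI)
    fix y assume "y \<in> ?\<phi> ` Zd"
    then show "y \<in> Zd" using gZ v0 by (auto intro!: Zd_diff)
  next
    fix y :: "real^'n" assume y: "y \<in> Zd"
    have "comb f (y + g v0) \<in> Zd" by (rule cZ[OF Zd_add[OF y gZ[OF v0]]])
    moreover have "y = ?\<phi> (comb f (y + g v0))" by (simp add: gf)
    ultimately show "y \<in> ?\<phi> ` Zd" by blast
  qed
  have 3: "?\<phi> ` spx v0 ?d (\<lambda>k. ?q k *\<^sub>R f k) = S_d_1"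
    unfolding affine_image_spx[OF g(1)] S_d_1_eq_spx linear_cmul[OF g(1)] add.right_inverse
    by (rule spx_cong) (simp add: gfk)
  show ?thesis unfolding unimod_equiv_def
    by (rule exI[of _ g], rule exI[of _ "- g v0"]) (use g(1) 1 2 3 in blast)
qed

lemma (in one_point_simplex) extremal_unimod_equiv:
  assumes k0: "k0 \<in> C" and p: "inj_on p {..<CARD('n)}" "p ` {..<CARD('n)} \<subseteq> C - {k0}" and d3: "CARD('n) \<ge> 2"
    and beta: "\<And>k. k < CARD('n) \<Longrightarrow> \<beta> (p k) = 1 / sylv_weight CARD('n) k"
    and edge: "\<beta> (p (CARD('n) - 1)) *\<^sub>R (p (CARD('n) - 1) - k0) \<in> Zd"
  shows "unimod_equiv (spx k0 CARD('n) (\<lambda>k. p k - k0)) S_d_1"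
proof -
  let ?d = "CARD('n)" and ?q = "sylv_weight CARD('n)" and ?w = "\<lambda>k. p k - k0"
  have pC: "p k \<in> C" "p k \<noteq> k0" if "k < ?d" for k using p that by auto
  have k0Z: "k0 \<in> Zd" using k0 C_Zd by auto
  have wZ: "?w k \<in> Zd" if "k < ?d" for k using pC[OF that] k0Z C_Zd by (auto intro: Zd_diff)
  have img: "p ` {..<?d} = C - {k0}"
  proof (rule card_subset_eq)
    show "card (p ` {..<?d}) = card (C - {k0})" using k0 card_C finite_C p(1) by (simp add: card_image)
  qed (use finite_C p in auto)
  have C: "C = insert k0 (p ` {..<?d})" "k0 \<notin> p ` {..<?d}" using img k0 by auto
  have sums: "sum F C = F k0 + (\<Sum>k<?d. F (p k))" for F :: "real^'n \<Rightarrow> 'z::comm_monoid_add"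
  proof -
    have "sum F C = sum F (insert k0 (p ` {..<?d}))" by (rule arg_cong[OF C(1)])
    also have "\<dots> = F k0 + sum F (p ` {..<?d})" using C(2) by (intro sum.insert) auto
    also have "sum F (p ` {..<?d}) = (\<Sum>k<?d. F (p k))" using sum.reindex[OF p(1), of F] by (simp only: o_def)
    finally show ?thesis .
  qed
  have "(\<Sum>k<?d. \<beta> (p k) *\<^sub>R ?w k) = (\<Sum>v\<in>C. \<beta> v *\<^sub>R v) - k0"
  proof -
    have "\<beta> k0 + (\<Sum>k<?d. \<beta> (p k)) = 1" using sums[of \<beta>] sum1 by simp
    then have "(\<Sum>k<?d. \<beta> (p k)) = 1 - \<beta> k0" by simp
    moreover have "(\<Sum>k<?d. \<beta> (p k) *\<^sub>R ?w k) = (\<Sum>k<?d. \<beta> (p k) *\<^sub>R p k) - (\<Sum>k<?d. \<beta> (p k)) *\<^sub>R k0"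
      by (simp only: scaleR_diff_right sum_subtractf scaleR_sum_left)
    ultimately show ?thesis unfolding sums by (simp add: scaleR_diff_left)
  qed
  then have all: "(\<Sum>k<?d. \<beta> (p k) *\<^sub>R ?w k) \<in> Zd" using centre k0Z by (simp add: Zd_diff)
  \<comment> \<open>The last denominator \<open>2 * (s_d - 1)\<close> is divisible by all earlier
    Sylvester numbers, which would defeat the coprimality argument. Its term is integral by
    \<open>edge\<close> and is removed; the remaining denominators are pairwise coprime.\<close>
  have low: "(\<Sum>k<?d-1. (1 / real (sylv (Suc k))) *\<^sub>R ?w k) \<in> Zd"
  proof -
    have "(\<Sum>k<Suc (?d-1). \<beta> (p k) *\<^sub>R ?w k) = \<beta> (p (?d-1)) *\<^sub>R ?w (?d-1) + (\<Sum>k<?d-1. \<beta> (p k) *\<^sub>R ?w k)"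
      by (subst sum.lessThan_Suc) (rule add.commute)
    moreover have "Suc (?d-1) = ?d" using d3 by simp
    ultimately have split: "(\<Sum>k<?d. \<beta> (p k) *\<^sub>R ?w k) = \<beta> (p (?d-1)) *\<^sub>R ?w (?d-1) + (\<Sum>k<?d-1. \<beta> (p k) *\<^sub>R ?w k)"
      by (simp only:)
    have "(\<Sum>k<?d-1. \<beta> (p k) *\<^sub>R ?w k) \<in> Zd" using Zd_add_cancel[OF all[unfolded split] edge] .
    moreover have "(\<Sum>k<?d-1. \<beta> (p k) *\<^sub>R ?w k) = (\<Sum>k<?d-1. (1 / real (sylv (Suc k))) *\<^sub>R ?w k)"
      by (intro sum.cong) (auto simp: beta sylv_weight_def)
    ultimately show ?thesis by simp
  qed
  define f where "f k = (1 / ?q k) *\<^sub>R ?w k" for k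
  have fZ: "f k \<in> Zd" if k: "k < ?d" for k
  proof (cases "k = ?d - 1")
    case True
    then show ?thesis using edge beta[of k] k by (simp add: f_def)
  next
    case False
    have "(1 / real (sylv (Suc k))) *\<^sub>R ?w k \<in> Zd"
    proof (rule Zd_pairwise_coprime_division[OF _ _ _ low])
      show "?w k \<in> Zd" if "k < ?d - 1" for k using that by (intro wZ) simp
      show "sylv (Suc k) \<noteq> 0" for k using sylv_ge_2[of "Suc k"] by simp
      show "coprime (sylv (Suc j)) (sylv (Suc k))" if "j \<noteq> k" for j k using that by (intro coprime_sylv) auto
      show "k < ?d - 1" using False k by simp
    qed
    then show ?thesis using False by (simp add: f_def sylv_weight_def)
  qed
  have "?q k \<noteq> 0" for k using sylv_weight_pos[of ?d k] by simp
  then have wf: "?w = (\<lambda>k. ?q k *\<^sub>R f k)" by (simp add: f_def)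
  have w: "fam_indep ?d ?w" by (rule fam_indep_edges[OF k0 p])
  obtain z where z: "compl_onb (UNIV :: (real^'n) set) ?d z" using ex_compl_onb[of UNIV] by auto
  have cd: "cdet ?d ?w z = cdet ?d f z * (\<Prod>k<?d. ?q k)" unfolding wf by (rule cdet_scale) simp
  have qpos: "0 < (\<Prod>k<?d. ?q k)" by (intro prod_pos) (simp add: sylv_weight_pos)
  have "(\<Prod>k<?d. \<beta> (p k)) = (\<Prod>k<?d. 1 / ?q k)" by (intro prod.cong) (auto simp: beta)
  also have "\<dots> = 1 / (\<Prod>k<?d. ?q k)" by (simp only: prod_dividef prod.neutral_const)
  finally have prodb: "(\<Prod>k<?d. \<beta> (p k)) = 1 / (\<Prod>k<?d. ?q k)" .
  have vf: "fact ?d * volZ (spx k0 ?d ?w) = \<bar>cdet ?d ?w z\<bar>" by (rule volZ_spx_full[OF w]) (rule wZ)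
  \<comment> \<open>The factors \<open>?q k\<close> contained in the edges cancel against the
    product of the weights, so the volume bound says that the determinant of \<open>f\<close> is at
    most 1 in absolute value. As \<open>f\<close> is integral and independent, it is also at least
    1.\<close>
  have A: "\<bar>cdet ?d ?w z\<bar> * (1 / (\<Prod>k<?d. ?q k)) \<le> 1"
    using volZ_face_bound[OF order_refl k0 p] unfolding vf prodb .
  have "x * \<bar>Q\<bar> * (1 / Q) = x" if "0 < Q" for x Q :: real using that by simp
  from A[unfolded cd abs_mult this[OF qpos]] have le: "\<bar>cdet ?d f z\<bar> \<le> 1" .
  have "cdet ?d ?w z \<noteq> 0" by (rule cdet_nonzero[OF order_refl w _ z]) auto
  then have nz: "cdet ?d f z \<noteq> 0" using cd by auto
  have "\<bar>cdet ?d unit z\<bar> \<le> \<bar>cdet ?d f z\<bar>"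
    by (rule cdet_lattice_le[OF order_refl lattice_basis_unit fZ nz])
  then have "\<bar>det (matrix (comb f))\<bar> = 1" using le unfolding cdet_unit by (simp add: cdet_def comb_fill_full)
  then show ?thesis unfolding wf by (rule unimod_equiv_S_d_1[rotated 2]) (use k0Z fZ in auto)
qed

section \<open>Faces of a simplex and a face attaining the bound\<close>

lemma spx_vertices_independent:
  fixes w :: "nat \<Rightarrow> real^'n"
  assumes w: "fam_indep l w"
  shows "\<not> affine_dependent (insert v ((\<lambda>k. v + w k) ` {..<l}))"
    and "card (insert v ((\<lambda>k. v + w k) ` {..<l})) = Suc l"
proof -
  have inj: "inj_on w {..<l}" and ind: "independent (w ` {..<l})" using w by (auto simp: fam_indep_iff)
  have 0: "0 \<notin> w ` {..<l}" using dependent_zero[of "w ` {..<l}"] ind by (rule_tac notI) simp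
  have v: "v \<notin> (\<lambda>k. v + w k) ` {..<l}"
  proof
    assume "v \<in> (\<lambda>k. v + w k) ` {..<l}"
    then obtain k where "k < l" "v = v + w k" by auto
    then have "w k = 0" by simp
    then show False using 0 \<open>k < l\<close> by force
  qed
  have "(\<lambda>x. - v + x) ` (\<lambda>k. v + w k) ` {..<l} = w ` {..<l}" by (simp add: image_image)
  then show "\<not> affine_dependent (insert v ((\<lambda>k. v + w k) ` {..<l}))"
    using affine_dependent_iff_dependent[OF v] ind by simp
  have "inj_on (\<lambda>k. v + w k) {..<l}" using inj by (auto simp: inj_on_def)
  then show "card (insert v ((\<lambda>k. v + w k) ` {..<l})) = Suc l" using v by (simp add: card_image)
qed

lemma faces_of_dim_simplex:
  fixes C :: "'a::euclidean_space set"
  assumes "\<not> affine_dependent C"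
  shows "faces_of_dim l (convex hull C) = {convex hull I | I. I \<subseteq> C \<and> card I = Suc l}"
proof -
  have dim: "aff_dim (convex hull I) = int (card I) - 1" if "I \<subseteq> C" for I
  proof -
    have "\<not> affine_dependent I" using affine_dependent_subset[OF _ that] assms by blast
    then show ?thesis by (simp add: aff_dim_convex_hull aff_dim_affine_independent)
  qed
  have "aff_dim (convex hull I) = int l \<longleftrightarrow> card I = Suc l" if "I \<subseteq> C" for I using dim[OF that] by linarith
  then show ?thesis unfolding faces_of_dim_def face_of_convex_hull_affine_independent[OF assms] by blast
qed

lemma finite_faces_of_dim_simplex:
  fixes C :: "'a::euclidean_space set"
  assumes "\<not> affine_dependent C"
  shows "finite (faces_of_dim l (convex hull C))"
proof -
  have "finite C" using assms by (rule aff_independent_finite)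
  then have "finite ((\<lambda>I. convex hull I) ` Pow C)" by simp
  moreover have "faces_of_dim l (convex hull C) \<subseteq> (\<lambda>I. convex hull I) ` Pow C"
    unfolding faces_of_dim_simplex[OF assms] by blast
  ultimately show ?thesis by (rule finite_subset[rotated])
qed

lemma unimod_equiv_S_d_1_imp:
  fixes S :: "(real^'n) set"
  assumes "unimod_equiv S S_d_1"
  obtains g v0 f where "linear (g :: real^'n \<Rightarrow> real^'n)" "\<And>x. x \<in> Zd \<Longrightarrow> g x \<in> Zd"
    "\<And>k. k < CARD('n) \<Longrightarrow> f k \<in> Zd" "\<And>k. k < CARD('n) \<Longrightarrow> g (f k) = unit k" "fam_indep CARD('n) f"
    "S = spx v0 CARD('n) (\<lambda>k. sylv_weight CARD('n) k *\<^sub>R f k)"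
proof -
  let ?d = "CARD('n)" and ?q = "sylv_weight CARD('n)"
  obtain g :: "real^'n \<Rightarrow> real^'n" and b where g: "linear g" and bij: "bij (\<lambda>x. g x + b)" and Z: "(\<lambda>x. g x + b) ` Zd = Zd" and S: "(\<lambda>x. g x + b) ` S = S_d_1"
    using assms unfolding unimod_equiv_def by blast
  let ?\<phi> = "\<lambda>x. g x + b"
  have "?\<phi> 0 \<in> Zd" using imageI[OF Zd_0, of ?\<phi>] unfolding Z .
  then have bZ: "b \<in> Zd" by (simp add: linear_0[OF g])
  have gZ: "g x \<in> Zd" if "x \<in> Zd" for x
  proof -
    have "?\<phi> x \<in> Zd" using imageI[OF that, of ?\<phi>] unfolding Z .
    then show ?thesis using Zd_diff[OF _ bZ, of "?\<phi> x"] by simp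
  qed
  \<comment> \<open>The linear part alone maps onto the lattice, because the translation vector
    \<open>b\<close>, the image of 0, is integral.\<close>
  have preim: "\<exists>x\<in>Zd. g x = y" if "y \<in> Zd" for y
  proof -
    have "y + b \<in> ?\<phi> ` Zd" unfolding Z using that bZ by (rule Zd_add)
    then show ?thesis by auto
  qed
  have ex: "\<exists>x. x \<in> Zd \<and> g x = unit k" for k using preim[OF unit_Zd] by blast
  define f where "f k = (SOME x. x \<in> Zd \<and> g x = unit k)" for k
  have f: "f k \<in> Zd" "g (f k) = unit k" for k using someI_ex[OF ex[of k]] unfolding f_def by blast+
  have "0 \<in> ?\<phi> ` Zd" unfolding Z by (rule Zd_0)
  then obtain v0 where v0: "g v0 + b = 0" by force
  have fam: "fam_indep ?d f" unfolding fam_indep_def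
  proof (intro allI impI)
    fix c k assume s: "(\<Sum>k<?d. c k *\<^sub>R f k) = 0" and k: "k < ?d"
    have "(\<Sum>k<?d. c k *\<^sub>R g (f k)) = g (\<Sum>k<?d. c k *\<^sub>R f k)" by (simp add: linear_sum[OF g] linear_cmul[OF g])
    then have "(\<Sum>k<?d. c k *\<^sub>R unit k) = (0 :: real^'n)" by (simp add: s linear_0[OF g] f(2))
    from fam_indepD[OF fam_indep_unit this k] show "c k = 0" .
  qed
  have "?\<phi> ` spx v0 ?d (\<lambda>k. ?q k *\<^sub>R f k) = S_d_1"
    unfolding affine_image_spx[OF g] S_d_1_eq_spx linear_cmul[OF g] v0 f(2) ..
  then have "?\<phi> ` S = ?\<phi> ` spx v0 ?d (\<lambda>k. ?q k *\<^sub>R f k)" using S by (simp only:)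
  then have "S = spx v0 ?d (\<lambda>k. ?q k *\<^sub>R f k)"
    by (rule inj_image_eq_iff[OF bij_is_inj[OF bij], THEN iffD1])
  then show ?thesis using that[OF g gZ f(1) f(2) fam] by simp
qed

lemma prod_sylv_weight:
  assumes "1 \<le> l" "l \<le> d"
  shows "(\<Prod>j<l. sylv_weight d (d - l + j)) = 2 * (real (sylv d) - 1)^2 / (real (sylv (d - l + 1)) - 1)"
proof -
  obtain m where m: "l = Suc m" using assms by (cases l) auto
  have last: "sylv_weight d (d - l + m) = 2 * (real (sylv d) - 1)" using assms m by (simp add: sylv_weight_def)
  have "(\<Prod>j<m. sylv_weight d (d - l + j)) = (\<Prod>j<m. real (sylv (d - l + 1 + j)))"
    using assms m by (intro prod.cong) (auto simp: sylv_weight_def)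
  also have "\<dots> = (\<Prod>i\<in>{d - l + 1..<d}. real (sylv i))"
    using assms m by (intro prod.reindex_bij_witness[of _ "\<lambda>i. i - (d - l + 1)" "\<lambda>j. d - l + 1 + j"]) auto
  finally have "(\<Prod>j<l. sylv_weight d (d - l + j)) = (\<Prod>i\<in>{d - l + 1..<d}. real (sylv i)) * (2 * (real (sylv d) - 1))"
    unfolding m prod.lessThan_Suc using last m by simp
  moreover have "(\<Prod>i\<in>{d - l + 1..<d}. real (sylv i)) * (real (sylv (d - l + 1)) - 1) = real (sylv d) - 1"
    using assms by (intro prod_sylv_real) auto
  moreover have "real (sylv (d - l + 1)) - 1 > 0" using sylv_ge_2[of "d - l + 1"] by simp
  moreover have "P * (2 * s) = 2 * s^2 / t" if "P * t = s" "t > 0" for P s t :: real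
    using that by (auto simp: field_simps power2_eq_square)
  ultimately show ?thesis by (simp only:)
qed

text \<open>The face is spanned by the last \<open>l\<close> edges, those with the largest weights.
  Their directions \<open>b\<close> form a basis of the lattice of the face, so \<open>l!\<close>
  times its volume is the product of these weights.\<close>

lemma S_d_1_face:
  fixes S :: "(real^'n) set"
  assumes eq: "unimod_equiv S S_d_1" and l: "1 \<le> l" "l \<le> CARD('n)"
  shows "\<exists>F\<in>faces_of_dim l S. volZ F
     = 2 * (real (sylv CARD('n)) - 1)^2 / (fact l * (real (sylv (CARD('n) - l + 1)) - 1))"
proof -
  let ?d = "CARD('n)" and ?q = "sylv_weight CARD('n)"
  obtain g v0 f where g: "linear (g :: real^'n \<Rightarrow> real^'n)" "\<And>x. x \<in> Zd \<Longrightarrow> g x \<in> Zd"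
    and f: "\<And>k. k < ?d \<Longrightarrow> f k \<in> Zd" "\<And>k. k < ?d \<Longrightarrow> g (f k) = unit k" "fam_indep ?d f"
    and S: "S = spx v0 ?d (\<lambda>k. ?q k *\<^sub>R f k)"
    using that by (rule unimod_equiv_S_d_1_imp[OF eq])
  have q0: "?q k \<noteq> 0" for k using sylv_weight_pos[of ?d k] by simp
  define s where "s j = ?d - l + j" for j
  have sl: "s j < ?d" if "j < l" for j using that l by (simp add: s_def)
  define b where "b j = f (s j)" for j
  define w where "w j = ?q (s j) *\<^sub>R b j" for j
  have coord: "(\<Sum>j<l. c j *\<^sub>R unit (s j) :: real^'n) $ idx (s i) = c i" if i: "i < l" for c i
  proof -
    have "(\<Sum>j<l. c j *\<^sub>R unit (s j) :: real^'n) $ idx (s i) = (\<Sum>j<l. if j = i then c i else 0)"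
      unfolding sum_component using sl i by (intro sum.cong) (auto simp: unit_def axis_def idx_eq_iff s_def)
    then show ?thesis using i by simp
  qed
  have gsum: "g (\<Sum>j<l. c j *\<^sub>R b j) = (\<Sum>j<l. c j *\<^sub>R unit (s j))" for c
    unfolding linear_sum[OF g(1)] linear_cmul[OF g(1)] b_def by (intro sum.cong) (auto simp: f(2) sl)
  have fb: "fam_indep l b" unfolding fam_indep_def
  proof (intro allI impI)
    fix c k assume s0: "(\<Sum>k<l. c k *\<^sub>R b k) = 0" and k: "k < l"
    have "(\<Sum>j<l. c j *\<^sub>R unit (s j)) = (0 :: real^'n)" using gsum[of c] unfolding s0 linear_0[OF g(1)] by simp
    then show "c k = 0" using coord[OF k, of c] by simp
  qed
  have fw: "fam_indep l w" unfolding fam_indep_def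
  proof (intro allI impI)
    fix c k assume s0: "(\<Sum>k<l. c k *\<^sub>R w k) = 0" and k: "k < l"
    have "(\<Sum>k<l. (c k * ?q (s k)) *\<^sub>R b k) = 0" using s0 by (simp add: w_def)
    from fam_indepD[OF fb this k] show "c k = 0" using q0 by simp
  qed
  have wZ: "w j \<in> Zd" if "j < l" for j
  proof -
    have "?q (s j) \<in> \<int>" unfolding sylv_weight_def by auto
    then show ?thesis unfolding w_def b_def using f(1)[OF sl[OF that]] by (intro Zd_scale)
  qed
  have bspan: "b j \<in> span (w ` {..<l})" if "j < l" for j
  proof -
    have "b j = (1 / ?q (s j)) *\<^sub>R w j" using q0 by (simp add: w_def)
    moreover have "w j \<in> span (w ` {..<l})" using that by (intro span_base) auto
    ultimately show ?thesis by (simp only: span_scale)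
  qed
  have lb: "is_lattice_basis (Zd \<inter> span (w ` {..<l})) l b"
    unfolding is_lattice_basis_iff
  proof (intro conjI fb equalityI subsetI)
    fix x assume x: "x \<in> Zd \<inter> span (w ` {..<l})"
    then obtain c where c: "x = (\<Sum>j<l. c j *\<^sub>R w j)" unfolding span_fam by blast
    have c': "x = (\<Sum>j<l. (c j * ?q (s j)) *\<^sub>R b j)" unfolding c by (simp add: w_def)
    have "g x \<in> Zd" using x g(2) by blast
    \<comment> \<open>Applying \<open>g\<close> turns the coefficients of a lattice point in the
      family \<open>b\<close> into coordinates of an integer vector, hence into integers.\<close>
    then have "(\<Sum>j<l. (c j * ?q (s j)) *\<^sub>R unit (s j)) \<in> (Zd :: (real^'n) set)" unfolding c' gsum .
    then have Zi: "(\<Sum>j<l. (c j * ?q (s j)) *\<^sub>R unit (s j) :: real^'n) $ idx (s i) \<in> \<int>" for i unfolding Zd_def by blast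
    have int: "c j * ?q (s j) \<in> \<int>" if "j < l" for j
      using Zi[of j] unfolding coord[OF that, of "\<lambda>j. c j * ?q (s j)"] .
    have "x = (\<Sum>j<l. of_int \<lfloor>c j * ?q (s j)\<rfloor> *\<^sub>R b j)" unfolding c' using int by (intro sum.cong) auto
    then show "x \<in> {\<Sum>k<l. of_int (z k) *\<^sub>R b k | z. True}" by (intro CollectI exI[of _ "\<lambda>j. \<lfloor>c j * ?q (s j)\<rfloor>"]) simp
  next
    fix x assume "x \<in> {\<Sum>k<l. of_int (z k) *\<^sub>R b k | z. True}"
    then obtain z where x: "x = (\<Sum>k<l. of_int (z k) *\<^sub>R b k)" by blast
    have "x \<in> Zd" unfolding x b_def using f(1) sl by (intro Zd_sum Zd_scale) auto
    moreover have "x \<in> span (w ` {..<l})" unfolding x using bspan by (intro span_sum span_scale) auto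
    ultimately show "x \<in> Zd \<inter> span (w ` {..<l})" by blast
  qed
  obtain z where z: "compl_onb (span (w ` {..<l})) l z" using ex_compl_onb[of "span (w ` {..<l})"] dim_fam[OF fw] by auto
  have cb: "cdet l b z \<noteq> 0" by (rule cdet_nonzero[OF l(2) fb _ z]) (use bspan in auto)
  have "w = (\<lambda>j. ?q (s j) *\<^sub>R b j)" by (rule ext) (simp add: w_def)
  then have cw: "cdet l w z = cdet l b z * (\<Prod>j<l. ?q (s j))" using cdet_scale[OF l(2), of "\<lambda>j. ?q (s j)" b z] by simp
  have "volZ (spx v0 l w) = \<bar>cdet l w z\<bar> / (fact l * \<bar>cdet l b z\<bar>)"
    by (rule volZ_spx[OF l(2) fw _ z lb]) (rule wZ)
  also have "\<dots> = \<bar>\<Prod>j<l. ?q (s j)\<bar> / fact l" unfolding cw abs_mult using cb by simp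
  also have "\<bar>\<Prod>j<l. ?q (s j)\<bar> = (\<Prod>j<l. ?q (s j))" by (intro abs_of_pos prod_pos) (simp add: sylv_weight_pos)
  also have "(\<Prod>j<l. ?q (s j)) = 2 * (real (sylv ?d) - 1)^2 / (real (sylv (?d - l + 1)) - 1)"
    unfolding s_def by (rule prod_sylv_weight[OF l])
  finally have vol: "volZ (spx v0 l w) = 2 * (real (sylv ?d) - 1)^2 / (fact l * (real (sylv (?d - l + 1)) - 1))"
    by (simp add: mult.commute)
  have fW: "fam_indep ?d (\<lambda>k. ?q k *\<^sub>R f k)" unfolding fam_indep_def
  proof (intro allI impI)
    fix c k assume s0: "(\<Sum>k<?d. c k *\<^sub>R ?q k *\<^sub>R f k) = 0" and k: "k < ?d"
    have "(\<Sum>k<?d. (c k * ?q k) *\<^sub>R f k) = 0" using s0 by simp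
    from fam_indepD[OF f(3) this k] show "c k = 0" using q0 by simp
  qed
  let ?C = "insert v0 ((\<lambda>k. v0 + ?q k *\<^sub>R f k) ` {..<?d})" and ?I = "insert v0 ((\<lambda>j. v0 + w j) ` {..<l})"
  have "(\<lambda>j. v0 + w j) ` {..<l} \<subseteq> (\<lambda>k. v0 + ?q k *\<^sub>R f k) ` {..<?d}"
    using sl by (intro image_subsetI) (auto simp: w_def b_def)
  then have "?I \<subseteq> ?C" by blast
  then have "spx v0 l w \<in> faces_of_dim l S"
    unfolding S spx_def faces_of_dim_simplex[OF spx_vertices_independent(1)[OF fW]]
    using spx_vertices_independent(2)[OF fw, of v0] by blast
  with vol show ?thesis by blast
qed

section \<open>Vertices sorted by weight and the bound for every face\<close>

lemma ex_decreasing_enumeration: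
  fixes f :: "'a \<Rightarrow> real"
  assumes "finite C"
  obtains v where "bij_betw v {..<card C} C" "\<And>i j. i \<le> j \<Longrightarrow> j < card C \<Longrightarrow> f (v j) \<le> f (v i)"
proof -
  obtain xs where xs: "set xs = C" "distinct xs" using finite_distinct_list[OF assms] by blast
  define ys where "ys = sort_key (\<lambda>a. - f a) xs"
  have ys: "set ys = C" "distinct ys" "sorted (map (\<lambda>a. - f a) ys)" using xs by (auto simp: ys_def)
  have len: "length ys = card C" using distinct_card[OF ys(2)] ys(1) by simp
  have 1: "bij_betw ((!) ys) {..<card C} C" by (rule bij_betw_nth[OF ys(2)]) (simp_all only: len ys(1))
  have 2: "f (ys ! j) \<le> f (ys ! i)" if "i \<le> j" "j < card C" for i j
    using sorted_nth_mono[OF ys(3) that(1)] that len by simp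
  show ?thesis by (rule that[OF 1]) (rule 2)
qed

text \<open>The two index sets have differences of equal size. The entry at \<open>d - l + 1\<close>
  separates them: entries in the last block only are at most this large, entries in \<open>J\<close>
  only at least.\<close>

lemma prod_last_le:
  fixes x :: "nat \<Rightarrow> real"
  assumes pos: "\<And>i. 1 \<le> i \<Longrightarrow> i \<le> d \<Longrightarrow> 0 < x i"
    and mono: "\<And>i j. 1 \<le> i \<Longrightarrow> i \<le> j \<Longrightarrow> j \<le> d \<Longrightarrow> x j \<le> x i"
    and J: "J \<subseteq> {1..d}" "card J = l" and l: "1 \<le> l" "l \<le> d"
  shows "(\<Prod>i=d-l+1..d. x i) \<le> prod x J"
proof -
  let ?T = "{d-l+1..d}" and ?c = "x (d - l + 1)"
  have fin: "finite J" using J(1) finite_subset by blast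
  have "card (J - ?T) = card J - card (J \<inter> ?T)" by (rule card_Diff_subset_Int) simp
  moreover have "card (?T - J) = card ?T - card (?T \<inter> J)" by (rule card_Diff_subset_Int) simp
  ultimately have card: "card (J - ?T) = card (?T - J)" using J(2) l by (simp add: Int_commute)
  have "prod x (?T - J) \<le> prod (\<lambda>_. ?c) (?T - J)"
  proof (intro prod_mono conjI)
    fix i assume i: "i \<in> ?T - J"
    show "0 \<le> x i" using i by (intro less_imp_le[OF pos]) auto
    show "x i \<le> ?c" using i l by (intro mono) auto
  qed
  also have "\<dots> = prod (\<lambda>_. ?c) (J - ?T)" using card by simp
  also have "\<dots> \<le> prod x (J - ?T)"
  proof (intro prod_mono conjI)
    fix i assume i: "i \<in> J - ?T"
    then have "1 \<le> i" "i \<le> d - l + 1" using J(1) by auto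
    then show "?c \<le> x i" using l by (intro mono) auto
    show "0 \<le> ?c" using l by (intro less_imp_le[OF pos]) auto
  qed
  finally have le: "prod x (?T - J) \<le> prod x (J - ?T)" .
  have "0 \<le> prod x (?T \<inter> J)" by (intro prod_nonneg ballI less_imp_le[OF pos]) auto
  then have "prod x (?T \<inter> J) * prod x (?T - J) \<le> prod x (?T \<inter> J) * prod x (J - ?T)" using le by (rule mult_left_mono[rotated])
  moreover have "prod x ?T = prod x (?T \<inter> J) * prod x (?T - J)"
    using prod.Int_Diff[of ?T x J] by simp
  moreover have "prod x J = prod x (?T \<inter> J) * prod x (J - ?T)"
    using prod.Int_Diff[OF fin, of x ?T] by (simp add: Int_commute)
  ultimately show ?thesis by simp
qed

lemma quotient_bound:
  fixes V P B F :: real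
  assumes F: "0 < F" and B: "0 < B" and le: "F * V * P \<le> 1" "1 / B \<le> P"
  shows "V \<le> B / F" and "V = B / F \<Longrightarrow> P = 1 / B"
proof -
  have "0 < 1 / B" using B by simp
  then have P: "0 < P" using le(2) by (rule less_le_trans)
  have "F * V \<le> 1 / P" using le(1) P by (simp add: pos_le_divide_eq)
  also have "1 / P \<le> B" using le(2) B P by (simp add: pos_divide_le_eq mult.commute)
  finally show "V \<le> B / F" using F by (simp add: pos_le_divide_eq mult.commute)
  assume "V = B / F"
  then have "B * P \<le> 1" using le(1) F by simp
  then have "P \<le> 1 / B" using B by (simp add: pos_le_divide_eq mult.commute)
  then show "P = 1 / B" using le(2) by (rule antisym)
qed

text \<open>The claimed bound times \<open>l!\<close>; its reciprocal is the lower bound of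
  \<open>prod_ge\<close> for \<open>k = d - l + 1\<close>.\<close>

definition vol_bound :: "nat \<Rightarrow> nat \<Rightarrow> real" where
  "vol_bound d l = 2 * (real (sylv d) - 1)^2 / (real (sylv (d - l + 1)) - 1)"

lemma vol_bound_pos: "0 < vol_bound d l"
  unfolding vol_bound_def using sylv_ge_2[of d] sylv_ge_2[of "d - l + 1"] by simp

locale sorted_one_point_simplex = one_point_simplex C \<beta> for C :: "(real^'n) set" and \<beta> +
  fixes v :: "nat \<Rightarrow> real^'n"
  assumes bij_v: "bij_betw v {..<Suc CARD('n)} C"
    and decr: "\<And>i j. i \<le> j \<Longrightarrow> j \<le> CARD('n) \<Longrightarrow> \<beta> (v j) \<le> \<beta> (v i)"
    and dim3: "CARD('n) \<ge> 3"
begin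

text \<open>\<open>v\<close> counts from 0 and \<open>product_sum_sequence\<close> from 1, so index
  sets of vertices are shifted by \<open>Suc\<close>.\<close>

definition x :: "nat \<Rightarrow> real" where "x i = \<beta> (v (i - 1))"

lemma inj_v: "inj_on v {..<Suc CARD('n)}" and img_v: "v ` {..<Suc CARD('n)} = C"
  using bij_v by (auto simp: bij_betw_def)

lemma v_mem: "k \<le> CARD('n) \<Longrightarrow> v k \<in> C" unfolding img_v[symmetric] by simp

lemma v_inj: "i \<le> CARD('n) \<Longrightarrow> j \<le> CARD('n) \<Longrightarrow> v i = v j \<longleftrightarrow> i = j"
  using inj_on_eq_iff[OF inj_v, of i j] by simp

lemma prod_x: "K \<subseteq> {..<Suc CARD('n)} \<Longrightarrow> prod x (Suc ` K) = prod \<beta> (v ` K)"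
proof -
  assume K: "K \<subseteq> {..<Suc CARD('n)}"
  have "prod x (Suc ` K) = (\<Prod>k\<in>K. \<beta> (v k))" by (subst prod.reindex) (auto simp: x_def)
  also have "\<dots> = prod \<beta> (v ` K)" using inj_on_subset[OF inj_v K] by (simp add: prod.reindex)
  finally show ?thesis .
qed

lemma sum_x: "K \<subseteq> {..<Suc CARD('n)} \<Longrightarrow> sum x (Suc ` K) = sum \<beta> (v ` K)"
proof -
  assume K: "K \<subseteq> {..<Suc CARD('n)}"
  have "sum x (Suc ` K) = (\<Sum>k\<in>K. \<beta> (v k))" by (subst sum.reindex) (auto simp: x_def)
  also have "\<dots> = sum \<beta> (v ` K)" using inj_on_subset[OF inj_v K] by (simp add: sum.reindex)
  finally show ?thesis .
qed

sublocale seq: product_sum_sequence x "CARD('n)"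
proof
  show "1 \<le> CARD('n)" using dim3 by simp
  show "0 < x i" if "1 \<le> i" "i \<le> Suc CARD('n)" for i unfolding x_def using that by (intro pos v_mem) simp
  show "x j \<le> x i" if "1 \<le> i" "i \<le> j" "j \<le> Suc CARD('n)" for i j unfolding x_def using that by (intro decr) auto
  have e: "{1..Suc CARD('n)} = Suc ` {..<Suc CARD('n)}" by (simp only: image_Suc_lessThan)
  show "(\<Sum>i=1..Suc CARD('n). x i) = 1" unfolding e sum_x[OF order_refl] img_v by (rule sum1)
  show "(\<Prod>i=1..j. x i) \<le> (\<Sum>i=Suc j..Suc CARD('n). x i)" if j: "1 \<le> j" "j \<le> CARD('n)" for j
  proof -
    have sub: "{..<j} \<subseteq> {..<Suc CARD('n)}" "{j..<Suc CARD('n)} \<subseteq> {..<Suc CARD('n)}" using j by auto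
    have e1: "{1..j} = Suc ` {..<j}" by (simp only: image_Suc_lessThan)
    have p: "(\<Prod>i=1..j. x i) = prod \<beta> (v ` {..<j})" unfolding e1 by (rule prod_x[OF sub(1)])
    have e2: "{Suc j..Suc CARD('n)} = Suc ` {j..<Suc CARD('n)}"
      by (simp only: image_Suc_atLeastAtMost atLeastLessThanSuc_atLeastAtMost)
    have s: "(\<Sum>i=Suc j..Suc CARD('n). x i) = sum \<beta> (v ` {j..<Suc CARD('n)})"
      unfolding e2 by (rule sum_x[OF sub(2)])
    have "{..<Suc CARD('n)} - {..<j} = {j..<Suc CARD('n)}" by auto
    then have "v ` {j..<Suc CARD('n)} = C - v ` {..<j}"
      using inj_on_image_set_diff[OF inj_v Diff_subset sub(1)] unfolding img_v by (simp only:)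
    moreover have "prod \<beta> (v ` {..<j}) \<le> sum \<beta> (C - v ` {..<j})"
    proof (rule product_sum)
      show "v ` {..<j} \<subseteq> C" using image_mono[OF sub(1), of v] unfolding img_v .
      have "v CARD('n) \<notin> v ` {..<j}"
      proof
        assume "v CARD('n) \<in> v ` {..<j}"
        then obtain i where "i < j" "v CARD('n) = v i" by auto
        then show False using v_inj[of "CARD('n)" i] j by simp
      qed
      moreover have "v CARD('n) \<in> C" by (rule v_mem) simp
      ultimately show "v ` {..<j} \<noteq> C" by blast
    qed
    ultimately show ?thesis unfolding p s by (simp only:)
  qed
qed

lemma hull_eq_spx:
  assumes K: "k0 \<in> K" and r: "r ` {..<l} = K - {k0}"
  shows "convex hull (v ` K) = spx (v k0) l (\<lambda>j. v (r j) - v k0)"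
proof -
  have e1: "(\<lambda>j. v k0 + (v (r j) - v k0)) ` {..<l} = v ` (K - {k0})"
  proof -
    have "v k0 + (v (r j) - v k0) = v (r j)" for j by simp
    then show ?thesis unfolding r[symmetric] image_image by (simp only:)
  qed
  have e2: "insert (v k0) (v ` (K - {k0})) = v ` K" by (simp only: image_insert[symmetric] insert_Diff[OF K])
  show ?thesis unfolding spx_def e1 e2 ..
qed

lemma sub_edges:
  assumes K: "K \<subseteq> {..<Suc CARD('n)}" "k0 \<in> K" and r: "bij_betw r {..<l} (K - {k0})"
  shows "inj_on (\<lambda>j. v (r j)) {..<l}" "(\<lambda>j. v (r j)) ` {..<l} \<subseteq> C - {v k0}"
proof -
  have rK: "r ` {..<l} = K - {k0}" "inj_on r {..<l}" using r by (auto simp: bij_betw_def)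
  have "inj_on v (r ` {..<l})" using rK(1) K by (intro inj_on_subset[OF inj_v]) auto
  from comp_inj_on[OF rK(2) this] show "inj_on (\<lambda>j. v (r j)) {..<l}" by (simp add: o_def)
  show "(\<lambda>j. v (r j)) ` {..<l} \<subseteq> C - {v k0}"
  proof (rule image_subsetI)
    fix j assume "j \<in> {..<l}"
    then have "r j \<in> K - {k0}" using rK(1) by blast
    then have rj: "r j \<le> CARD('n)" "r j \<noteq> k0" "k0 \<le> CARD('n)" using K by auto
    then show "v (r j) \<in> C - {v k0}" using v_mem[OF rj(1)] v_inj[OF rj(1,3)] by simp
  qed
qed


text \<open>The base vertex is the one of largest index and hence least weight in the face. The
  other indices are then below \<open>d\<close>, so \<open>x (d + 1)\<close> never enters the
  product and \<open>prod_last_le\<close> applies.\<close>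

lemma index_face_bound:
  assumes K: "K \<subseteq> {..<Suc CARD('n)}" "card K = Suc l" and l: "1 \<le> l" "l \<le> CARD('n)"
  shows "fact l * volZ (convex hull (v ` K)) * prod x (Suc ` (K - {Max K})) \<le> 1"
    and "1 / vol_bound CARD('n) l \<le> prod x (Suc ` (K - {Max K}))"
proof -
  let ?k0 = "Max K"
  have fin: "finite K" using K(1) finite_subset by blast
  have "K \<noteq> {}" using K(2) by auto
  then have k0: "?k0 \<in> K" using fin by simp
  have "card {..<l} = card (K - {?k0})" using K(2) fin k0 by simp
  then obtain r where r: "bij_betw r {..<l} (K - {?k0})" using finite_same_card_bij[of "{..<l}" "K - {?k0}"] fin by auto
  have r': "r ` {..<l} = K - {?k0}" "inj_on r {..<l}" using r by (auto simp: bij_betw_def)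
  have kC: "v ?k0 \<in> C" using k0 K(1) by (intro v_mem) auto
  have "(\<Prod>j<l. \<beta> (v (r j))) = (\<Prod>k\<in>K - {?k0}. \<beta> (v k))" using prod.reindex_bij_betw[OF r, of "\<lambda>k. \<beta> (v k)"] .
  also have "\<dots> = prod x (Suc ` (K - {?k0}))" by (subst prod.reindex) (auto simp: x_def)
  finally have P: "(\<Prod>j<l. \<beta> (v (r j))) = prod x (Suc ` (K - {?k0}))" .
  show "fact l * volZ (convex hull (v ` K)) * prod x (Suc ` (K - {?k0})) \<le> 1"
    using volZ_face_bound[OF l(2) kC sub_edges[OF K(1) k0 r]] unfolding P hull_eq_spx[OF k0 r'(1)] .
  have "(\<Prod>i=CARD('n)-l+1..CARD('n). x i) \<le> prod x (Suc ` (K - {?k0}))"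
  proof (rule prod_last_le)
    show "Suc ` (K - {?k0}) \<subseteq> {1..CARD('n)}"
    proof (rule image_subsetI)
      fix k assume k: "k \<in> K - {?k0}"
      then have "k \<le> ?k0" "k \<noteq> ?k0" using Max_ge[OF fin, of k] by auto
      moreover have "?k0 \<le> CARD('n)" using k0 K(1) by auto
      ultimately show "Suc k \<in> {1..CARD('n)}" by auto
    qed
    show "card (Suc ` (K - {?k0})) = l" using K(2) fin k0 by (simp add: card_image)
  qed (use l seq.pos seq.mono in auto)
  moreover have "(real (sylv (CARD('n) - l + 1)) - 1) / (2 * (real (sylv CARD('n)) - 1)^2) \<le> (\<Prod>i=CARD('n)-l+1..CARD('n). x i)"
    using l dim3 by (intro seq.prod_ge) auto
  ultimately show "1 / vol_bound CARD('n) l \<le> prod x (Suc ` (K - {?k0}))" unfolding vol_bound_def by simp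
qed


lemma index_volZ_le:
  assumes K: "K \<subseteq> {..<Suc CARD('n)}" "card K = Suc l" and l: "1 \<le> l" "l \<le> CARD('n)"
  shows "volZ (convex hull (v ` K)) \<le> vol_bound CARD('n) l / fact l"
    and "volZ (convex hull (v ` K)) = vol_bound CARD('n) l / fact l \<Longrightarrow> prod x (Suc ` (K - {Max K})) = 1 / vol_bound CARD('n) l"
proof -
  let ?V = "volZ (convex hull (v ` K))" and ?P = "prod x (Suc ` (K - {Max K}))"
  note b = index_face_bound[OF K l]
  have B: "0 < vol_bound CARD('n) l" by (rule vol_bound_pos)
  have f: "(0::real) < fact l" by simp
  show "?V \<le> vol_bound CARD('n) l / fact l"
    by (rule quotient_bound(1)[OF f B b])
  show "?P = 1 / vol_bound CARD('n) l" if "?V = vol_bound CARD('n) l / fact l"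
    by (rule quotient_bound(2)[OF f B b that])
qed


lemma faces_index:
  assumes "F \<in> faces_of_dim l (convex hull C)"
  obtains K where "K \<subseteq> {..<Suc CARD('n)}" "card K = Suc l" "F = convex hull (v ` K)"
proof -
  obtain I where I: "I \<subseteq> C" "card I = Suc l" "F = convex hull I" using assms unfolding faces_of_dim_simplex[OF indep] by blast
  have "I \<subseteq> v ` {..<Suc CARD('n)}" unfolding img_v by (rule I(1))
  then obtain K where K: "K \<subseteq> {..<Suc CARD('n)}" "I = v ` K" unfolding subset_image_iff by blast
  have "card K = Suc l" using I(2) card_image[OF inj_on_subset[OF inj_v K(1)]] unfolding K(2) by simp
  moreover have "F = convex hull (v ` K)" using I(3) unfolding K(2) .
  ultimately show ?thesis by (rule that[OF K(1)])
qed

section \<open>The equality cases\<close>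

lemma extremal_beta:
  assumes "prod x {k..CARD('n)} = (real (sylv k) - 1) / (2 * (real (sylv CARD('n)) - 1)^2)" "k = CARD('n) \<or> k = 1 \<and> 4 \<le> CARD('n)"
  shows "\<And>k. k < CARD('n) \<Longrightarrow> \<beta> (v k) = 1 / sylv_weight CARD('n) k" "\<beta> (v (CARD('n) - 1)) = \<beta> (v CARD('n))"
proof -
  have 1: "seq.R (CARD('n) - 1) = seq.r (CARD('n) - 1)" by (rule seq.prod_eq_imp(1)[OF assms(2,1)])
  have 2: "x CARD('n) = seq.R (CARD('n) - 1) / 2" by (rule seq.prod_eq_imp(2)[OF assms(2,1)])
  have xd: "x CARD('n) = 1 / (2 * (real (sylv CARD('n)) - 1))" "x (Suc CARD('n)) = 1 / (2 * (real (sylv CARD('n)) - 1))"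
    by (rule seq.extremal(2)[OF 1 2], rule seq.extremal(3)[OF 1 2])
  show "\<beta> (v k) = 1 / sylv_weight CARD('n) k" if k: "k < CARD('n)" for k
  proof (cases "k = CARD('n) - 1")
    case True
    then show ?thesis using xd(1) by (simp add: x_def sylv_weight_def)
  next
    case False
    then have "x (Suc k) = 1 / real (sylv (Suc k))" using k by (intro seq.extremal(1)[OF 1 2]) auto
    then show ?thesis using False by (simp add: x_def sylv_weight_def)
  qed
  show "\<beta> (v (CARD('n) - 1)) = \<beta> (v CARD('n))" using xd by (simp add: x_def)
qed


lemma bij_id_minus: "bij_betw (\<lambda>k. k) {..<CARD('n)} ({..<Suc CARD('n)} - {CARD('n)})"
  by (rule bij_betwI[of _ _ _ "\<lambda>k. k"]) auto

lemma hull_C_spx: "convex hull C = spx (v CARD('n)) CARD('n) (\<lambda>k. v k - v CARD('n))"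
proof -
  have "(\<lambda>k. k) ` {..<CARD('n)} = {..<Suc CARD('n)} - {CARD('n)}" by auto
  from hull_eq_spx[OF _ this] show ?thesis by (simp add: img_v)
qed

lemma all_edges: "inj_on v {..<CARD('n)}" "v ` {..<CARD('n)} \<subseteq> C - {v CARD('n)}"
  using sub_edges[OF order_refl _ bij_id_minus] by simp_all

text \<open>Equality of the volume forces equality in both estimates behind it: the product of the
  weights is minimal, which makes the weights extremal, and volume times product is 1, which is the
  hypothesis of \<open>maximal_volume_edge\<close>. The last two weights agree, as that lemma
  requires.\<close>

lemma extremal_full:
  assumes d4: "4 \<le> CARD('n)" and eq: "volZ (convex hull C) = vol_bound CARD('n) CARD('n) / fact CARD('n)"
  shows "unimod_equiv (convex hull C) S_d_1"
proof -
  have M: "Max {..<Suc CARD('n)} = CARD('n)" by (rule Max_eqI) auto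
  have "{..<Suc CARD('n)} - {CARD('n)} = {..<CARD('n)}" by auto
  then have S: "Suc ` ({..<Suc CARD('n)} - {Max {..<Suc CARD('n)}}) = {1..CARD('n)}" unfolding M by (simp add: image_Suc_lessThan)
  have P: "prod x {1..CARD('n)} = 1 / vol_bound CARD('n) CARD('n)"
    using index_volZ_le(2)[of "{..<Suc CARD('n)}" "CARD('n)"] eq dim3 unfolding S img_v by simp
  also have "\<dots> = (real (sylv 1) - 1) / (2 * (real (sylv CARD('n)) - 1)^2)" by (simp add: vol_bound_def)
  finally have P': "prod x {1..CARD('n)} = (real (sylv 1) - 1) / (2 * (real (sylv CARD('n)) - 1)^2)" .
  note ex = extremal_beta[OF P' disjI2[OF conjI[OF refl d4]]]
  have vd: "v CARD('n) \<in> C" by (rule v_mem) simp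
  have "fact CARD('n) * volZ (spx (v CARD('n)) CARD('n) (\<lambda>k. v k - v CARD('n))) * (\<Prod>k<CARD('n). \<beta> (v k)) = 1"
  proof -
    have "(\<Prod>k<CARD('n). \<beta> (v k)) = prod x (Suc ` {..<CARD('n)})" by (subst prod.reindex) (auto simp: x_def)
    also have "\<dots> = 1 / vol_bound CARD('n) CARD('n)" unfolding image_Suc_lessThan P[symmetric] by simp
    finally show ?thesis using eq vol_bound_pos[of "CARD('n)" "CARD('n)"] unfolding hull_C_spx by simp
  qed
  then have "\<beta> (v (CARD('n) - 1)) *\<^sub>R (v (CARD('n) - 1) - v CARD('n)) \<in> Zd"
    using ex(2) dim3 by (intro maximal_volume_edge[OF vd all_edges]) auto
  then show ?thesis unfolding hull_C_spx
    using dim3 ex(1) by (intro extremal_unimod_equiv[OF vd all_edges]) auto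
qed


text \<open>Equality gives the endpoint of smaller index the weight
  \<open>1 / (2 * (s_d - 1))\<close>, the lower bound for \<open>x d\<close>. By monotonicity
  \<open>x d\<close> has this value as well, so all weights are extremal; the length of the edge
  yields the divisibility.\<close>

lemma extremal_edge:
  assumes K: "K \<subseteq> {..<Suc CARD('n)}" "card K = 2" and eq: "volZ (convex hull (v ` K)) = vol_bound CARD('n) 1"
  shows "unimod_equiv (convex hull C) S_d_1"
proof -
  have K2: "card K = Suc 1" using K(2) by simp
  have fin: "finite K" using K(1) finite_subset by blast
  have Kne: "K \<noteq> {}" using K(2) by auto
  then have k0: "Max K \<in> K" using fin by simp
  have "card (K - {Max K}) = 1" using K(2) fin k0 by simp
  then obtain i where i: "K - {Max K} = {i}" by (auto simp: card_1_singleton_iff)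
  then have iK: "i \<in> K" "i \<noteq> Max K" by auto
  then have iM: "i < Max K" using Max_ge[OF fin iK(1)] by simp
  have Md: "Max K \<le> CARD('n)" using k0 K(1) by auto
  have vb: "vol_bound CARD('n) 1 = 2 * (real (sylv CARD('n)) - 1)"
    using dim3 sylv_ge_2[of "CARD('n)"] by (simp add: vol_bound_def power2_eq_square)
  have q: "sylv_weight CARD('n) (CARD('n) - 1) = 2 * (real (sylv CARD('n)) - 1)" by (simp add: sylv_weight_def)
  have xi: "x (Suc i) = 1 / vol_bound CARD('n) 1"
    using index_volZ_le(2)[OF K(1) K2] eq dim3 i by simp
  have "x CARD('n) \<le> x (Suc i)" using iM Md by (intro seq.mono) auto
  moreover have "(real (sylv CARD('n)) - 1) / (2 * (real (sylv CARD('n)) - 1)^2) \<le> x CARD('n)"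
    using seq.prod_ge[of "CARD('n)"] dim3 by simp
  moreover have e: "(real (sylv CARD('n)) - 1) / (2 * (real (sylv CARD('n)) - 1)^2) = 1 / vol_bound CARD('n) 1"
    unfolding vb using sylv_ge_2[of "CARD('n)"] by (simp add: power2_eq_square)
  ultimately have "prod x {CARD('n)..CARD('n)} = (real (sylv CARD('n)) - 1) / (2 * (real (sylv CARD('n)) - 1)^2)" using xi by simp
  note ex = extremal_beta[OF this disjI1[OF refl]]
  \<comment> \<open>At an earlier position the weight is \<open>1 / s_(i+1)\<close>, and
    \<open>s_(i+1) \<le> s_d < 2 * (s_d - 1)\<close>, where the last step uses
    \<open>s_d > 2\<close>.\<close>
  have id: "i = CARD('n) - 1"
  proof (rule ccontr)
    assume ne: "i \<noteq> CARD('n) - 1"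
    then have i': "Suc i < CARD('n)" using iM Md by simp
    have "\<beta> (v i) = 1 / real (sylv (Suc i))" using ex(1)[of i] i' ne by (simp add: sylv_weight_def)
    then have "1 / real (sylv (Suc i)) = 1 / (2 * (real (sylv CARD('n)) - 1))" using xi unfolding vb by (simp add: x_def)
    then have "real (sylv (Suc i)) = 2 * (real (sylv CARD('n)) - 1)" by (simp add: field_simps)
    moreover have "real (sylv (Suc i)) \<le> real (sylv CARD('n)) " using sylv_mono[of "Suc i" "CARD('n)"] i' by simp
    moreover have "b \<le> 2" if "a = 2 * (b - 1)" "a \<le> b" for a b :: real using that by (simp add: right_diff_distrib)
    ultimately have "real (sylv CARD('n)) \<le> 2" by blast
    moreover have "real (sylv 2) \<le> real (sylv CARD('n))" using sylv_mono[of 2 "CARD('n)"] dim3 by simp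
    ultimately show False by (simp add: sylv_2)
  qed
  have Kd: "Max K = CARD('n)" using iM Md id by simp
  define W where "W = v (CARD('n) - 1) - v CARD('n)"
  let ?w = "\<lambda>_::nat. W"
  have vd: "v CARD('n) \<in> C" "v (CARD('n) - 1) \<in> C" by (rule v_mem, simp)+
  have ne: "v (CARD('n) - 1) \<noteq> v CARD('n)" using v_inj[of "CARD('n) - 1" "CARD('n)"] dim3 by simp
  have "convex hull (v ` K) = spx (v (Max K)) 1 (\<lambda>j. v ((\<lambda>_. CARD('n) - 1) j) - v (Max K))"
    by (rule hull_eq_spx[OF k0]) (use i id in auto)
  then have hull: "convex hull (v ` K) = spx (v CARD('n)) 1 ?w" unfolding Kd W_def .
  have vol: "volZ (spx (v CARD('n)) 1 ?w) = 2 * (real (sylv CARD('n)) - 1)" using eq unfolding hull vb .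
  have w: "fam_indep 1 ?w" unfolding W_def
  proof (rule fam_indep_edges[OF vd(1)])
    show "inj_on (\<lambda>_::nat. v (CARD('n) - 1)) {..<1}" by (rule inj_onI) simp
    show "(\<lambda>_::nat. v (CARD('n) - 1)) ` {..<1} \<subseteq> C - {v CARD('n)}"
      by (rule image_subsetI) (use vd(2) ne in auto)
  qed
  have WZ: "W \<in> Zd" unfolding W_def using vd C_Zd by (auto intro: Zd_diff)
  have one: "1 \<le> CARD('n)" using dim3 by simp
  obtain b where b: "is_lattice_basis (Zd \<inter> span (?w ` {..<1})) 1 b" using ex_lattice_basis[OF WZ w] by blast
  obtain z where z: "compl_onb (span (?w ` {..<1})) 1 z" using ex_compl_onb[of "span (?w ` {..<1})"] dim_fam[OF w] by auto
  have bm: "b k \<in> Zd" "b k \<in> span (?w ` {..<1})" if "k < 1" for k using lattice_basis_mem[OF b that] by auto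
  have L: "Zd \<inter> span (?w ` {..<1}) = {\<Sum>k<1. of_int (z k) *\<^sub>R b k | z. True}" and fb: "fam_indep 1 b"
    using b unfolding is_lattice_basis_iff by blast+
  have "W \<in> Zd \<inter> span (?w ` {..<1})" using WZ by (auto intro!: span_base)
  then obtain n where "W = (\<Sum>k<1. of_int (n k) *\<^sub>R b k)" unfolding L by blast
  then have n: "W = of_int (n 0) *\<^sub>R b 0" by simp
  have cb: "cdet 1 b z \<noteq> 0" by (rule cdet_nonzero[OF one fb _ z]) (use bm in auto)
  have "fill 1 ?w z = fill 1 (\<lambda>k. of_int (n 0) *\<^sub>R b k) z"
    by (rule ext) (simp add: fill_def n)
  then have "cdet 1 ?w z = cdet 1 (\<lambda>k. of_int (n 0) *\<^sub>R b k) z" unfolding cdet_def by (simp only:)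
  also have "\<dots> = cdet 1 b z * of_int (n 0)" using cdet_scale[OF one, of "\<lambda>_. of_int (n 0)" b z] by simp
  finally have cw: "cdet 1 ?w z = cdet 1 b z * of_int (n 0)" .
  \<comment> \<open>The lattice on the line of the edge is generated by \<open>b 0\<close>, so the
    normalized volume is the multiplier \<open>\<bar>n 0\<bar>\<close>.\<close>
  have "volZ (spx (v CARD('n)) 1 ?w) = \<bar>cdet 1 ?w z\<bar> / (fact 1 * \<bar>cdet 1 b z\<bar>)"
    by (rule volZ_spx[OF one w _ z b]) (rule WZ)
  also have "\<dots> = \<bar>of_int (n 0)\<bar>" unfolding cw abs_mult using cb by simp
  finally have nq: "\<bar>of_int (n 0)\<bar> = 2 * (real (sylv CARD('n)) - 1)" unfolding vol by simp
  define Q where "Q = 2 * (real (sylv CARD('n)) - 1)"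
  have Qp: "0 < Q" using sylv_ge_2[of "CARD('n)"] by (simp add: Q_def)
  have "\<beta> (v (CARD('n) - 1)) = 1 / Q" using ex(1)[of "CARD('n) - 1"] dim3 unfolding q Q_def by simp
  then have "\<beta> (v (CARD('n) - 1)) *\<^sub>R (v (CARD('n) - 1) - v CARD('n)) = (of_int (n 0) / Q) *\<^sub>R b 0"
    unfolding W_def[symmetric] n by simp
  moreover have "of_int (n 0) / Q = 1 \<or> of_int (n 0) / Q = - 1" using nq Qp unfolding Q_def[symmetric] by (auto simp: abs_if split: if_splits)
  ultimately have "\<beta> (v (CARD('n) - 1)) *\<^sub>R (v (CARD('n) - 1) - v CARD('n)) \<in> Zd" using bm(1)[of 0] Zd_uminus by auto
  then show ?thesis unfolding hull_C_spx
    using dim3 ex(1) by (intro extremal_unimod_equiv[OF vd(1) all_edges]) auto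
qed

text \<open>In full dimension \<open>volZ\<close> and Lebesgue measure are both
  \<open>\<bar>cdet\<bar> / d!\<close>, so the bound for \<open>l = d\<close> carries over.\<close>

lemma lebesgue_bound: "measure lebesgue (convex hull C) \<le> vol_bound CARD('n) CARD('n) / fact CARD('n)"
proof -
  have w: "fam_indep CARD('n) (\<lambda>k. v k - v CARD('n))" using fam_indep_edges[OF v_mem[of "CARD('n)"] all_edges] by simp
  have wZ: "v k - v CARD('n) \<in> Zd" if "k < CARD('n)" for k using v_mem[of k] v_mem[of "CARD('n)"] that C_Zd by (auto intro: Zd_diff)
  have "fact CARD('n) * volZ (convex hull C) = \<bar>cdet CARD('n) (\<lambda>k. v k - v CARD('n)) (\<lambda>_. 0)\<bar>"
    unfolding hull_C_spx by (rule volZ_spx_full[OF w]) (rule wZ)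
  then have "measure lebesgue (convex hull C) = fact CARD('n) * volZ (convex hull C) / fact CARD('n)"
    using measure_spx_full[OF w, of "v CARD('n)" "\<lambda>_. 0"] unfolding hull_C_spx by (simp only:)
  also have "\<dots> = volZ (convex hull C)" by simp
  also have "\<dots> \<le> vol_bound CARD('n) CARD('n) / fact CARD('n)"
    using index_volZ_le(1)[of "{..<Suc CARD('n)}" "CARD('n)"] dim3 unfolding img_v by simp
  finally show ?thesis .
qed

end

theorem mainTheorem2:
  fixes S :: "(real^'n) set" and l :: nat
  assumes "CARD('n) \<ge> 3" and "S \<in> lattice_simplices_one" and "1 \<le> l" and "l \<le> CARD('n)"
  shows "Max (volZ ` faces_of_dim l S)
           \<le> 2 * (real (sylv CARD('n)) - 1)^2 / (fact l * (real (sylv (CARD('n) - l + 1)) - 1))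
    \<and> (unimod_equiv S S_d_1 \<longrightarrow> Max (volZ ` faces_of_dim l S)
           = 2 * (real (sylv CARD('n)) - 1)^2 / (fact l * (real (sylv (CARD('n) - l + 1)) - 1)))
    \<and> (CARD('n) \<ge> 4 \<and> (l = 1 \<or> l = CARD('n)) \<longrightarrow>
           (Max (volZ ` faces_of_dim l S)
              = 2 * (real (sylv CARD('n)) - 1)^2 / (fact l * (real (sylv (CARD('n) - l + 1)) - 1))
            \<longleftrightarrow> unimod_equiv S S_d_1))
    \<and> measure lebesgue S \<le> 2 / fact CARD('n) * (real (sylv CARD('n)) - 1)^2"
proof -
  let ?d = "CARD('n)"
  obtain C \<beta> where S: "S = convex hull C" and "one_point_simplex C \<beta>"
    using one_point_simplex_exists[OF assms(2)] by blast
  then interpret one_point_simplex C \<beta> by simp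
  obtain v where v: "bij_betw v {..<card C} C" "\<And>i j. i \<le> j \<Longrightarrow> j < card C \<Longrightarrow> \<beta> (v j) \<le> \<beta> (v i)"
    using ex_decreasing_enumeration[OF finite_C, of \<beta>] by blast
  interpret sorted_one_point_simplex C \<beta> v
    by unfold_locales (use v assms(1) card_C in auto)
  let ?F = "volZ ` faces_of_dim l S"
  have bound_eq: "2 * (real (sylv ?d) - 1)^2 / (fact l * (real (sylv (?d - l + 1)) - 1)) = vol_bound ?d l / fact l"
    by (simp add: vol_bound_def)
  have fin: "finite ?F" unfolding S using finite_faces_of_dim_simplex[OF indep] by (rule finite_imageI)
  \<comment> \<open>A face of dimension \<open>l\<close> has to be exhibited, since
    \<open>Max\<close> of an empty set carries no information.\<close>
  have "{..<Suc l} \<subseteq> {..<Suc ?d}" using assms(4) by auto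
  then have "card (v ` {..<Suc l}) = Suc l" "v ` {..<Suc l} \<subseteq> C"
    using card_image[OF inj_on_subset[OF inj_v]] image_mono[of _ _ v] unfolding img_v[symmetric] by simp_all
  then have ne: "?F \<noteq> {}" unfolding S faces_of_dim_simplex[OF indep] by blast
  have le: "volZ F \<le> vol_bound ?d l / fact l" if F: "F \<in> faces_of_dim l S" for F
  proof -
    obtain K where K: "K \<subseteq> {..<Suc ?d}" "card K = Suc l" "F = convex hull (v ` K)"
      using F unfolding S by (rule faces_index)
    show ?thesis unfolding K(3) by (rule index_volZ_le(1)[OF K(1,2) assms(3,4)])
  qed
  have 1: "Max ?F \<le> vol_bound ?d l / fact l" using le Max_in[OF fin ne] by auto
  have 2: "Max ?F = vol_bound ?d l / fact l" if eq: "unimod_equiv S S_d_1"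
  proof (rule antisym[OF 1])
    obtain F where F: "F \<in> faces_of_dim l S" "volZ F = vol_bound ?d l / fact l"
      using S_d_1_face[OF eq assms(3,4)] unfolding bound_eq by blast
    show "vol_bound ?d l / fact l \<le> Max ?F" unfolding F(2)[symmetric] using fin F(1) by (intro Max_ge imageI)
  qed
  have 3: "unimod_equiv S S_d_1" if d4: "4 \<le> ?d" and l: "l = 1 \<or> l = ?d" and eq: "Max ?F = vol_bound ?d l / fact l"
  proof -
    obtain F where F: "F \<in> faces_of_dim l S" "volZ F = vol_bound ?d l / fact l"
      using Max_in[OF fin ne] unfolding eq by auto
    obtain K where K: "K \<subseteq> {..<Suc ?d}" "card K = Suc l" "F = convex hull (v ` K)"
      using F(1) unfolding S by (rule faces_index)
    show ?thesis
    proof (cases "l = 1")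
      case True
      have "card K = 2" "volZ (convex hull (v ` K)) = vol_bound ?d 1" using K(2,3) F(2) True by simp_all
      then show ?thesis unfolding S by (rule extremal_edge[OF K(1)])
    next
      case False
      then have ld: "l = ?d" using l by simp
      have "K = {..<Suc ?d}" using card_subset_eq[OF _ K(1)] K(2) ld by simp
      then have "F = S" using K(3) unfolding S img_v[symmetric] by simp
      then have "volZ (convex hull C) = vol_bound ?d ?d / fact ?d" using F(2) unfolding S ld by simp
      then show ?thesis unfolding S by (rule extremal_full[OF d4])
    qed
  qed
  have 4: "measure lebesgue S \<le> 2 / fact ?d * (real (sylv ?d) - 1)^2"
    using lebesgue_bound unfolding S by (simp add: vol_bound_def sylv_1)
  show ?thesis unfolding bound_eq using 1 2 3 4 by blast
qed

end
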